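(* Let $\mathcal J$ be a finite set with $n_0:=\#\mathcal J\ge2$. Suppose that for some stopping times $S,T$ we have a family of nonnegative processes $\{\varrho^{\mathbf j}_t;S\le t<T\}_{\mathbf j\in\mathcal J}$ defined on $\{S<T\}$ such that $$\sum_{\mathbf j\in\mathcal J}\varrho^{\mathbf j}_t=\sum_{\mathbf j\in\mathcal J}\varrho^{\mathbf j}_S+\int_S^t\sum_{\mathbf j\in\mathcal J}\frac{\mu_{\mathbf j}(r)}{\varrho^{\mathbf j}_r}\,\mathrm dr+\sum_{\mathbf j\in\mathcal J}(\mathcal B^{\mathbf j}_t-\mathcal B^{\mathbf j}_S),\quad\forall\,S\le t<T,$$ $$\int_S^t\sum_{\mathbf j\in\mathcal J}\frac{\mathrm dr}{\varrho^{\mathbf j}_r}<\infty,\quad\forall\,S\le t<T,$$ and the following conditions are satisfied by $\{\mu_{\mathbf j}(s);S\le s<T\}_{\mathbf j\in\mathcal J}$ and $\{\mathcal B^{\mathbf j}_t\}_{\mathbf j\in\mathcal J}$: (a) The $\mu_{\mathbf j}(s)$ are bounded and progressively measurable, and for some constant $\alpha\ge0$ satisfying $$\frac{n_0^2(1-2\alpha)}{n_0+\frac{n_0(n_0-1)}2}\ge1,$$ a.s. on $\{S<T\}$ we have $\mu_{\mathbf j}(s)=\mu_{\mathbf j}(s,\omega)\ge(1-2\alpha)/2>0$ for a.e. $s\in[S,T)$ and all $\mathbf j\in\mathcal J$. (b) $\{\mathcal B^{\mathbf j}_t\}_{\mathbf j\in\mathcal J}$ consists of one-dimensional standard Brownian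 motions satisfying $$\langle\mathcal B^{\mathbf j},\mathcal B^{\mathbf k}\rangle_t-\langle\mathcal B^{\mathbf j},\mathcal B^{\mathbf k}\rangle_S=\frac12\int_S^t\sigma_{\mathbf j,\mathbf k}(s)\,\mathrm ds,\quad\forall\,S\le t<T,\ \mathbf j\ne\mathbf k,$$ for progressively measurable $\sigma_{\mathbf j,\mathbf k}(s)=\sigma_{\mathbf j,\mathbf k}(s,\omega)$ with $\operatorname{ess\,sup}\{|\sigma_{\mathbf j,\mathbf k}(s,\omega)|;s\in[S,T)\}\le1$ a.s. on $\{S<T\}$. Define a process $\{\varrho_t;S\le t\le T\}$ on $\{S<T\}$ by $\varrho_t:=\sum_{\mathbf j\in\mathcal J}\varrho^{\mathbf j}_t$ for $S\le t<T$, and $\varrho_T:=\lim_{s\nearrow T}\varrho_s\in[0,\infty]$ if $T<\infty$. Then $$\mathbb P\big(\varrho_t>0\text{ for all }t\in(S,T],\ S<T\big)=\mathbb P(S<T).$$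
   Context: Everything is defined on one filtered probability space: $S,T$ are stopping times with values in $[0,\infty]$, the processes $\varrho^{\mathbf j}$ are adapted (progressively measurable), and the $\mathcal B^{\mathbf j}$ are Brownian motions with respect to the filtration. All time variables take values only in $\mathbb R_+=[0,\infty)$; thus "$t\in(S,T]$" means $t\in(S,\infty)$ on $\{T=\infty\}$. The limit defining $\varrho_T$ exists in $[0,\infty]$ because the finite-variation part in the first equation is nondecreasing. *)

theory Defs
  imports "HOL-Probability.Probability"
begin

text \<open>
  The filtration is indexed by \<open>[0,\<infinity>]\<close>, so that the library notion \<^const>\<open>stopping_time\<close> covers
  stopping times with values in \<open>[0,\<infinity>]\<close>. The \<open>\<sigma>\<close>-algebra \<open>F \<infinity>\<close> is an arbitrary one lying between
  all the \<open>F t\<close>, \<open>t < \<infinity>\<close>, and \<open>M\<close>; it enters only through \<open>{T \<le> \<infinity>} \<in> F \<infinity>\<close>, which is trivial.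
  Processes have real time; only times \<open>t \<ge> 0\<close> matter. The usual conditions are not assumed.
\<close>

locale filtered_prob_space = prob_space M + filtration "space M" F
  for M :: "'a measure" and F :: "ennreal \<Rightarrow> 'a measure" +
  assumes subalgebra_F: "\<And>t. subalgebra M (F t)"

definition martingale :: "'a measure \<Rightarrow> (ennreal \<Rightarrow> 'a measure) \<Rightarrow> (real \<Rightarrow> 'a \<Rightarrow> real) \<Rightarrow> bool" where
  "martingale M F X \<longleftrightarrow>
     (\<forall>t\<ge>0. X t \<in> borel_measurable (F (ennreal t)) \<and> integrable M (X t)) \<and>
     (\<forall>s\<ge>0. \<forall>t\<ge>s. AE \<omega> in M. real_cond_exp M (F (ennreal s)) (X t) \<omega> = X s \<omega>)"

definition brownian_motion ::
  "'a measure \<Rightarrow> (ennreal \<Rightarrow> 'a measure) \<Rightarrow> (real \<Rightarrow> 'a \<Rightarrow> real) \<Rightarrow> bool" where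
  "brownian_motion M F X \<longleftrightarrow>
     (\<forall>t\<ge>0. X t \<in> borel_measurable (F (ennreal t))) \<and>
     (AE \<omega> in M. X 0 \<omega> = 0) \<and>
     (AE \<omega> in M. continuous_on {0..} (\<lambda>t. X t \<omega>)) \<and>
     (\<forall>s\<ge>0. \<forall>t>s.
        distributed M lborel (\<lambda>\<omega>. X t \<omega> - X s \<omega>) (normal_density 0 (sqrt (t - s))) \<and>
        prob_space.indep_set M (sets (F (ennreal s)))
          {(\<lambda>\<omega>. X t \<omega> - X s \<omega>) -` A \<inter> space M | A. A \<in> sets borel})"

definition locally_finite_variation :: "(real \<Rightarrow> real) \<Rightarrow> bool" where
  "locally_finite_variation f \<longleftrightarrow>
     (\<forall>t\<ge>0. \<exists>C. \<forall>(n::nat) p. mono p \<and> 0 \<le> p 0 \<and> p n \<le> t \<longrightarrow>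
        (\<Sum>i<n. \<bar>f (p (Suc i)) - f (p i)\<bar>) \<le> C)"

text \<open>
  \<open>covariation M F X Y A\<close> says that \<open>A\<close> is (a version of) the bracket \<open>\<langle>X,Y\<rangle>\<close> of continuous
  square-integrable martingales \<open>X\<close>, \<open>Y\<close>: the adapted, continuous process of finite variation
  with \<open>A 0 = 0\<close> for which \<open>X Y - A\<close> is a martingale. Up to indistinguishability there is exactly
  one such process.
\<close>

definition covariation ::
  "'a measure \<Rightarrow> (ennreal \<Rightarrow> 'a measure) \<Rightarrow> (real \<Rightarrow> 'a \<Rightarrow> real) \<Rightarrow> (real \<Rightarrow> 'a \<Rightarrow> real) \<Rightarrow>
   (real \<Rightarrow> 'a \<Rightarrow> real) \<Rightarrow> bool" where
  "covariation M F X Y A \<longleftrightarrow>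
     (\<forall>t\<ge>0. A t \<in> borel_measurable (F (ennreal t))) \<and>
     (AE \<omega> in M. A 0 \<omega> = 0) \<and>
     (AE \<omega> in M. continuous_on {0..} (\<lambda>t. A t \<omega>)) \<and>
     (AE \<omega> in M. locally_finite_variation (\<lambda>t. A t \<omega>)) \<and>
     martingale M F (\<lambda>t \<omega>. X t \<omega> * Y t \<omega> - A t \<omega>)"

text \<open>The finite times in \<open>[S,T)\<close>; the set is empty unless \<open>S < T\<close>. The condition \<open>0 \<le> t\<close> is
  needed because \<^const>\<open>ennreal\<close> maps negative numbers to \<open>0\<close>.\<close>

definition active_times :: "('a \<Rightarrow> ennreal) \<Rightarrow> ('a \<Rightarrow> ennreal) \<Rightarrow> 'a \<Rightarrow> real set" where
  "active_times S T \<omega> = {t. 0 \<le> t \<and> S \<omega> \<le> ennreal t \<and> ennreal t < T \<omega>}"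

text \<open>
  Progressive measurability of a process \<open>{X t; S \<le> t < T}\<close> defined on \<open>{S < T}\<close>, which is
  represented by a total function whose values off \<open>[S,T)\<close> are irrelevant: its extension by \<open>0\<close>
  is progressively measurable. (The random interval \<open>[S,T)\<close> is itself a progressive set.)
\<close>

definition progressive_on ::
  "(ennreal \<Rightarrow> 'a measure) \<Rightarrow> ('a \<Rightarrow> ennreal) \<Rightarrow> ('a \<Rightarrow> ennreal) \<Rightarrow> (real \<Rightarrow> 'a \<Rightarrow> real) \<Rightarrow> bool" where
  "progressive_on F S T X \<longleftrightarrow>
     (\<forall>u\<ge>0. (\<lambda>(t, \<omega>). if t \<in> active_times S T \<omega> then X t \<omega> else 0)
        \<in> borel_measurable (restrict_space borel {0..u} \<Otimes>\<^sub>M F (ennreal u)))"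

text \<open>The process \<open>\<Sum>\<^sub>j \<rho>\<^sub>j\<close> on \<open>[S,T)\<close>, extended to \<open>t = T < \<infinity>\<close> by its left limit in \<open>[0,\<infinity>]\<close>.\<close>

definition total_process ::
  "'j set \<Rightarrow> ('a \<Rightarrow> ennreal) \<Rightarrow> ('j \<Rightarrow> real \<Rightarrow> 'a \<Rightarrow> real) \<Rightarrow> real \<Rightarrow> 'a \<Rightarrow> ennreal" where
  "total_process J T \<rho> t \<omega> =
     (if ennreal t < T \<omega> then ennreal (\<Sum>j\<in>J. \<rho> j t \<omega>)
      else Lim (at_left t) (\<lambda>s. ennreal (\<Sum>j\<in>J. \<rho> j s \<omega>)))"

end

theory Submission
  imports Defs
begin

text \<open>
  Write \<open>X\<close> for the sum of the \<open>\<rho> j\<close>, \<open>N\<close> for the sum of the Brownian motions and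
  \<open>n\<close> for \<open>card J\<close>. The bracket of \<open>N\<close> grows on \<open>[S,T)\<close> at rate at most
  \<open>q = n + n (n - 1) / 2\<close>: each Brownian motion contributes \<open>1\<close>, each ordered pair of
  different indices at most \<open>1/2\<close>. Since \<open>1 / x\<close> is convex, \<open>\<Sum> 1 / \<rho> j \<ge> n\<^sup>2 / X\<close>, so
  that the lower bound on the \<open>\<mu> j\<close> and the condition on \<open>\<alpha>\<close> make the drift of \<open>X\<close> at
  least \<open>q / (2 X)\<close>. This is the drift of a two-dimensional Bessel process whose noise has
  the rate \<open>q\<close>, exactly the critical strength: the second-order term
  \<open>- d\<langle>N\<rangle> / (2 X\<^sup>2)\<close> in the expansion of \<open>ln X\<close> is compensated by the drift term, and \<open>ln X\<close>
  is a local submartingale. Started at level \<open>\<epsilon>\<close>, it reaches \<open>ln \<delta>\<close> before leaving through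
  \<open>ln K\<close> with a probability that is of order \<open>1 / ln (1 / \<delta>)\<close>, and this tends to \<open>0\<close> with
  \<open>\<delta>\<close>.

  The expansion of \<open>ln X\<close> is carried out on a time grid of mesh \<open>h\<close> instead of by stochastic
  calculus. While \<open>X\<close> stays in \<open>(\<delta>, K)\<close> at the grid points, its next value is compared with
  the Euler predictor \<open>X + q h / (2 X) + \<Delta>N\<close>, and Taylor's formula for a truncated logarithm is
  integrated with the help of \<open>E[Y \<Delta>N] = 0\<close>, \<open>E[Y (\<Delta>N)\<^sup>2] = E[Y \<Delta>\<langle>N\<rangle>]\<close> and a bound on the
  fourth moment of \<open>\<Delta>N\<close>. Besides the Taylor remainder two errors occur. One is the amount by
  which \<open>X\<close> falls short of the predictor; it vanishes in the limit because \<open>1 / X\<close>, cut off at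
  \<open>1 / \<delta>\<close>, is uniformly continuous up to \<open>T\<close> on each path. The other is the growth of the
  bracket in the one step of the grid that contains \<open>T\<close>, where nothing is known about the
  rate; it vanishes because the bracket is continuous and, being a submartingale, uniformly
  integrable along the grid approximations of \<open>T\<close>.

  The lemma \<open>prob_hit_le\<close> is the resulting estimate on a grid, \<open>left_limit_nonzero\<close> is its
  consequence for a process that has a positive level at a deterministic time. Finally, as
  \<open>\<integral> 1 / \<rho> j\<close> is finite, \<open>X\<close> is positive at almost every time, hence by continuity at rational
  times arbitrarily close to \<open>S\<close>, and countably many applications of \<open>left_limit_nonzero\<close> give
  the theorem.
\<close>

section \<open>Truncated logarithms and elementary inequalities\<close>

text \<open>
  The derivatives of \<open>ln (1 + z) - z + z\<^sup>2 / 2\<close> and of the same function minus \<open>z ^ 3\<close> are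
  \<open>z\<^sup>2 / (1 + z)\<close> and \<open>z\<^sup>2 (1 / (1 + z) - 3)\<close>; the first is nonnegative for \<open>z \<ge> 0\<close>, the second
  nonpositive on \<open>[-1/2, 0]\<close>.
\<close>

lemma ln_one_plus_ge_cubic:
  fixes z :: real
  assumes "-1/2 \<le> z"
  shows "z - z\<^sup>2 / 2 - \<bar>z\<bar> ^ 3 \<le> ln (1 + z)"
proof (cases "0 \<le> z")
  case True
  define g :: "real \<Rightarrow> real" where "g = (\<lambda>z. ln (1 + z) - z + z\<^sup>2 / 2)"
  have "g 0 \<le> g z"
  proof (rule DERIV_nonneg_imp_nondecreasing[OF True])
    fix x :: real assume x: "0 \<le> x" "x \<le> z"
    have "(g has_real_derivative x\<^sup>2 / (1 + x)) (at x)"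
      unfolding g_def using x by (auto intro!: derivative_eq_intros simp: field_simps power2_eq_square)
    then show "\<exists>y. (g has_real_derivative y) (at x) \<and> 0 \<le> y"
      using x by (intro exI[of _ "x\<^sup>2 / (1 + x)"]) auto
  qed
  then have "0 \<le> ln (1 + z) - z + z\<^sup>2 / 2" by (simp add: g_def)
  moreover have "0 \<le> \<bar>z\<bar> ^ 3" by simp
  ultimately show ?thesis by linarith
next
  case False
  define g :: "real \<Rightarrow> real" where "g = (\<lambda>z. ln (1 + z) - z + z\<^sup>2 / 2 - z ^ 3)"
  have "g 0 \<le> g z"
  proof (rule DERIV_nonpos_imp_nonincreasing[where f = g and a = z and b = 0])
    show "z \<le> 0" using False by simp
    fix x :: real assume x: "z \<le> x" "x \<le> 0"
    then have x1: "1 / 2 \<le> 1 + x" using assms by linarith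
    have "(g has_real_derivative x\<^sup>2 * (1 / (1 + x) - 3)) (at x)"
      unfolding g_def using x1 by (auto intro!: derivative_eq_intros simp: field_simps power2_eq_square)
    moreover have "x\<^sup>2 * (1 / (1 + x) - 3) \<le> 0"
      using x1 by (intro mult_nonneg_nonpos) (auto simp: field_simps)
    ultimately show "\<exists>y. (g has_real_derivative y) (at x) \<and> y \<le> 0" by blast
  qed
  moreover have "\<bar>z\<bar> ^ 3 = - (z ^ 3)" using False by (simp add: power3_eq_cube)
  ultimately show ?thesis by (simp add: g_def)
qed

text \<open>
  The Euler predictor may leave every interval and even become negative. Truncation makes the
  logarithm bounded and Lipschitz on the whole line while it stays monotone.
\<close>

definition clipped_ln :: "real \<Rightarrow> real \<Rightarrow> real \<Rightarrow> real" where
  "clipped_ln a b y = ln (max a (min y b))"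

lemma clipped_ln_bounds:
  assumes "0 < a" "a \<le> b"
  shows "ln a \<le> clipped_ln a b y" "clipped_ln a b y \<le> ln b"
  using assms by (auto simp: clipped_ln_def)

lemma clipped_ln_eq: "a \<le> y \<Longrightarrow> y \<le> b \<Longrightarrow> clipped_ln a b y = ln y"
  by (simp add: clipped_ln_def)

lemma clipped_ln_mono: "0 < a \<Longrightarrow> a \<le> b \<Longrightarrow> x \<le> y \<Longrightarrow> clipped_ln a b x \<le> clipped_ln a b y"
  unfolding clipped_ln_def by (subst ln_le_cancel_iff) auto

lemma clipped_ln_add_le:
  assumes a: "0 < a" "a \<le> b" and e: "0 \<le> e"
  shows "clipped_ln a b (x + e) \<le> clipped_ln a b x + e / a"
proof -
  define m where "m = max a (min x b)"
  have m: "a \<le> m" using a by (simp add: m_def)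
  have "clipped_ln a b (x + e) \<le> ln (m + e)"
    unfolding clipped_ln_def m_def using a e by (subst ln_le_cancel_iff) auto
  also have "\<dots> = ln (m * (1 + e / m))" using m a by (simp add: distrib_left)
  also have "\<dots> = ln m + ln (1 + e / m)" 
  proof -
    have "0 \<le> e / m" using m a e by simp
    then have "0 < 1 + e / m" by linarith
    then show ?thesis using m a by (simp only: ln_mult_pos)
  qed
  also have "ln (1 + e / m) \<le> e / m" using m a e by (intro ln_add_one_self_le_self) auto
  also have "e / m \<le> e / a" using m a e by (intro divide_left_mono) auto
  finally show ?thesis by (simp add: m_def clipped_ln_def)
qed

text \<open>
  The second-order expansion at a point of \<open>[\<delta>, K]\<close> holds for all increments, however large,
  once the cubic term has a large coefficient: for \<open>z \<ge> 1\<close> the left-hand side is negative and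
  monotonicity suffices; for \<open>-1/2 \<le> z \<le> 1\<close> the truncation is not active; and for \<open>z \<le> -1/2\<close>
  the cubic term alone exceeds the largest possible loss \<open>ln K - ln (\<delta> / 2)\<close>.
\<close>

lemma clipped_ln_taylor:
  fixes \<delta> K x y :: real
  assumes \<delta>: "0 < \<delta>" and x: "\<delta> \<le> x" "x \<le> K"
  defines "z \<equiv> (y - x) / x"
  shows "z - z\<^sup>2 / 2 - (8 * ln (2 * K / \<delta>) + 1) * \<bar>z\<bar> ^ 3
           \<le> clipped_ln (\<delta> / 2) (2 * K) y - ln x"
proof -
  define C where "C = 8 * ln (2 * K / \<delta>) + 1"
  have "0 \<le> ln (2 * K / \<delta>)" using \<delta> x by (intro ln_ge_zero) (auto simp: field_simps)
  then have C: "1 \<le> C" by (simp add: C_def)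
  have x0: "0 < x" using \<delta> x by simp
  have y: "y = x * (1 + z)" using x0 by (simp add: z_def field_simps)
  have fx: "clipped_ln (\<delta> / 2) (2 * K) x = ln x" using \<delta> x by (intro clipped_ln_eq) auto
  consider "1 \<le> z" | "z \<le> -1/2" | "-1/2 \<le> z" "z \<le> 1" by linarith
  then have "z - z\<^sup>2 / 2 - C * \<bar>z\<bar> ^ 3 \<le> clipped_ln (\<delta> / 2) (2 * K) y - ln x"
  proof cases
    case 1
    then have "x \<le> y" using x0 by (simp add: y)
    then have "ln x \<le> clipped_ln (\<delta> / 2) (2 * K) y"
      using clipped_ln_mono[of "\<delta> / 2" "2 * K" x y] \<delta> x by (simp add: fx)
    moreover have "z ^ 1 \<le> z ^ 3" using 1 by (intro power_increasing) auto
    moreover have "1 * z ^ 3 \<le> C * z ^ 3" using C 1 by (intro mult_right_mono) auto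
    moreover have "0 \<le> z\<^sup>2" by simp
    moreover have "\<bar>z\<bar> ^ 3 = z ^ 3" using 1 by simp
    ultimately show ?thesis using 1 by (simp only: mult_1 power_one_right)
  next
    case 2
    have "(1/2) ^ 3 \<le> \<bar>z\<bar> ^ 3" using 2 by (intro power_mono) auto
    then have "C * (1 / 8) \<le> C * \<bar>z\<bar> ^ 3" using C by (intro mult_left_mono) (auto simp: power3_eq_cube)
    moreover have "0 \<le> z\<^sup>2" by simp
    moreover have "ln (2 * K / \<delta>) \<le> C * (1 / 8)" by (simp add: C_def)
    ultimately have "z - z\<^sup>2 / 2 - C * \<bar>z\<bar> ^ 3 \<le> - ln (2 * K / \<delta>)" using 2 by linarith
    also have "\<dots> = ln (\<delta> / 2) - ln K" using \<delta> x by (simp add: ln_div ln_mult)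
    also have "\<dots> \<le> clipped_ln (\<delta> / 2) (2 * K) y - ln x"
      using clipped_ln_bounds(1)[of "\<delta> / 2" "2 * K" y] \<delta> x by (intro diff_mono) auto
    finally show ?thesis .
  next
    case 3
    have yb: "\<delta> / 2 \<le> y" "y \<le> 2 * K"
      using mult_mono[of \<delta> x "1/2" "1 + z"] mult_mono[of x K "1 + z" 2] 3 \<delta> x x0
      by (auto simp: y)
    have "clipped_ln (\<delta> / 2) (2 * K) y = ln x + ln (1 + z)"
      using yb 3 x0 by (subst clipped_ln_eq) (auto simp: y ln_mult)
    moreover have "z - z\<^sup>2 / 2 - \<bar>z\<bar> ^ 3 \<le> ln (1 + z)" by (rule ln_one_plus_ge_cubic) (use 3 in simp)
    moreover have "1 * \<bar>z\<bar> ^ 3 \<le> C * \<bar>z\<bar> ^ 3" using C by (intro mult_right_mono) auto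
    ultimately show ?thesis by linarith
  qed
  then show ?thesis by (simp add: C_def)
qed

text \<open>
  Third absolute moments are estimated by fourth moments; the scale \<open>s\<close> will be the square root
  of the mesh, the order of magnitude of an increment of \<open>N\<close>.
\<close>

lemma abs_cube_le:
  fixes z s :: real
  assumes "0 < s"
  shows "\<bar>z\<bar> ^ 3 \<le> s ^ 3 + z ^ 4 / s"
proof (cases "\<bar>z\<bar> \<le> s")
  case True
  then have "\<bar>z\<bar> ^ 3 \<le> s ^ 3" by (intro power_mono) auto
  then show ?thesis using assms by (smt (verit) divide_nonneg_pos zero_le_even_power even_numeral)
next
  case False
  then have "s * \<bar>z\<bar> ^ 3 \<le> \<bar>z\<bar> * \<bar>z\<bar> ^ 3" using assms by (intro mult_right_mono) auto
  also have "\<dots> = z ^ 4" by (simp flip: power_Suc)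
  finally show ?thesis using assms by (smt (verit) pos_le_divide_eq mult.commute zero_less_power)
qed

lemma power4_add_le: "(a + b) ^ 4 \<le> 8 * (a ^ 4 + b ^ 4)" for a b :: real
proof -
  have sq: "(x + y)\<^sup>2 \<le> 2 * (x\<^sup>2 + y\<^sup>2)" for x y :: real
    using zero_le_power2[of "x - y"] by (simp add: power2_eq_square algebra_simps)
  have "((a + b)\<^sup>2)\<^sup>2 \<le> (2 * (a\<^sup>2 + b\<^sup>2))\<^sup>2" by (intro power_mono sq) auto
  also have "\<dots> = 4 * (a\<^sup>2 + b\<^sup>2)\<^sup>2" by (simp add: power2_eq_square algebra_simps)
  also have "\<dots> \<le> 4 * (2 * ((a\<^sup>2)\<^sup>2 + (b\<^sup>2)\<^sup>2))" by (intro mult_left_mono sq) auto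
  finally show ?thesis by simp
qed

text \<open>
  The function \<open>1 / x\<close> lies above its tangent at the arithmetic mean, and the linear parts of
  the tangents add up to zero.
\<close>

lemma sum_inverse_ge:
  fixes x :: "'j \<Rightarrow> real"
  assumes J: "finite J" "J \<noteq> {}" and x: "\<And>j. j \<in> J \<Longrightarrow> 0 < x j"
  shows "(real (card J))\<^sup>2 / (\<Sum>j\<in>J. x j) \<le> (\<Sum>j\<in>J. 1 / x j)"
proof -
  define X where "X = (\<Sum>j\<in>J. x j)"
  define m where "m = X / card J"
  have X: "0 < X" unfolding X_def using J x by (intro sum_pos) auto
  have c: "0 < real (card J)" using J by (simp add: card_gt_0_iff)
  then have m: "0 < m" using X by (simp add: m_def)
  have *: "2 / m - x j / m\<^sup>2 \<le> 1 / x j" if "j \<in> J" for j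
  proof -
    have "0 \<le> (x j - m)\<^sup>2" by simp
    then have "(2 * m - x j) * x j \<le> m\<^sup>2" by (simp add: power2_eq_square algebra_simps)
    then have "(2 * m - x j) / m\<^sup>2 \<le> 1 / x j" using x[OF that] m by (simp add: field_simps)
    then show ?thesis using m by (simp add: diff_divide_distrib power2_eq_square)
  qed
  have "(real (card J))\<^sup>2 / X = card J * (2 / m) - X / m\<^sup>2"
    using X c by (simp add: m_def field_simps power2_eq_square)
  also have "\<dots> = (\<Sum>j\<in>J. 2 / m - x j / m\<^sup>2)"
    by (simp add: sum_subtractf sum_divide_distrib[symmetric] X_def)
  also have "\<dots> \<le> (\<Sum>j\<in>J. 1 / x j)" by (intro sum_mono *)
  finally show ?thesis by (simp add: X_def)
qed

lemma sum_power4_le: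
  fixes x :: "'j \<Rightarrow> real"
  shows "(\<Sum>j\<in>J. x j) ^ 4 \<le> real (card J) ^ 3 * (\<Sum>j\<in>J. x j ^ 4)"
proof (cases "finite J")
  case True
  have "((\<Sum>j\<in>J. x j)\<^sup>2)\<^sup>2 \<le> (real (card J) * (\<Sum>j\<in>J. (x j)\<^sup>2))\<^sup>2"
    using sum_squared_le_sum_of_squares[of x J]
    by (intro power_mono) (auto simp: mult.commute)
  also have "\<dots> = (real (card J))\<^sup>2 * (\<Sum>j\<in>J. (x j)\<^sup>2)\<^sup>2" by (simp add: power_mult_distrib)
  also have "\<dots> \<le> (real (card J))\<^sup>2 * ((\<Sum>j\<in>J. ((x j)\<^sup>2)\<^sup>2) * real (card J))"
    using sum_squared_le_sum_of_squares[of "\<lambda>j. (x j)\<^sup>2" J]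
    by (intro mult_left_mono) (auto simp: mult.commute)
  finally show ?thesis
    by (simp add: power2_eq_square power3_eq_cube power4_eq_xxxx mult_ac)
qed auto

text \<open>
  Setting the value at \<open>v\<close> to the left limit gives a continuous function on a compact interval.
\<close>

lemma uniformly_continuous_on_left_limit:
  fixes g :: "real \<Rightarrow> real"
  assumes rv: "r < v" and cont: "continuous_on {r..<v} g" and lim: "(g \<longlongrightarrow> l) (at_left v)"
  shows "uniformly_continuous_on {r..<v} g"
proof -
  define g' where "g' = (\<lambda>x. if x = v then l else g x)"
  have "continuous_on {r..v} g'"
  proof (subst continuous_on_eq_continuous_within, intro ballI)
    fix x assume x: "x \<in> {r..v}"
    show "continuous (at x within {r..v}) g'"
    proof (cases "x = v")
      case True
      have "(g' \<longlongrightarrow> l) (at_left v)"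
        using lim by (rule Lim_transform_eventually)
          (auto simp: g'_def eventually_at_filter)
      then show ?thesis using True rv
        by (simp add: continuous_within g'_def at_within_Icc_at_left)
    next
      case False
      then have xv: "x < v" using x by auto
      have "continuous (at x within {r..<v}) g"
        using cont x xv by (auto simp: continuous_on_eq_continuous_within)
      then have "(g \<longlongrightarrow> g x) (at x within {r..<v})" by (simp add: continuous_within)
      then have "(g' \<longlongrightarrow> g x) (at x within {r..<v})"
        by (rule Lim_transform_eventually) (auto simp: g'_def eventually_at_filter)
      moreover have "at x within {r..v} = at x within {r..<v}"
        by (rule at_within_nhd[where S="{..<v}"]) (use xv in auto)
      ultimately show ?thesis using False by (simp add: continuous_within g'_def)
    qed
  qed
  then have "uniformly_continuous_on {r..v} g'" by (rule compact_uniformly_continuous) simp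
  then show ?thesis
    unfolding uniformly_continuous_on_def g'_def by (simp add: Ball_def) (smt (verit, best))
qed

text \<open>
  The left limit may be \<open>\<infinity>\<close>, since the drift may force the process to explode at \<open>T\<close>.
\<close>

abbreviation has_nonzero_left_limit :: "(real \<Rightarrow> real) \<Rightarrow> real \<Rightarrow> bool" where
  "has_nonzero_left_limit g t \<equiv>
     (\<exists>l. l \<noteq> 0 \<and> (g \<longlongrightarrow> l) (at_left t)) \<or> filterlim g at_top (at_left t)"

lemma mono_left_limit:
  fixes m :: "real \<Rightarrow> real"
  assumes rv: "r < v" and mono: "\<And>s t. r \<le> s \<Longrightarrow> s \<le> t \<Longrightarrow> t < v \<Longrightarrow> m s \<le> m t"
  shows "(\<exists>l. (m \<longlongrightarrow> l) (at_left v)) \<or> filterlim m at_top (at_left v)"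
proof -
  have ev: "eventually (\<lambda>t. s \<le> t \<and> t < v) (at_left v)" if "s < v" for s
    using that by (auto simp: eventually_at_left_field intro!: exI[of _ s])
  show ?thesis
  proof (cases "bdd_above (m ` {r..<v})")
    case True
    have "(m \<longlongrightarrow> (SUP t\<in>{r..<v}. m t)) (at_left v)"
    proof (rule increasing_tendsto)
      show "eventually (\<lambda>t. m t \<le> (SUP t\<in>{r..<v}. m t)) (at_left v)"
        using ev[OF rv] by eventually_elim (use True in \<open>auto intro!: cSUP_upper\<close>)
      fix x assume "x < (SUP t\<in>{r..<v}. m t)"
      then obtain s where s: "s \<in> {r..<v}" "x < m s"
        using True rv by (subst (asm) less_cSUP_iff) auto
      then have "s < v" by simp
      from ev[OF this] show "eventually (\<lambda>t. x < m t) (at_left v)"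
        by eventually_elim (use s mono[of s] in fastforce)
    qed
    then show ?thesis by blast
  next
    case False
    have "filterlim m at_top (at_left v)"
      unfolding filterlim_at_top
    proof
      fix Z
      from False have "\<exists>s\<in>{r..<v}. Z < m s" by (auto simp: bdd_above_def not_le)
      then obtain s where s: "s \<in> {r..<v}" "Z < m s" by blast
      then have "s < v" by simp
      from ev[OF this] show "eventually (\<lambda>t. Z \<le> m t) (at_left v)"
        by eventually_elim (use s mono[of s] in fastforce)
    qed
    then show ?thesis ..
  qed
qed

section \<open>Processes with critical drift\<close>

lemma integrable_bounded_mult:
  fixes Y Z :: "'a \<Rightarrow> real"
  assumes "Y \<in> borel_measurable M" "\<And>\<omega>. \<bar>Y \<omega>\<bar> \<le> b" "integrable M Z"
  shows "integrable M (\<lambda>\<omega>. Y \<omega> * Z \<omega>)"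
proof (rule Bochner_Integration.integrable_bound[where f="\<lambda>\<omega>. b * Z \<omega>"])
  have "norm (Y \<omega> * Z \<omega>) \<le> norm (b * Z \<omega>)" for \<omega>
    using mult_right_mono[OF assms(2)[of \<omega>], of "\<bar>Z \<omega>\<bar>"] assms(2)[of \<omega>] by (simp add: abs_mult)
  then show "AE \<omega> in M. norm (Y \<omega> * Z \<omega>) \<le> norm (b * Z \<omega>)" by simp
qed (use assms in auto)

lemma (in filtered_prob_space) measurable_F_M:
  "f \<in> borel_measurable (F t) \<Longrightarrow> f \<in> borel_measurable M"
  by (rule measurable_from_subalg[OF subalgebra_F])

lemma (in filtered_prob_space) sets_F_M: "A \<in> sets (F t) \<Longrightarrow> A \<in> sets M"
  using subalgebra_F[of t] by (auto simp: subalgebra_def)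

lemma (in filtered_prob_space) measurable_F_mono:
  assumes "s \<le> t" "f \<in> borel_measurable (F s)"
  shows "f \<in> borel_measurable (F t)"
  using assms sets_F_mono[OF assms(1)] by (auto simp: measurable_def space_F)

text \<open>
  The abstract situation on a deterministic interval \<open>[r, u]\<close>: on the event \<open>\<Gamma>\<close>, which is known
  at time \<open>r\<close>, the process \<open>X\<close> lives up to the stopping time \<open>T\<close> and is driven by the
  square-integrable martingale \<open>N\<close> with bracket \<open>L\<close>. The last assumption expresses without an
  integral that the drift of \<open>X\<close> is at least \<open>q / (2 X)\<close>, where \<open>q\<close> bounds the growth rate of
  \<open>L\<close> before \<open>T\<close>. The rate of \<open>L\<close> is controlled only before \<open>T\<close>, whereas \<open>N\<close> and \<open>L\<close> exist on
  all of \<open>[r, u]\<close>.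
\<close>

locale critical_drift_process = filtered_prob_space M F
  for M :: "'a measure" and F :: "ennreal \<Rightarrow> 'a measure" +
  fixes T :: "'a \<Rightarrow> ennreal" and \<Gamma> :: "'a set" and X N L :: "real \<Rightarrow> 'a \<Rightarrow> real"
    and q c r u :: real
  assumes r_nonneg: "0 \<le> r" and r_less_u: "r < u" and q_pos: "0 < q"
    and T: "stopping_time F T"
    and \<Gamma>: "\<Gamma> \<in> sets (F (ennreal r))"
    and \<Gamma>_T: "\<And>\<omega>. \<omega> \<in> \<Gamma> \<Longrightarrow> ennreal r < T \<omega>"
    and X_adapted: "\<And>t. r \<le> t \<Longrightarrow> t \<le> u \<Longrightarrow>
      (\<lambda>\<omega>. if \<omega> \<in> \<Gamma> \<and> ennreal t < T \<omega> then X t \<omega> else 0) \<in> borel_measurable (F (ennreal t))"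
    and N_adapted: "\<And>t. r \<le> t \<Longrightarrow> t \<le> u \<Longrightarrow> N t \<in> borel_measurable (F (ennreal t))"
    and L_adapted: "\<And>t. r \<le> t \<Longrightarrow> t \<le> u \<Longrightarrow> L t \<in> borel_measurable (F (ennreal t))"
    and L_integrable: "\<And>t. r \<le> t \<Longrightarrow> t \<le> u \<Longrightarrow> integrable M (L t)"
    and N_fourth_integrable: "\<And>s t. r \<le> s \<Longrightarrow> s \<le> t \<Longrightarrow> t \<le> u \<Longrightarrow>
      integrable M (\<lambda>\<omega>. (N t \<omega> - N s \<omega>) ^ 4)"
    and N_fourth_le: "\<And>s t. r \<le> s \<Longrightarrow> s \<le> t \<Longrightarrow> t \<le> u \<Longrightarrow>
      expectation (\<lambda>\<omega>. (N t \<omega> - N s \<omega>) ^ 4) \<le> c * (t - s)\<^sup>2"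
    and N_martingale: "\<And>s t Y b. r \<le> s \<Longrightarrow> s \<le> t \<Longrightarrow> t \<le> u \<Longrightarrow> Y \<in> borel_measurable (F (ennreal s)) \<Longrightarrow>
      (\<And>\<omega>. \<bar>Y \<omega>\<bar> \<le> b) \<Longrightarrow> expectation (\<lambda>\<omega>. Y \<omega> * (N t \<omega> - N s \<omega>)) = 0"
    and N_bracket: "\<And>s t Y b. r \<le> s \<Longrightarrow> s \<le> t \<Longrightarrow> t \<le> u \<Longrightarrow> Y \<in> borel_measurable (F (ennreal s)) \<Longrightarrow>
      (\<And>\<omega>. \<bar>Y \<omega>\<bar> \<le> b) \<Longrightarrow>
      expectation (\<lambda>\<omega>. Y \<omega> * (N t \<omega> - N s \<omega>)\<^sup>2) = expectation (\<lambda>\<omega>. Y \<omega> * (L t \<omega> - L s \<omega>))"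
    and N_continuous: "AE \<omega> in M. continuous_on {r..u} (\<lambda>t. N t \<omega>)"
    and L_continuous: "AE \<omega> in M. continuous_on {r..u} (\<lambda>t. L t \<omega>)"
    and X_continuous: "AE \<omega> in M. \<omega> \<in> \<Gamma> \<longrightarrow>
      continuous_on {t \<in> {r..u}. ennreal t < T \<omega>} (\<lambda>t. X t \<omega>)"
    and L_growth: "AE \<omega> in M. \<omega> \<in> \<Gamma> \<longrightarrow> (\<forall>s t. r \<le> s \<longrightarrow> s \<le> t \<longrightarrow> t \<le> u \<longrightarrow> ennreal t < T \<omega> \<longrightarrow>
      \<bar>L t \<omega> - L s \<omega>\<bar> \<le> q * (t - s))"
    and X_growth: "AE \<omega> in M. \<omega> \<in> \<Gamma> \<longrightarrow> (\<forall>s t b. r \<le> s \<longrightarrow> s \<le> t \<longrightarrow> t \<le> u \<longrightarrow> ennreal t < T \<omega> \<longrightarrow>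
      0 < b \<longrightarrow> (\<forall>v\<in>{s..t}. X v \<omega> \<le> b) \<longrightarrow>
      N t \<omega> - N s \<omega> + q / (2 * b) * (t - s) \<le> X t \<omega> - X s \<omega>)"
begin

definition mesh :: "nat \<Rightarrow> real" where "mesh n = (u - r) / real n"

definition grid :: "nat \<Rightarrow> nat \<Rightarrow> real" where "grid n i = r + real i * mesh n"

lemma mesh_pos: "0 < n \<Longrightarrow> 0 < mesh n"
  using r_less_u by (simp add: mesh_def)

lemma grid_0 [simp]: "grid n 0 = r"
  by (simp add: grid_def)

lemma grid_Suc: "grid n (Suc i) = grid n i + mesh n"
  by (simp add: grid_def algebra_simps)

lemma mesh_nonneg: "0 \<le> mesh n"
  using r_less_u by (simp add: mesh_def)

lemma grid_mono: "i \<le> j \<Longrightarrow> grid n i \<le> grid n j"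
  using mesh_nonneg[of n] by (simp add: grid_def mult_right_mono)

lemma grid_ge: "r \<le> grid n i"
  using grid_mono[of 0 i n] by simp

lemma grid_le:
  assumes "i \<le> n" shows "grid n i \<le> u"
proof (cases "n = 0")
  case False
  have "real i * mesh n \<le> real n * mesh n"
    using assms mesh_nonneg[of n] by (intro mult_right_mono) auto
  also have "\<dots> = u - r" using False by (simp add: mesh_def)
  finally show ?thesis by (simp add: grid_def)
qed (use assms r_less_u in \<open>auto simp: grid_def mesh_def\<close>)

end

text \<open>
  The process is observed at the grid points until it leaves the strip \<open>(\<delta>, K)\<close>.
\<close>

locale barrier_strip = critical_drift_process +
  fixes \<delta> K :: real
  assumes \<delta>: "0 < \<delta>" and \<delta>K: "\<delta> < K"
begin

text \<open>
  The event that the observation is still going on at the \<open>i\<close>-th grid point. It is known at that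
  time, and it contains the condition that \<open>T\<close> has not yet come.
\<close>

definition active :: "nat \<Rightarrow> nat \<Rightarrow> 'a set" where
  "active n i = {\<omega> \<in> \<Gamma>. \<forall>k\<le>i. ennreal (grid n k) < T \<omega> \<and> \<delta> < X (grid n k) \<omega> \<and> X (grid n k) \<omega> < K}"

text \<open>
  The observation has ended before or at the \<open>i\<close>-th grid point by a value at or below \<open>\<delta>\<close>, as
  opposed to a value at or above \<open>K\<close> or to the end of the lifetime.
\<close>

definition hit :: "nat \<Rightarrow> nat \<Rightarrow> 'a set" where
  "hit n i = {\<omega>. \<exists>k<i. \<omega> \<in> active n k \<and> ennreal (grid n (Suc k)) < T \<omega> \<and> X (grid n (Suc k)) \<omega> \<le> \<delta>}"

text \<open>
  One step of the Euler scheme for the equation with drift \<open>q / (2 X)\<close>. Unlike the next value of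
  \<open>X\<close> it is defined also if \<open>T\<close> occurs during the step.
\<close>

definition predictor :: "nat \<Rightarrow> nat \<Rightarrow> 'a \<Rightarrow> real" where
  "predictor n i \<omega> = X (grid n i) \<omega> + q * mesh n / (2 * X (grid n i) \<omega>)
     + (N (grid n (Suc i)) \<omega> - N (grid n i) \<omega>)"

text \<open>
  The two errors besides the Taylor remainder: how far \<open>X\<close> falls short of the predictor in a step
  that it survives, and the growth of the bracket in the step during which \<open>T\<close> occurs.
\<close>

definition deficit :: "nat \<Rightarrow> nat \<Rightarrow> 'a \<Rightarrow> real" where
  "deficit n i \<omega> = (if \<omega> \<in> active n i \<and> ennreal (grid n (Suc i)) < T \<omega>
     then max 0 (predictor n i \<omega> - X (grid n (Suc i)) \<omega>) else 0)"

definition overshoot :: "nat \<Rightarrow> nat \<Rightarrow> 'a \<Rightarrow> real" where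
  "overshoot n i \<omega> = (if \<omega> \<in> active n i \<and> \<not> ennreal (grid n (Suc i)) < T \<omega>
     then max 0 (L (grid n (Suc i)) \<omega> - L (grid n i) \<omega>) else 0)"

abbreviation f :: "real \<Rightarrow> real" where "f \<equiv> clipped_ln (\<delta> / 2) (2 * K)"

text \<open>
  A version of \<open>X t\<close> that is measurable at time \<open>t\<close>; it equals \<open>X t\<close> wherever it is needed.
\<close>

definition stopped_X :: "real \<Rightarrow> 'a \<Rightarrow> real" where
  "stopped_X t \<omega> = (if \<omega> \<in> \<Gamma> \<and> ennreal t < T \<omega> then X t \<omega> else 0)"

lemma stopped_X_measurable: "r \<le> t \<Longrightarrow> t \<le> u \<Longrightarrow> stopped_X t \<in> borel_measurable (F (ennreal t))"
  using X_adapted[of t] by (simp add: stopped_X_def[abs_def])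

lemma active_D:
  assumes "\<omega> \<in> active n i" "k \<le> i"
  shows "\<omega> \<in> \<Gamma>" "ennreal (grid n k) < T \<omega>" "\<delta> < X (grid n k) \<omega>" "X (grid n k) \<omega> < K"
    "stopped_X (grid n k) \<omega> = X (grid n k) \<omega>"
  using assms by (auto simp: active_def stopped_X_def)

lemma \<Gamma>_mono: "r \<le> t \<Longrightarrow> \<Gamma> \<in> sets (F (ennreal t))"
  using \<Gamma> sets_F_mono[of "ennreal r" "ennreal t"] by (auto simp: ennreal_leI)

lemma \<Gamma>_space: "\<Gamma> \<subseteq> space M"
  using sets.sets_into_space[OF \<Gamma>] by (simp add: space_F)

lemma less_T_sets: "{\<omega> \<in> space M. ennreal t < T \<omega>} \<in> sets (F (ennreal t))"
  using stopping_timeD2[OF T, of "ennreal t"] by (simp add: pred_def space_F)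

lemma active_sets:
  assumes "i \<le> n" shows "active n i \<in> sets (F (ennreal (grid n i)))"
proof -
  have *: "{\<omega> \<in> \<Gamma>. ennreal (grid n k) < T \<omega> \<and> \<delta> < X (grid n k) \<omega> \<and> X (grid n k) \<omega> < K}
      \<in> sets (F (ennreal (grid n i)))" if "k \<le> i" for k
  proof -
    have [measurable]: "stopped_X (grid n k) \<in> borel_measurable (F (ennreal (grid n k)))"
      using that assms by (intro stopped_X_measurable grid_ge grid_le) auto
    have "{\<omega> \<in> space (F (ennreal (grid n k))). \<delta> < stopped_X (grid n k) \<omega> \<and> stopped_X (grid n k) \<omega> < K}
        \<in> sets (F (ennreal (grid n k)))" by measurable
    moreover have "{\<omega> \<in> \<Gamma>. ennreal (grid n k) < T \<omega> \<and> \<delta> < X (grid n k) \<omega> \<and> X (grid n k) \<omega> < K} =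
       {\<omega> \<in> space (F (ennreal (grid n k))). \<delta> < stopped_X (grid n k) \<omega> \<and> stopped_X (grid n k) \<omega> < K}"
      using \<Gamma>_space \<delta> by (auto simp: stopped_X_def space_F split: if_splits)
    ultimately show ?thesis
      using sets_F_mono[of "ennreal (grid n k)" "ennreal (grid n i)"] grid_mono[OF that]
      by (auto simp: ennreal_leI)
  qed
  have "active n i = (\<Inter>k\<in>{..i}.
      {\<omega> \<in> \<Gamma>. ennreal (grid n k) < T \<omega> \<and> \<delta> < X (grid n k) \<omega> \<and> X (grid n k) \<omega> < K})"
    by (auto simp: active_def)
  also have "\<dots> \<in> sets (F (ennreal (grid n i)))"
    by (rule sets.finite_INT) (use * in auto)
  finally show ?thesis .
qed

lemma active_not_hit:
  assumes "\<omega> \<in> active n i" shows "\<omega> \<notin> hit n i"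
proof
  assume "\<omega> \<in> hit n i"
  then obtain k where "k < i" "X (grid n (Suc k)) \<omega> \<le> \<delta>" by (auto simp: hit_def)
  then show False using active_D(3)[OF assms, of "Suc k"] by simp
qed

text \<open>
  The value \<open>\<Phi> i\<close> is the logarithm of \<open>X\<close> while the observation goes on and is frozen
  afterwards: at \<open>ln \<delta>\<close> after a hit, at the upper bound \<open>ln (2 K)\<close> of the truncated logarithm
  after any other exit. Each increment of \<open>\<Phi>\<close> dominates that of the truncated logarithm along
  the predictor up to the Lipschitz constant \<open>2 / \<delta>\<close> times the deficit.
\<close>

lemma telescope:
  assumes \<omega>: "\<omega> \<in> \<Gamma>" and \<epsilon>: "\<delta> < \<epsilon>" "\<epsilon> \<le> K" "\<epsilon> \<le> X r \<omega>"
  shows "(\<Sum>i<m. indicator (active n i) \<omega> * (f (predictor n i \<omega>) - ln (X (grid n i) \<omega>)) - 2 / \<delta> * deficit n i \<omega>)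
     \<le> ln (2 * K) - ln \<epsilon> - (ln (2 * K) - ln \<delta>) * indicator (hit n m) \<omega>"
proof -
  define \<Phi> where "\<Phi> i = (if \<omega> \<in> active n i then ln (X (grid n i) \<omega>)
    else if \<omega> \<in> hit n i then ln \<delta> else ln (2 * K))" for i
  have f_le: "f y \<le> ln (2 * K)" for y
    by (rule clipped_ln_bounds) (use \<delta> \<delta>K in auto)
  have f_mono: "f x \<le> f (y + e) \<and> f (y + e) \<le> f y + 2 / \<delta> * e" if "x \<le> y + e" "0 \<le> e" for x y e
    using clipped_ln_add_le[of "\<delta>/2" "2 * K" e y] clipped_ln_mono[of "\<delta>/2" "2 * K" x "y + e"] that \<delta> \<delta>K
    by (auto simp: mult.commute)
  have f_ln: "f x = ln x" if "\<delta> \<le> x" "x \<le> K" for x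
    using that \<delta> \<delta>K by (intro clipped_ln_eq) auto
  have d0: "0 \<le> deficit n i \<omega>" for i by (simp add: deficit_def)
  have step: "indicator (active n i) \<omega> * (f (predictor n i \<omega>) - ln (X (grid n i) \<omega>)) - 2 / \<delta> * deficit n i \<omega>
       \<le> \<Phi> (Suc i) - \<Phi> i" for i
  proof (cases "\<omega> \<in> active n i")
    case False
    then have "\<omega> \<notin> active n (Suc i)" unfolding active_def using le_SucI by blast
    moreover have "\<omega> \<in> hit n (Suc i) \<longleftrightarrow> \<omega> \<in> hit n i"
      using False by (auto simp: hit_def less_Suc_eq)
    ultimately have "\<Phi> (Suc i) = \<Phi> i" using False by (simp add: \<Phi>_def)
    then show ?thesis using False d0[of i] \<delta> by (simp add: deficit_def)
  next
    case True
    define t where "t = grid n (Suc i)"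
    have "f (predictor n i \<omega>) - 2 / \<delta> * deficit n i \<omega> \<le> \<Phi> (Suc i)"
    proof (cases "ennreal t < T \<omega> \<and> X t \<omega> < K")
      case live: True
      have le: "predictor n i \<omega> \<le> X t \<omega> + deficit n i \<omega>"
        using True live by (simp add: deficit_def t_def)
      show ?thesis
      proof (cases "X t \<omega> \<le> \<delta>")
        case False
        then have "\<omega> \<in> active n (Suc i)" using True live by (auto simp: active_def t_def le_Suc_eq)
        then show ?thesis using f_mono[OF le d0] f_ln[of "X t \<omega>"] False live by (simp add: \<Phi>_def t_def)
      next
        case low: True
        then have "\<omega> \<notin> active n (Suc i)" "\<omega> \<in> hit n (Suc i)"
          using True live by (auto simp: active_def hit_def t_def)
        moreover have "predictor n i \<omega> \<le> \<delta> + deficit n i \<omega>" using le low by linarith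
        ultimately show ?thesis using f_mono[OF _ d0, of "predictor n i \<omega>" \<delta> i] f_ln[of \<delta>] \<delta>K by (simp add: \<Phi>_def)
      qed
    next
      case dead: False
      have "\<omega> \<notin> hit n i" using True by (rule active_not_hit)
      then have "\<omega> \<notin> hit n (Suc i)" using dead \<delta>K by (auto simp: hit_def t_def less_Suc_eq)
      moreover have "\<omega> \<notin> active n (Suc i)" using dead by (auto simp: active_def t_def)
      moreover have "0 \<le> 2 / \<delta> * deficit n i \<omega>" using d0 \<delta> by simp
      ultimately show ?thesis using f_le[of "predictor n i \<omega>"] by (simp add: \<Phi>_def)
    qed
    then show ?thesis using True by (simp add: \<Phi>_def)
  qed
  have "(\<Sum>i<m. indicator (active n i) \<omega> * (f (predictor n i \<omega>) - ln (X (grid n i) \<omega>)) - 2 / \<delta> * deficit n i \<omega>)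
     \<le> (\<Sum>i<m. \<Phi> (Suc i) - \<Phi> i)" by (intro sum_mono step)
  also have "\<dots> = \<Phi> m - \<Phi> 0" by (rule sum_lessThan_telescope)
  also have "ln \<epsilon> \<le> \<Phi> 0"
    using \<epsilon> \<delta> \<delta>K by (auto simp: \<Phi>_def hit_def)
  moreover have "\<Phi> m \<le> ln (2 * K) - (ln (2 * K) - ln \<delta>) * indicator (hit n m) \<omega>"
  proof (cases "\<omega> \<in> active n m")
    case True
    then have "\<omega> \<notin> hit n m" by (rule active_not_hit)
    moreover have "ln (X (grid n m) \<omega>) \<le> ln (2 * K)"
      using active_D(3,4)[OF True order_refl] \<delta> \<delta>K by (subst ln_le_cancel_iff) auto
    ultimately show ?thesis using True by (simp add: \<Phi>_def)
  qed (auto simp: \<Phi>_def)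
  ultimately show ?thesis by linarith
qed

text \<open>
  An upper bound for the expected Taylor error of a step of length \<open>h\<close>. It is of order
  \<open>h powr (3/2)\<close>, so that the sum over the \<open>(u - r) / h\<close> steps is of order \<open>sqrt h\<close>.
\<close>

definition remainder :: "real \<Rightarrow> real" where
  "remainder h = q\<^sup>2 * h\<^sup>2 / (8 * \<delta> ^ 4) + (8 * ln (2 * K / \<delta>) + 1) *
     (sqrt h ^ 3 + 8 * ((q * h / (2 * \<delta>\<^sup>2)) ^ 4 + c * h\<^sup>2 / \<delta> ^ 4) / sqrt h)"

text \<open>
  Insert the relative increment \<open>z = q h / (2 x\<^sup>2) + d / x\<close> of the predictor into the Taylor
  bound. The drift contributes \<open>q h / (2 x\<^sup>2)\<close> and the noise \<open>- d\<^sup>2 / (2 x\<^sup>2)\<close>: these are the two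
  terms whose coefficients agree because the drift is the critical one.
\<close>

lemma log_increment_ge:
  assumes x: "\<delta> < x" "x < K" and h: "0 < h"
  shows "d / x + (q * h - d\<^sup>2) / 2 * (1 / x\<^sup>2) - q * h / 2 * (d * (1 / x ^ 3)) - q\<^sup>2 * h\<^sup>2 / (8 * \<delta> ^ 4)
      - (8 * ln (2 * K / \<delta>) + 1) *
     (sqrt h ^ 3 + 8 * ((q * h / (2 * \<delta>\<^sup>2)) ^ 4 + d ^ 4 / \<delta> ^ 4) / sqrt h)
    \<le> f (x + q * h / (2 * x) + d) - ln x"
proof -
  define C where "C = 8 * ln (2 * K / \<delta>) + 1"
  have "0 \<le> ln (2 * K / \<delta>)" using \<delta> \<delta>K by (intro ln_ge_zero) (auto simp: field_simps)
  then have C: "0 \<le> C" by (simp add: C_def)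
  define z where "z = (x + q * h / (2 * x) + d - x) / x"
  have x0: "0 < x" using x \<delta> by simp
  have z: "z = q * h / (2 * x\<^sup>2) + d / x"
    using x0 by (simp add: z_def field_simps power2_eq_square)
  have 1: "z - z\<^sup>2 / 2 = d / x + (q * h - d\<^sup>2) / 2 * (1 / x\<^sup>2) - q * h / 2 * (d * (1 / x ^ 3))
      - q\<^sup>2 * h\<^sup>2 / (8 * x ^ 4)"
    using x0 by (simp add: z field_simps power2_eq_square power3_eq_cube power4_eq_xxxx)
  have 2: "q\<^sup>2 * h\<^sup>2 / (8 * x ^ 4) \<le> q\<^sup>2 * h\<^sup>2 / (8 * \<delta> ^ 4)"
    using x x0 \<delta> by (intro divide_left_mono mult_left_mono power_mono) auto
  have "(q * h / (2 * x\<^sup>2)) ^ 4 \<le> (q * h / (2 * \<delta>\<^sup>2)) ^ 4"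
    using x x0 \<delta> h q_pos by (intro power_mono divide_left_mono mult_left_mono) auto
  moreover have "(d / x) ^ 4 \<le> d ^ 4 / \<delta> ^ 4"
    unfolding power_divide using x x0 \<delta> by (intro divide_left_mono power_mono) auto
  ultimately have "z ^ 4 \<le> 8 * ((q * h / (2 * \<delta>\<^sup>2)) ^ 4 + d ^ 4 / \<delta> ^ 4)"
    unfolding z by (intro order_trans[OF power4_add_le] mult_left_mono add_mono) auto
  then have "z ^ 4 / sqrt h \<le> 8 * ((q * h / (2 * \<delta>\<^sup>2)) ^ 4 + d ^ 4 / \<delta> ^ 4) / sqrt h"
    using h by (intro divide_right_mono) auto
  then have "\<bar>z\<bar> ^ 3 \<le> sqrt h ^ 3 + 8 * ((q * h / (2 * \<delta>\<^sup>2)) ^ 4 + d ^ 4 / \<delta> ^ 4) / sqrt h"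
    using abs_cube_le[of "sqrt h" z] h by simp
  then have 3: "C * \<bar>z\<bar> ^ 3 \<le> C * (sqrt h ^ 3 + 8 * ((q * h / (2 * \<delta>\<^sup>2)) ^ 4 + d ^ 4 / \<delta> ^ 4) / sqrt h)"
    using C by (intro mult_left_mono)
  have "z - z\<^sup>2 / 2 - C * \<bar>z\<bar> ^ 3 \<le> f (x + q * h / (2 * x) + d) - ln x"
    unfolding z_def C_def by (rule clipped_ln_taylor) (use \<delta> x in auto)
  then show ?thesis using 1 2 3 unfolding C_def by linarith
qed

text \<open>
  The random coefficients of the increments of \<open>N\<close> in the expansion. They are bounded and known
  at the beginning of the step, so they can be used in the martingale and bracket identities.
\<close>

definition weight :: "nat \<Rightarrow> nat \<Rightarrow> nat \<Rightarrow> 'a \<Rightarrow> real" where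
  "weight p n i \<omega> = indicator (active n i) \<omega> / stopped_X (grid n i) \<omega> ^ p"

lemma weight_measurable:
  assumes "i \<le> n" shows "weight p n i \<in> borel_measurable (F (ennreal (grid n i)))"
proof -
  have [measurable]: "active n i \<in> sets (F (ennreal (grid n i)))"
    "stopped_X (grid n i) \<in> borel_measurable (F (ennreal (grid n i)))"
    using assms by (auto intro!: active_sets stopped_X_measurable grid_ge grid_le)
  show ?thesis unfolding weight_def by measurable
qed

lemma weight_bounds: "0 \<le> weight p n i \<omega>" "weight p n i \<omega> \<le> 1 / \<delta> ^ p"
proof -
  show "0 \<le> weight p n i \<omega>"
    using \<delta> active_D(3,5)[of \<omega> n i i] by (auto simp: weight_def indicator_def)
  show "weight p n i \<omega> \<le> 1 / \<delta> ^ p"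
    using \<delta> active_D(3,5)[of \<omega> n i i]
    by (auto simp: weight_def indicator_def intro!: divide_left_mono power_mono)
qed

lemma weight_abs: "\<bar>weight p n i \<omega>\<bar> \<le> 1 / \<delta> ^ p"
  using weight_bounds[of p n i \<omega>] by simp

lemma N_measurable_M: "r \<le> t \<Longrightarrow> t \<le> u \<Longrightarrow> N t \<in> borel_measurable M"
  by (rule measurable_F_M[OF N_adapted])

lemma N_square_integrable:
  assumes "r \<le> s" "s \<le> t" "t \<le> u"
  shows "integrable M (\<lambda>\<omega>. (N t \<omega> - N s \<omega>)\<^sup>2)" "integrable M (\<lambda>\<omega>. N t \<omega> - N s \<omega>)"
proof -
  have [measurable]: "N t \<in> borel_measurable M" "N s \<in> borel_measurable M"
    using assms by (auto intro!: N_measurable_M)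
  have i: "integrable M (\<lambda>\<omega>. 1 + (N t \<omega> - N s \<omega>) ^ 4)"
    using N_fourth_integrable[OF assms] by simp
  have sq: "x\<^sup>2 \<le> 1 + x ^ 4" for x :: real
  proof -
    have "0 \<le> (x\<^sup>2 - 1)\<^sup>2" by simp
    then have "2 * x\<^sup>2 \<le> 1 + x ^ 4" by (simp add: power2_diff)
    then show ?thesis using zero_le_power2[of x] by linarith
  qed
  have ab: "\<bar>x\<bar> \<le> 1 + x\<^sup>2" for x :: real
    using zero_le_power2[of "\<bar>x\<bar> - 1"] zero_le_power2[of x] by (simp add: power2_diff)
  show i2: "integrable M (\<lambda>\<omega>. (N t \<omega> - N s \<omega>)\<^sup>2)"
    by (rule Bochner_Integration.integrable_bound[OF i]) (use sq in \<open>auto simp: add_nonneg_nonneg\<close>)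
  show "integrable M (\<lambda>\<omega>. N t \<omega> - N s \<omega>)"
    by (rule Bochner_Integration.integrable_bound[where f="\<lambda>\<omega>. 1 + (N t \<omega> - N s \<omega>)\<^sup>2"])
      (use ab i2 in auto)
qed

lemma overshoot_measurable:
  assumes "i < n" shows "overshoot n i \<in> borel_measurable M" "integrable M (overshoot n i)"
proof -
  have [measurable]: "L (grid n (Suc i)) \<in> borel_measurable M" "L (grid n i) \<in> borel_measurable M"
    using assms by (auto intro!: measurable_F_M[OF L_adapted] grid_ge grid_le)
  have [measurable]: "active n i \<in> sets M" using assms by (auto intro!: sets_F_M[OF active_sets])
  have [measurable]: "{\<omega> \<in> space M. ennreal (grid n (Suc i)) < T \<omega>} \<in> sets M"
    by (rule sets_F_M[OF less_T_sets])
  show 1: "overshoot n i \<in> borel_measurable M" unfolding overshoot_def[abs_def] by measurable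
  have "integrable M (\<lambda>\<omega>. L (grid n (Suc i)) \<omega> - L (grid n i) \<omega>)"
    using assms by (intro Bochner_Integration.integrable_diff L_integrable grid_ge grid_le) auto
  then show "integrable M (overshoot n i)"
    by (rule Bochner_Integration.integrable_bound) (use 1 in \<open>auto simp: overshoot_def\<close>)
qed

text \<open>
  In the mean the terms linear in \<open>\<Delta>N\<close> vanish and \<open>(\<Delta>N)\<^sup>2\<close> may be replaced by \<open>\<Delta>L\<close>. If \<open>T\<close> does
  not occur in the step, then \<open>\<Delta>L \<le> q h\<close> and the drift compensates the second-order term; the
  other steps contribute the overshoot.
\<close>

lemma expected_log_increment_ge:
  assumes i: "i < n"
  defines "g \<equiv> \<lambda>\<omega>. indicator (active n i) \<omega> * (f (predictor n i \<omega>) - ln (X (grid n i) \<omega>))"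
  shows "integrable M g"
    "- (1 / (2 * \<delta>\<^sup>2)) * expectation (overshoot n i) - remainder (mesh n) \<le> expectation g"
proof -
  define h where "h = mesh n"
  define s t where "s = grid n i" and "t = grid n (Suc i)"
  have h: "0 < h" unfolding h_def using i by (intro mesh_pos) auto
  have st: "r \<le> s" "s \<le> t" "t \<le> u" "s \<le> u" "r \<le> t" "t - s = h"
    using i h by (auto simp: s_def t_def h_def grid_Suc intro!: grid_ge grid_le grid_mono)
     (auto simp flip: grid_Suc intro!: grid_ge grid_le)
  have [measurable]: "N t \<in> borel_measurable M" "N s \<in> borel_measurable M"
    using st by (auto intro!: N_measurable_M)
  have [measurable]: "stopped_X s \<in> borel_measurable M"
    using st by (auto intro!: measurable_F_M[OF stopped_X_measurable])
  have A[measurable]: "active n i \<in> sets M" using i by (auto intro!: sets_F_M[OF active_sets])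
  define d where "d = (\<lambda>\<omega>. N t \<omega> - N s \<omega>)"
  define l where "l = (\<lambda>\<omega>. L t \<omega> - L s \<omega>)"
  define w where "w = (\<lambda>p. weight p n i)"
  have d[measurable]: "d \<in> borel_measurable M" unfolding d_def by measurable
  have wF: "w p \<in> borel_measurable (F (ennreal s))" for p
    unfolding w_def s_def using i by (intro weight_measurable) auto
  note w[measurable] = measurable_F_M[OF wF]
  have wb: "\<bar>w p \<omega>\<bar> \<le> 1 / \<delta> ^ p" for p \<omega> unfolding w_def by (rule weight_abs)
  have intd: "integrable M d" "integrable M (\<lambda>\<omega>. (d \<omega>)\<^sup>2)" "integrable M (\<lambda>\<omega>. d \<omega> ^ 4)" "integrable M l"
    unfolding d_def l_def using N_square_integrable[of s t] N_fourth_integrable[of s t]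
      L_integrable[of s] L_integrable[of t] st by auto
  have intw: "integrable M (w p)" for p
    using integrable_bounded_mult[OF w wb, of "\<lambda>_. 1"] by simp
  have intwd: "integrable M (\<lambda>\<omega>. w p \<omega> * d \<omega>)" "integrable M (\<lambda>\<omega>. w p \<omega> * (d \<omega>)\<^sup>2)"
    "integrable M (\<lambda>\<omega>. w p \<omega> * l \<omega>)" for p
    by (intro integrable_bounded_mult[OF w wb] intd)+
  have g_eq: "g \<omega> = indicator (active n i) \<omega> * (f (stopped_X s \<omega> + q * h / (2 * stopped_X s \<omega>) + d \<omega>) - ln (stopped_X s \<omega>))" for \<omega>
    using active_D(5)[of \<omega> n i i] by (auto simp: g_def predictor_def indicator_def s_def h_def d_def t_def)
  have fm: "f \<in> borel_measurable borel" unfolding clipped_ln_def[abs_def] by measurable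
  have g_meas: "g \<in> borel_measurable M"
    unfolding g_eq[abs_def] using fm by measurable
  have lnb: "ln \<delta> \<le> ln (X s \<omega>) \<and> ln (X s \<omega>) \<le> ln K" if "\<omega> \<in> active n i" for \<omega>
    using active_D(3,4)[OF that order_refl] \<delta> \<delta>K by (auto simp: s_def)
  have "\<bar>g \<omega>\<bar> \<le> ln (2 * K) - ln (\<delta> / 2)" for \<omega>
  proof (cases "\<omega> \<in> active n i")
    case True
    have "ln (\<delta> / 2) \<le> ln \<delta>" "ln K \<le> ln (2 * K)" using \<delta> \<delta>K by auto
    moreover have "ln (\<delta> / 2) \<le> f (predictor n i \<omega>)" "f (predictor n i \<omega>) \<le> ln (2 * K)"
      using clipped_ln_bounds[of "\<delta> / 2" "2 * K" "predictor n i \<omega>"] \<delta> \<delta>K by auto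
    moreover note lnb[OF True]
    ultimately have "\<bar>f (predictor n i \<omega>) - ln (X s \<omega>)\<bar> \<le> ln (2 * K) - ln (\<delta> / 2)"
      by (intro abs_leI) linarith+
    then show ?thesis using True by (simp add: g_def s_def)
  next
    case False
    have "ln (\<delta> / 2) \<le> ln (2 * K)" using \<delta> \<delta>K by auto
    then show ?thesis using False by (simp add: g_def)
  qed
  then show g_int: "integrable M g"
    by (intro integrable_const_bound[where B="ln (2 * K) - ln (\<delta> / 2)"]) (use g_meas in auto)

  define C where "C = 8 * ln (2 * K / \<delta>) + 1"
  define e where "e = (\<lambda>\<omega>. q\<^sup>2 * h\<^sup>2 / (8 * \<delta> ^ 4) + C * (sqrt h ^ 3 + 8 * ((q * h / (2 * \<delta>\<^sup>2)) ^ 4 + d \<omega> ^ 4 / \<delta> ^ 4) / sqrt h))"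
  have "0 \<le> ln (2 * K / \<delta>)" using \<delta> \<delta>K by (intro ln_ge_zero) (auto simp: field_simps)
  then have C: "0 \<le> C" by (simp add: C_def)
  have e0: "0 \<le> e \<omega>" for \<omega>
    unfolding e_def using C h \<delta> q_pos by (intro add_nonneg_nonneg mult_nonneg_nonneg divide_nonneg_nonneg) auto
  have inte: "integrable M e" unfolding e_def using intd by (intro Bochner_Integration.integrable_add integrable_mult_right integrable_divide) auto
  have e_le: "expectation e \<le> remainder h"
  proof -
    have "expectation e = q\<^sup>2 * h\<^sup>2 / (8 * \<delta> ^ 4) + C * (sqrt h ^ 3 + 8 * ((q * h / (2 * \<delta>\<^sup>2)) ^ 4 + expectation (\<lambda>\<omega>. d \<omega> ^ 4) / \<delta> ^ 4) / sqrt h)"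
      unfolding e_def using intd by (simp add: prob_space)
    also have "\<dots> \<le> remainder h"
      unfolding remainder_def C_def[symmetric] using N_fourth_le[of s t] st C h \<delta>
      by (intro add_left_mono mult_left_mono divide_right_mono) (auto simp: d_def)
    finally show ?thesis .
  qed
  have lower: "w 1 \<omega> * d \<omega> + (q * h / 2 * w 2 \<omega> - w 2 \<omega> * (d \<omega>)\<^sup>2 / 2) - q * h / 2 * (w 3 \<omega> * d \<omega>) - e \<omega> \<le> g \<omega>" for \<omega>
  proof (cases "\<omega> \<in> active n i")
    case True
    note a = active_D[OF True order_refl]
    have wx: "w p \<omega> = 1 / X s \<omega> ^ p" for p using True a by (simp add: w_def weight_def s_def)
    have "w 1 \<omega> * d \<omega> = d \<omega> / X s \<omega>" "w 3 \<omega> * d \<omega> = d \<omega> * (1 / X s \<omega> ^ 3)"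
      "q * h / 2 * w 2 \<omega> - w 2 \<omega> * (d \<omega>)\<^sup>2 / 2 = (q * h - (d \<omega>)\<^sup>2) / 2 * (1 / (X s \<omega>)\<^sup>2)"
      unfolding wx by (simp_all add: left_diff_distrib diff_divide_distrib)
    moreover have "g \<omega> = f (X s \<omega> + q * h / (2 * X s \<omega>) + d \<omega>) - ln (X s \<omega>)"
      using True a by (simp add: g_eq s_def)
    moreover note log_increment_ge[of "X s \<omega>" h "d \<omega>"]
    moreover have "\<delta> < X s \<omega>" "X s \<omega> < K" using a by (auto simp: s_def)
    ultimately show ?thesis using h unfolding e_def C_def by (simp only: diff_diff_eq add.assoc)
  next
    case False
    then show ?thesis using e0[of \<omega>] by (simp add: w_def weight_def g_def)
  qed
  have "expectation (\<lambda>\<omega>. w 1 \<omega> * d \<omega> + (q * h / 2 * w 2 \<omega> - w 2 \<omega> * (d \<omega>)\<^sup>2 / 2) - q * h / 2 * (w 3 \<omega> * d \<omega>) - e \<omega>)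
     \<le> expectation g"
    using intw intwd inte g_int lower by (intro integral_mono) auto
  also have "expectation (\<lambda>\<omega>. w 1 \<omega> * d \<omega> + (q * h / 2 * w 2 \<omega> - w 2 \<omega> * (d \<omega>)\<^sup>2 / 2) - q * h / 2 * (w 3 \<omega> * d \<omega>) - e \<omega>)
    = expectation (\<lambda>\<omega>. w 1 \<omega> * d \<omega>) + (q * h / 2 * expectation (w 2) - expectation (\<lambda>\<omega>. w 2 \<omega> * (d \<omega>)\<^sup>2) / 2)
      - q * h / 2 * expectation (\<lambda>\<omega>. w 3 \<omega> * d \<omega>) - expectation e"
    using intw intwd inte by simp
  also have "expectation (\<lambda>\<omega>. w 1 \<omega> * d \<omega>) = 0"
    unfolding d_def using st by (intro N_martingale[OF _ _ _ wF wb])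
  also have "expectation (\<lambda>\<omega>. w 3 \<omega> * d \<omega>) = 0"
    unfolding d_def using st by (intro N_martingale[OF _ _ _ wF wb])
  also have "expectation (\<lambda>\<omega>. w 2 \<omega> * (d \<omega>)\<^sup>2) = expectation (\<lambda>\<omega>. w 2 \<omega> * l \<omega>)"
    unfolding d_def l_def using st by (intro N_bracket[OF _ _ _ wF wb])
  finally have main: "q * h / 2 * expectation (w 2) - expectation (\<lambda>\<omega>. w 2 \<omega> * l \<omega>) / 2 - remainder h \<le> expectation g"
    using e_le by simp
  have "AE \<omega> in M. w 2 \<omega> * l \<omega> \<le> q * h * w 2 \<omega> + 1 / \<delta>\<^sup>2 * overshoot n i \<omega>"
    using L_growth
  proof eventually_elim
    case (elim \<omega>)
    show ?case
    proof (cases "\<omega> \<in> active n i")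
      case True
      have "w 2 \<omega> * l \<omega> \<le> w 2 \<omega> * (q * h) + 1 / \<delta>\<^sup>2 * overshoot n i \<omega>"
      proof (cases "ennreal t < T \<omega>")
        case live: True
        have "\<bar>L t \<omega> - L s \<omega>\<bar> \<le> q * (t - s)" using elim active_D(1)[OF True order_refl] st live by blast
        then have "w 2 \<omega> * l \<omega> \<le> w 2 \<omega> * (q * h)"
          using weight_bounds(1)[of 2 n i \<omega>] st by (intro mult_left_mono) (auto simp: l_def w_def)
        moreover have "0 \<le> overshoot n i \<omega>" by (simp add: overshoot_def)
        ultimately show ?thesis by (simp add: add_increasing2)
      next
        case False
        have "w 2 \<omega> * l \<omega> \<le> w 2 \<omega> * max 0 (l \<omega>)"
          using weight_bounds(1)[of 2 n i \<omega>] by (intro mult_left_mono) (auto simp: w_def)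
        also have "\<dots> \<le> 1 / \<delta>\<^sup>2 * max 0 (l \<omega>)"
          using weight_bounds(2)[of 2 n i \<omega>] by (intro mult_right_mono) (auto simp: w_def)
        also have "\<dots> = 1 / \<delta>\<^sup>2 * overshoot n i \<omega>" using True False by (simp add: overshoot_def l_def t_def s_def)
        also have "\<dots> \<le> w 2 \<omega> * (q * h) + \<dots>" using weight_bounds(1)[of 2 n i \<omega>] q_pos h by (simp add: w_def)
        finally show ?thesis .
      qed
      then show ?thesis by (simp add: mult.commute)
    qed (simp add: w_def weight_def overshoot_def)
  qed
  then have "expectation (\<lambda>\<omega>. w 2 \<omega> * l \<omega>) \<le> expectation (\<lambda>\<omega>. q * h * w 2 \<omega> + 1 / \<delta>\<^sup>2 * overshoot n i \<omega>)"
    using intwd intw overshoot_measurable(2)[OF i] by (intro integral_mono_AE) auto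
  also have "\<dots> = q * h * expectation (w 2) + 1 / \<delta>\<^sup>2 * expectation (overshoot n i)"
    using intw overshoot_measurable(2)[OF i] by simp
  finally show "- (1 / (2 * \<delta>\<^sup>2)) * expectation (overshoot n i) - remainder (mesh n) \<le> expectation g"
    using main by (simp add: h_def field_simps)
qed

end

context critical_drift_process
begin

text \<open>
  By continuity the smallest admissible bound \<open>b\<close> in the growth condition is attained. For a
  maximum that is not positive only the comparison with the increment of \<open>N\<close> remains.
\<close>

lemma X_path:
  "AE \<omega> in M. \<omega> \<in> \<Gamma> \<longrightarrow> (\<forall>s t. r \<le> s \<longrightarrow> s \<le> t \<longrightarrow> t \<le> u \<longrightarrow> ennreal t < T \<omega> \<longrightarrow>
     (\<exists>v\<in>{s..t}. (\<forall>w\<in>{s..t}. X w \<omega> \<le> X v \<omega>) \<and>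
       N t \<omega> - N s \<omega> \<le> X t \<omega> - X s \<omega> \<and>
       (0 < X v \<omega> \<longrightarrow> N t \<omega> - N s \<omega> + q / (2 * X v \<omega>) * (t - s) \<le> X t \<omega> - X s \<omega>)))"
  using X_continuous X_growth
proof eventually_elim
  case (elim \<omega>)
  show ?case
  proof (intro impI allI)
    fix s t assume \<omega>: "\<omega> \<in> \<Gamma>" and st: "r \<le> s" "s \<le> t" "t \<le> u" "ennreal t < T \<omega>"
    have sub: "{s..t} \<subseteq> {t \<in> {r..u}. ennreal t < T \<omega>}"
      using st by (auto intro: le_less_trans[OF ennreal_leI])
    then have "continuous_on {s..t} (\<lambda>t. X t \<omega>)"
      using elim(1) \<omega> continuous_on_subset by blast
    then obtain v where v: "v \<in> {s..t}" "\<forall>w\<in>{s..t}. X w \<omega> \<le> X v \<omega>"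
      using continuous_attains_sup[of "{s..t}" "\<lambda>t. X t \<omega>"] st by auto
    have g: "N t \<omega> - N s \<omega> + q / (2 * b) * (t - s) \<le> X t \<omega> - X s \<omega>" if "0 < b" "X v \<omega> \<le> b" for b
    proof -
      have "\<forall>w\<in>{s..t}. X w \<omega> \<le> b" using v that by (blast intro: order_trans)
      then show ?thesis using elim(2) \<omega> st that by blast
    qed
    have "N t \<omega> - N s \<omega> \<le> N t \<omega> - N s \<omega> + q / (2 * max 1 (X v \<omega>)) * (t - s)"
      using q_pos st by simp
    also have "\<dots> \<le> X t \<omega> - X s \<omega>" by (rule g) auto
    finally show "\<exists>v\<in>{s..t}. (\<forall>w\<in>{s..t}. X w \<omega> \<le> X v \<omega>) \<and>
       N t \<omega> - N s \<omega> \<le> X t \<omega> - X s \<omega> \<and>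
       (0 < X v \<omega> \<longrightarrow> N t \<omega> - N s \<omega> + q / (2 * X v \<omega>) * (t - s) \<le> X t \<omega> - X s \<omega>)"
      using g[of "X v \<omega>"] v by blast
  qed
qed

text \<open>
  \<open>X - N\<close> is nondecreasing before \<open>T\<close> and \<open>N\<close> is continuous.
\<close>

lemma X_left_limit:
  "AE \<omega> in M. \<omega> \<in> \<Gamma> \<longrightarrow> (\<forall>t. r < t \<longrightarrow> t \<le> u \<longrightarrow> ennreal t \<le> T \<omega> \<longrightarrow>
     (\<exists>l. ((\<lambda>s. X s \<omega>) \<longlongrightarrow> l) (at_left t)) \<or> filterlim (\<lambda>s. X s \<omega>) at_top (at_left t))"
  using X_path N_continuous
proof eventually_elim
  case (elim \<omega>)
  show ?case
  proof (intro impI allI)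
    fix t assume \<omega>: "\<omega> \<in> \<Gamma>" and t: "r < t" "t \<le> u" "ennreal t \<le> T \<omega>"
    define m where "m = (\<lambda>s. X s \<omega> - N s \<omega>)"
    have "m s \<le> m v" if "r \<le> s" "s \<le> v" "v < t" for s v
    proof -
      have "ennreal v < ennreal t" using that r_nonneg by (intro ennreal_lessI) auto
      then have "ennreal v < T \<omega>" using t by simp
      moreover have "v \<le> u" using that t by simp
      ultimately have "N v \<omega> - N s \<omega> \<le> X v \<omega> - X s \<omega>" using elim(1) \<omega> that by blast
      then show ?thesis by (simp add: m_def)
    qed
    then have m: "(\<exists>l. (m \<longlongrightarrow> l) (at_left t)) \<or> filterlim m at_top (at_left t)"
      by (rule mono_left_limit[OF t(1)])
    have "continuous (at t within {r..t}) (\<lambda>t. N t \<omega>)"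
      using continuous_on_subset[OF elim(2), of "{r..t}"] t by (auto simp: continuous_on_eq_continuous_within)
    then have N: "((\<lambda>s. N s \<omega>) \<longlongrightarrow> N t \<omega>) (at_left t)"
      using t by (simp add: continuous_within at_within_Icc_at_left)
    have X: "X s \<omega> = N s \<omega> + m s" for s by (simp add: m_def)
    from m show "(\<exists>l. ((\<lambda>s. X s \<omega>) \<longlongrightarrow> l) (at_left t)) \<or> filterlim (\<lambda>s. X s \<omega>) at_top (at_left t)"
      unfolding X using tendsto_add[OF N] filterlim_tendsto_add_at_top[OF N] by blast
  qed
qed

end

context barrier_strip
begin

lemma hit_sets:
  assumes "i \<le> n" shows "hit n i \<in> sets M"
proof -
  have "{\<omega>. \<omega> \<in> active n k \<and> ennreal (grid n (Suc k)) < T \<omega> \<and> X (grid n (Suc k)) \<omega> \<le> \<delta>} \<in> sets M" if "k < i" for k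
  proof -
    have [measurable]: "stopped_X (grid n (Suc k)) \<in> borel_measurable M" "active n k \<in> sets M"
      using that assms by (auto intro!: measurable_F_M[OF stopped_X_measurable] sets_F_M[OF active_sets] grid_ge grid_le)
    have [measurable]: "{\<omega> \<in> space M. ennreal (grid n (Suc k)) < T \<omega>} \<in> sets M"
      by (rule sets_F_M[OF less_T_sets])
    have "{\<omega> \<in> space M. \<omega> \<in> active n k \<and> ennreal (grid n (Suc k)) < T \<omega> \<and> stopped_X (grid n (Suc k)) \<omega> \<le> \<delta>} \<in> sets M"
      by measurable
    also have "{\<omega> \<in> space M. \<omega> \<in> active n k \<and> ennreal (grid n (Suc k)) < T \<omega> \<and> stopped_X (grid n (Suc k)) \<omega> \<le> \<delta>} =
      {\<omega>. \<omega> \<in> active n k \<and> ennreal (grid n (Suc k)) < T \<omega> \<and> X (grid n (Suc k)) \<omega> \<le> \<delta>}"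
      using active_D(1)[of _ n k k] \<Gamma>_space by (auto simp: stopped_X_def)
    finally show ?thesis .
  qed
  moreover have "hit n i = (\<Union>k<i. {\<omega>. \<omega> \<in> active n k \<and> ennreal (grid n (Suc k)) < T \<omega> \<and> X (grid n (Suc k)) \<omega> \<le> \<delta>})"
    by (auto simp: hit_def)
  ultimately show ?thesis by auto
qed

lemma hit_\<Gamma>: "hit n i \<subseteq> \<Gamma>"
  by (auto simp: hit_def active_def)

lemma deficit_nonneg: "0 \<le> deficit n i \<omega>"
  by (simp add: deficit_def)

lemma overshoot_nonneg: "0 \<le> overshoot n i \<omega>"
  by (simp add: overshoot_def)

text \<open>
  The drift during a step is at least \<open>q / 2\<close> times the reciprocal of the maximal value \<open>X v\<close> in
  that step, while the predictor uses the reciprocal of the initial value. Above \<open>\<delta>\<close> the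
  truncated reciprocal is the true one.
\<close>

lemma deficit_oscillation:
  "AE \<omega> in M. \<forall>n i. i < n \<longrightarrow> \<omega> \<in> active n i \<longrightarrow> ennreal (grid n (Suc i)) < T \<omega> \<longrightarrow>
    (\<exists>v\<in>{grid n i..grid n (Suc i)}.
       deficit n i \<omega> \<le> q * mesh n / 2 * (1 / max \<delta> (X (grid n i) \<omega>) - 1 / max \<delta> (X v \<omega>)))"
  using X_path
proof eventually_elim
  case (elim \<omega>)
  show ?case
  proof (intro allI impI)
    fix n i assume i: "i < n" and a: "\<omega> \<in> active n i" and T: "ennreal (grid n (Suc i)) < T \<omega>"
    define s t where "s = grid n i" and "t = grid n (Suc i)"
    have st: "r \<le> s" "s \<le> t" "t \<le> u" "t - s = mesh n"
      using i by (auto simp: s_def t_def grid_Suc mesh_nonneg intro!: grid_ge) (auto simp flip: grid_Suc intro!: grid_le)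
    obtain v where v: "v \<in> {s..t}" "\<forall>w\<in>{s..t}. X w \<omega> \<le> X v \<omega>"
      "0 < X v \<omega> \<longrightarrow> N t \<omega> - N s \<omega> + q / (2 * X v \<omega>) * (t - s) \<le> X t \<omega> - X s \<omega>"
      using elim[rule_format, OF active_D(1)[OF a order_refl] st(1-3) T[folded t_def]] by blast
    have Xs: "\<delta> < X s \<omega>" using active_D(3)[OF a order_refl] by (simp add: s_def)
    have Xv: "X s \<omega> \<le> X v \<omega>" using v st by auto
    have "q * mesh n / 2 * (1 / X s \<omega> - 1 / X v \<omega>) = q * mesh n / (2 * X s \<omega>) - q / (2 * X v \<omega>) * (t - s)"
      unfolding st(4) by (simp add: right_diff_distrib)
    moreover have "0 < X v \<omega>" using Xs Xv \<delta> by simp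
    ultimately have "predictor n i \<omega> - X t \<omega> \<le> q * mesh n / 2 * (1 / X s \<omega> - 1 / X v \<omega>)"
      using v(3) unfolding predictor_def s_def[symmetric] t_def[symmetric] by linarith
    moreover have "0 \<le> q * mesh n / 2 * (1 / X s \<omega> - 1 / X v \<omega>)"
      using q_pos mesh_nonneg[of n] Xs Xv \<delta> by (intro mult_nonneg_nonneg) (auto simp: field_simps)
    ultimately have "deficit n i \<omega> \<le> q * mesh n / 2 * (1 / X s \<omega> - 1 / X v \<omega>)"
      using a T by (simp only: deficit_def t_def simp_thms if_True max.bounded_iff)
    then show "\<exists>v\<in>{grid n i..grid n (Suc i)}.
       deficit n i \<omega> \<le> q * mesh n / 2 * (1 / max \<delta> (X (grid n i) \<omega>) - 1 / max \<delta> (X v \<omega>))"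
      using v(1) Xs Xv by (intro bexI[of _ v]) (auto simp: s_def t_def max_def)
  qed
qed

lemma deficit_le: "AE \<omega> in M. \<forall>n i. i < n \<longrightarrow> deficit n i \<omega> \<le> q * mesh n / (2 * \<delta>)"
  using deficit_oscillation
proof eventually_elim
  case (elim \<omega>)
  show ?case
  proof (intro allI impI)
    fix n i assume i: "(i::nat) < n"
    have nn: "0 \<le> q * mesh n" using q_pos mesh_nonneg[of n] by simp
    show "deficit n i \<omega> \<le> q * mesh n / (2 * \<delta>)"
    proof (cases "\<omega> \<in> active n i \<and> ennreal (grid n (Suc i)) < T \<omega>")
      case True
      then obtain v where v: "deficit n i \<omega> \<le> q * mesh n / 2 * (1 / max \<delta> (X (grid n i) \<omega>) - 1 / max \<delta> (X v \<omega>))"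
        using elim i by blast
      have "1 / max \<delta> (X (grid n i) \<omega>) - 1 / max \<delta> (X v \<omega>) \<le> 1 / max \<delta> (X (grid n i) \<omega>)"
        using \<delta> by (simp add: max_def)
      also have "\<dots> \<le> 1 / \<delta>" using \<delta> by (intro divide_left_mono) auto
      finally have "q * mesh n / 2 * (1 / max \<delta> (X (grid n i) \<omega>) - 1 / max \<delta> (X v \<omega>)) \<le> q * mesh n / 2 * (1 / \<delta>)"
        using nn by (intro mult_left_mono) auto
      then have "deficit n i \<omega> \<le> q * mesh n / 2 * (1 / \<delta>)" using v by linarith
      then show ?thesis by simp
    qed (use nn \<delta> in \<open>auto simp: deficit_def\<close>)
  qed
qed

lemma deficit_integrable:
  assumes "i < n" shows "integrable M (deficit n i)"
proof (rule integrable_const_bound[where B = "q * mesh n / (2 * \<delta>)"])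
  show "AE \<omega> in M. norm (deficit n i \<omega>) \<le> q * mesh n / (2 * \<delta>)"
    using deficit_le by eventually_elim (use assms deficit_nonneg in auto)
  have [measurable]: "N (grid n (Suc i)) \<in> borel_measurable M" "N (grid n i) \<in> borel_measurable M"
    "stopped_X (grid n i) \<in> borel_measurable M" "stopped_X (grid n (Suc i)) \<in> borel_measurable M"
    using assms by (auto intro!: measurable_F_M[OF stopped_X_measurable] N_measurable_M grid_ge grid_le)
  have [measurable]: "active n i \<in> sets M" using assms by (auto intro!: sets_F_M[OF active_sets])
  have [measurable]: "{\<omega> \<in> space M. ennreal (grid n (Suc i)) < T \<omega>} \<in> sets M"
    by (rule sets_F_M[OF less_T_sets])
  have "deficit n i \<omega> = (if \<omega> \<in> active n i \<and> ennreal (grid n (Suc i)) < T \<omega>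
     then max 0 (stopped_X (grid n i) \<omega> + q * mesh n / (2 * stopped_X (grid n i) \<omega>)
     + (N (grid n (Suc i)) \<omega> - N (grid n i) \<omega>) - stopped_X (grid n (Suc i)) \<omega>) else 0)" for \<omega>
    using active_D(1,5)[of \<omega> n i i] by (auto simp: deficit_def predictor_def stopped_X_def)
  then show "deficit n i \<in> borel_measurable M" by (subst measurable_cong) (assumption, measurable)
qed

text \<open>
  The submartingale estimate on a grid: \<open>ln X\<close> starts above \<open>ln \<epsilon>\<close>, nearly increases in the mean,
  and ends at \<open>ln \<delta>\<close> on the event of a hit and below \<open>ln (2 K)\<close> otherwise.
\<close>

lemma prob_hit_le:
  assumes n: "0 < n" and \<epsilon>: "\<delta> < \<epsilon>" "\<epsilon> \<le> K" "\<And>\<omega>. \<omega> \<in> \<Gamma> \<Longrightarrow> \<epsilon> \<le> X r \<omega>"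
  shows "(ln (2 * K) - ln \<delta>) * prob (hit n n) \<le> ln (2 * K) - ln \<epsilon>
    + 2 / \<delta> * expectation (\<lambda>\<omega>. \<Sum>i<n. deficit n i \<omega>)
    + 1 / (2 * \<delta>\<^sup>2) * expectation (\<lambda>\<omega>. \<Sum>i<n. overshoot n i \<omega>) + real n * remainder (mesh n)"
proof -
  define g where "g i \<omega> = indicator (active n i) \<omega> * (f (predictor n i \<omega>) - ln (X (grid n i) \<omega>))" for i \<omega>
  note g = expected_log_increment_ge[of _ n, folded g_def]
  have gi: "integrable M (g i)" if "i < n" for i
    using g(1)[OF that] by (simp add: g_def[abs_def])
  have hs: "hit n n \<in> sets M" by (rule hit_sets) simp
  have \<Gamma>M: "\<Gamma> \<in> sets M" by (rule sets_F_M[OF \<Gamma>])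
  have "(\<Sum>i<n. g i \<omega> - 2 / \<delta> * deficit n i \<omega>)
     \<le> (ln (2 * K) - ln \<epsilon>) * indicator \<Gamma> \<omega> - (ln (2 * K) - ln \<delta>) * indicator (hit n n) \<omega>" for \<omega>
  proof (cases "\<omega> \<in> \<Gamma>")
    case True
    then show ?thesis using telescope[OF True \<epsilon>(1,2) \<epsilon>(3)[OF True], of n n] by (simp add: g_def)
  next
    case False
    then have "\<omega> \<notin> active n i" "\<omega> \<notin> hit n n" for i using hit_\<Gamma>[of n n] by (auto simp: active_def)
    then show ?thesis using False by (simp add: g_def deficit_def)
  qed
  then have "expectation (\<lambda>\<omega>. \<Sum>i<n. g i \<omega> - 2 / \<delta> * deficit n i \<omega>)
     \<le> expectation (\<lambda>\<omega>. (ln (2 * K) - ln \<epsilon>) * indicator \<Gamma> \<omega> - (ln (2 * K) - ln \<delta>) * indicator (hit n n) \<omega>)"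
    using gi deficit_integrable \<Gamma>M hs
    by (intro integral_mono) (auto intro!: Bochner_Integration.integrable_diff integrable_mult_right
        integrable_real_indicator emeasure_finite simp: less_top[symmetric])
  also have "\<dots> = (ln (2 * K) - ln \<epsilon>) * prob \<Gamma> - (ln (2 * K) - ln \<delta>) * prob (hit n n)"
    using \<Gamma>M hs by (simp add: integrable_real_indicator less_top[symmetric])
  also have "(ln (2 * K) - ln \<epsilon>) * prob \<Gamma> \<le> (ln (2 * K) - ln \<epsilon>) * 1"
    using \<epsilon> \<delta> \<delta>K by (intro mult_left_mono) auto
  finally have 1: "(ln (2 * K) - ln \<delta>) * prob (hit n n) \<le> ln (2 * K) - ln \<epsilon> - expectation (\<lambda>\<omega>. \<Sum>i<n. g i \<omega> - 2 / \<delta> * deficit n i \<omega>)"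
    by simp
  have "expectation (\<lambda>\<omega>. \<Sum>i<n. g i \<omega> - 2 / \<delta> * deficit n i \<omega>)
    = (\<Sum>i<n. expectation (g i)) - 2 / \<delta> * expectation (\<lambda>\<omega>. \<Sum>i<n. deficit n i \<omega>)"
  proof -
    have "expectation (\<lambda>\<omega>. \<Sum>i<n. g i \<omega> - 2 / \<delta> * deficit n i \<omega>)
      = (\<Sum>i<n. expectation (\<lambda>\<omega>. g i \<omega> - 2 / \<delta> * deficit n i \<omega>))"
      using gi deficit_integrable by (intro Bochner_Integration.integral_sum) auto
    also have "\<dots> = (\<Sum>i<n. expectation (g i) - 2 / \<delta> * expectation (deficit n i))"
      using gi deficit_integrable by (intro sum.cong) auto
    finally show ?thesis using deficit_integrable by (simp add: sum_subtractf sum_distrib_left)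
  qed
  moreover have "(\<Sum>i<n. - (1 / (2 * \<delta>\<^sup>2)) * expectation (overshoot n i) - remainder (mesh n)) \<le> (\<Sum>i<n. expectation (g i))"
    by (intro sum_mono) (use g(2) in \<open>auto simp: g_def[abs_def]\<close>)
  moreover have "(\<Sum>i<n. - (1 / (2 * \<delta>\<^sup>2)) * expectation (overshoot n i) - remainder (mesh n))
    = - (1 / (2 * \<delta>\<^sup>2)) * expectation (\<lambda>\<omega>. \<Sum>i<n. overshoot n i \<omega>) - real n * remainder (mesh n)"
    using overshoot_measurable(2) by (simp add: sum_subtractf sum_distrib_left)
  ultimately show ?thesis using 1 by linarith
qed

end

section \<open>Refining the time grid\<close>

context barrier_strip
begin

lemma mesh_tendsto: "mesh \<longlonglongrightarrow> 0"
  unfolding mesh_def[abs_def] by (rule lim_const_over_n)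

lemma eventually_mesh_less: "0 < e \<Longrightarrow> eventually (\<lambda>n. mesh n < e) sequentially"
  using order_tendstoD(2)[OF mesh_tendsto] .

lemma n_mesh: "0 < n \<Longrightarrow> real n * mesh n = u - r"
  by (simp add: mesh_def)

lemma remainder_tendsto: "(\<lambda>n. real n * remainder (mesh n)) \<longlonglongrightarrow> 0"
proof (rule Lim_transform_eventually)
  define R where "R = (\<lambda>h. (u - r) * (q\<^sup>2 * h / (8 * \<delta> ^ 4) + (8 * ln (2 * K / \<delta>) + 1) *
     (sqrt h + 8 * ((q / (2 * \<delta>\<^sup>2)) ^ 4 * (h\<^sup>2 * sqrt h) + c * sqrt h / \<delta> ^ 4))))"
  have "(\<lambda>n. R (mesh n)) \<longlonglongrightarrow> R 0"
    unfolding R_def by (intro tendsto_intros mesh_tendsto) (use \<delta> in auto)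
  then show "(\<lambda>n. R (mesh n)) \<longlonglongrightarrow> 0" by (simp add: R_def)
  show "eventually (\<lambda>n. R (mesh n) = real n * remainder (mesh n)) sequentially"
    using eventually_gt_at_top[of 0]
  proof eventually_elim
    case (elim n)
    define h where "h = mesh n"
    have h: "0 < h" unfolding h_def using elim by (rule mesh_pos)
    define w where "w = sqrt h"
    have w: "0 < w" "h = w\<^sup>2" using h by (auto simp: w_def)
    have "remainder h = h * (q\<^sup>2 * h / (8 * \<delta> ^ 4) + (8 * ln (2 * K / \<delta>) + 1) *
     (sqrt h + 8 * ((q / (2 * \<delta>\<^sup>2)) ^ 4 * (h\<^sup>2 * sqrt h) + c * sqrt h / \<delta> ^ 4)))"
      unfolding remainder_def w_def[symmetric] unfolding w(2) using w(1) \<delta>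
      by (simp add: field_simps eval_nat_numeral)
    then show ?case using n_mesh[OF elim] unfolding R_def h_def[symmetric] by (metis mult.assoc)
  qed
qed

text \<open>
  The path of \<open>X\<close> itself may explode at \<open>T\<close>; its truncated reciprocal then tends to \<open>0\<close> and still
  has a limit.
\<close>

lemma uniformly_continuous_reciprocal:
  "AE \<omega> in M. \<omega> \<in> \<Gamma> \<longrightarrow>
     uniformly_continuous_on {t \<in> {r..u}. ennreal t < T \<omega>} (\<lambda>t. 1 / max \<delta> (X t \<omega>))"
  using X_left_limit X_continuous
proof eventually_elim
  case (elim \<omega>)
  show ?case
  proof
    assume \<omega>: "\<omega> \<in> \<Gamma>"
    let ?D = "{t \<in> {r..u}. ennreal t < T \<omega>}"
    have cont: "continuous_on ?D (\<lambda>t. 1 / max \<delta> (X t \<omega>))"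
      using elim(2) \<omega> \<delta> by (intro continuous_intros) auto
    show "uniformly_continuous_on ?D (\<lambda>t. 1 / max \<delta> (X t \<omega>))"
    proof (cases "ennreal u < T \<omega>")
      case True
      then have "?D = {r..u}" by (auto intro: le_less_trans[OF ennreal_leI])
      then show ?thesis using cont by (auto intro: compact_uniformly_continuous)
    next
      case False
      define v where "v = enn2real (T \<omega>)"
      have Tv: "T \<omega> = ennreal v" using False by (cases "T \<omega>") (auto simp: v_def)
      have v0: "0 \<le> v" by (simp add: v_def)
      have rv: "r < v" using \<Gamma>_T[OF \<omega>] r_nonneg unfolding Tv by (simp add: ennreal_less_iff)
      have vu: "v \<le> u" using False r_nonneg r_less_u v0 unfolding Tv by (simp add: ennreal_less_iff not_less)
      have D: "?D = {r..<v}" using vu r_nonneg unfolding Tv by (auto simp: ennreal_less_iff)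
      from elim(1) \<omega> rv vu consider l where "((\<lambda>s. X s \<omega>) \<longlongrightarrow> l) (at_left v)" | "filterlim (\<lambda>s. X s \<omega>) at_top (at_left v)"
        unfolding Tv by blast
      then have "\<exists>l. ((\<lambda>t. 1 / max \<delta> (X t \<omega>)) \<longlongrightarrow> l) (at_left v)"
      proof cases
        case 1
        then have "((\<lambda>t. 1 / max \<delta> (X t \<omega>)) \<longlongrightarrow> 1 / max \<delta> l) (at_left v)"
          using \<delta> by (intro tendsto_intros) auto
        then show ?thesis by blast
      next
        case 2
        then have "filterlim (\<lambda>t. max \<delta> (X t \<omega>)) at_top (at_left v)"
          by (rule filterlim_at_top_mono) auto
        then have "((\<lambda>t. 1 / max \<delta> (X t \<omega>)) \<longlongrightarrow> 0) (at_left v)"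
          using tendsto_inverse_0_at_top by (auto simp: inverse_eq_divide)
        then show ?thesis by blast
      qed
      then show ?thesis
        using uniformly_continuous_on_left_limit[OF rv] cont unfolding D by blast
    qed
  qed
qed

text \<open>
  The sum of the deficits is at most \<open>q (u - r) / 2\<close> times the modulus of continuity of the
  truncated reciprocal, and it is bounded; dominated convergence applies.
\<close>

lemma deficit_tendsto: "(\<lambda>n. expectation (\<lambda>\<omega>. \<Sum>i<n. deficit n i \<omega>)) \<longlonglongrightarrow> 0"
proof -
  have "(\<lambda>n. expectation (\<lambda>\<omega>. \<Sum>i<n. deficit n i \<omega>)) \<longlonglongrightarrow> expectation (\<lambda>_. 0)"
  proof (rule integral_dominated_convergence[where w = "\<lambda>_. q * (u - r) / (2 * \<delta>)"])
    show "AE \<omega> in M. norm (\<Sum>i<n. deficit n i \<omega>) \<le> q * (u - r) / (2 * \<delta>)" for n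
      using deficit_le
    proof eventually_elim
      case (elim \<omega>)
      have "(\<Sum>i<n. deficit n i \<omega>) \<le> (\<Sum>i<n. q * mesh n / (2 * \<delta>))"
        using elim by (intro sum_mono) auto
      also have "\<dots> = q * (real n * mesh n) / (2 * \<delta>)" by simp
      also have "\<dots> \<le> q * (u - r) / (2 * \<delta>)"
        using q_pos \<delta> r_less_u by (cases "n = 0") (auto simp: n_mesh)
      finally show ?case using sum_nonneg[of "{..<n}" "\<lambda>i. deficit n i \<omega>"] by (simp add: deficit_nonneg)
    qed
    show "AE \<omega> in M. (\<lambda>n. \<Sum>i<n. deficit n i \<omega>) \<longlonglongrightarrow> 0"
      using deficit_oscillation uniformly_continuous_reciprocal
    proof eventually_elim
      case (elim \<omega>)
      show ?case
      proof (cases "\<omega> \<in> \<Gamma>")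
        case False
        then show ?thesis by (simp add: deficit_def active_def)
      next
        case True
        define \<phi> where "\<phi> t = 1 / max \<delta> (X t \<omega>)" for t
        define D where "D = {t \<in> {r..u}. ennreal t < T \<omega>}"
        have uc: "uniformly_continuous_on D \<phi>" using elim(2) True by (simp add: \<phi>_def[abs_def] D_def)
        show ?thesis
        proof (rule LIMSEQ_I)
          fix e :: real assume e: "0 < e"
          define e' where "e' = e / (q * (u - r))"
          have e': "0 < e'" "q * (u - r) * e' = e" using e q_pos r_less_u by (auto simp: e'_def)
          obtain d where d: "0 < d" "\<And>s t. s \<in> D \<Longrightarrow> t \<in> D \<Longrightarrow> dist t s < d \<Longrightarrow> dist (\<phi> t) (\<phi> s) < e'"
            using uc e'(1) unfolding uniformly_continuous_on_def by metis
          obtain n0 where n0: "\<And>n. n0 \<le> n \<Longrightarrow> mesh n < d"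
            using eventually_mesh_less[OF d(1)] by (auto simp: eventually_sequentially)
          have "norm ((\<Sum>i<n. deficit n i \<omega>) - 0) < e" if n: "max 1 n0 \<le> n" for n
          proof -
            have "deficit n i \<omega> \<le> q * mesh n / 2 * e'" if i: "i < n" for i
            proof (cases "\<omega> \<in> active n i \<and> ennreal (grid n (Suc i)) < T \<omega>")
              case a: True
              then obtain v where v: "v \<in> {grid n i..grid n (Suc i)}"
                "deficit n i \<omega> \<le> q * mesh n / 2 * (\<phi> (grid n i) - \<phi> v)"
                using elim(1) i unfolding \<phi>_def by blast
              have "grid n (Suc i) \<le> u" using i by (intro grid_le) auto
              then have "v \<in> D" "grid n i \<in> D"
                using v(1) a grid_ge[of n i] by (auto simp: D_def intro: le_less_trans[OF ennreal_leI])
              moreover have "dist v (grid n i) < d"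
                using v(1) n0[of n] n by (auto simp: dist_real_def grid_Suc)
              ultimately have "dist (\<phi> v) (\<phi> (grid n i)) < e'" using d(2) by blast
              then have "\<phi> (grid n i) - \<phi> v \<le> e'" by (simp add: dist_real_def abs_if split: if_splits)
              then have "q * mesh n / 2 * (\<phi> (grid n i) - \<phi> v) \<le> q * mesh n / 2 * e'"
                using q_pos mesh_nonneg[of n] by (intro mult_left_mono) auto
              then show ?thesis using v(2) by linarith
            qed (use q_pos mesh_nonneg[of n] e' in \<open>auto simp: deficit_def\<close>)
            then have "(\<Sum>i<n. deficit n i \<omega>) \<le> (\<Sum>i<n. q * mesh n / 2 * e')"
              by (intro sum_mono) auto
            also have "\<dots> = q * (real n * mesh n) * e' / 2" by simp
            also have "\<dots> = e / 2" using n e' by (simp add: n_mesh)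
            finally show ?thesis
              using e sum_nonneg[of "{..<n}" "\<lambda>i. deficit n i \<omega>"] by (simp add: deficit_nonneg)
          qed
          then show "\<exists>no. \<forall>n\<ge>no. norm ((\<Sum>i<n. deficit n i \<omega>) - 0) < e" by blast
        qed
      qed
    qed
  qed (auto intro!: borel_measurable_sum borel_measurable_integrable[OF deficit_integrable])
  then show ?thesis by simp
qed

text \<open>
  At most one step of the grid contains \<open>T\<close>.
\<close>

lemma overshoot_sum_cases: "(\<Sum>i<n. overshoot n i \<omega>) = 0 \<or> (\<exists>i<n. \<omega> \<in> active n i \<and>
    \<not> ennreal (grid n (Suc i)) < T \<omega> \<and> (\<Sum>i<n. overshoot n i \<omega>) = overshoot n i \<omega>)"
proof (cases "\<exists>i<n. \<omega> \<in> active n i \<and> \<not> ennreal (grid n (Suc i)) < T \<omega>")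
  case True
  then obtain i where i: "i < n" "\<omega> \<in> active n i" "\<not> ennreal (grid n (Suc i)) < T \<omega>" by blast
  have "overshoot n j \<omega> = 0" if "j \<noteq> i" for j
  proof (cases "j < i")
    case True
    then have "ennreal (grid n (Suc j)) < T \<omega>" using active_D(2)[OF i(2), of "Suc j"] by simp
    then show ?thesis by (simp add: overshoot_def)
  next
    case False
    then have "i < j" using that by simp
    then have "\<omega> \<notin> active n j" using i(3) active_D(2)[of \<omega> n j "Suc i"] by auto
    then show ?thesis by (simp add: overshoot_def)
  qed
  then have "(\<Sum>j<n. overshoot n j \<omega>) = (\<Sum>j\<in>{i}. overshoot n j \<omega>)"
    using i(1) by (intro sum.mono_neutral_right) auto
  then show ?thesis using i by auto
next
  case False
  then have "(\<Sum>i<n. overshoot n i \<omega>) = 0" by (intro sum.neutral) (auto simp: overshoot_def)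
  then show ?thesis ..
qed

lemma overshoot_path_tendsto: "AE \<omega> in M. (\<lambda>n. \<Sum>i<n. overshoot n i \<omega>) \<longlonglongrightarrow> 0"
  using L_continuous
proof eventually_elim
  case (elim \<omega>)
  then have uc: "uniformly_continuous_on {r..u} (\<lambda>t. L t \<omega>)" by (rule compact_uniformly_continuous) simp
  show ?case
  proof (rule LIMSEQ_I)
    fix e :: real assume e: "0 < e"
    obtain d where d: "0 < d" "\<And>s t. s \<in> {r..u} \<Longrightarrow> t \<in> {r..u} \<Longrightarrow> dist t s < d \<Longrightarrow> dist (L t \<omega>) (L s \<omega>) < e"
      using uc e unfolding uniformly_continuous_on_def by metis
    obtain n0 where n0: "\<And>n. n0 \<le> n \<Longrightarrow> mesh n < d"
      using eventually_mesh_less[OF d(1)] by (auto simp: eventually_sequentially)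
    have "norm ((\<Sum>i<n. overshoot n i \<omega>) - 0) < e" if n: "n0 \<le> n" for n
    proof -
      have "overshoot n i \<omega> < e" if i: "i < n" for i
      proof -
        have "grid n i \<in> {r..u}" "grid n (Suc i) \<in> {r..u}" using i by (auto intro!: grid_ge grid_le)
        moreover have "dist (grid n (Suc i)) (grid n i) < d"
          using n0[OF n] mesh_nonneg[of n] by (simp add: grid_Suc dist_real_def)
        ultimately have "dist (L (grid n (Suc i)) \<omega>) (L (grid n i) \<omega>) < e" using d(2) by blast
        then show ?thesis using e by (auto simp: overshoot_def dist_real_def)
      qed
      then have "(\<Sum>i<n. overshoot n i \<omega>) < e" using overshoot_sum_cases[of n \<omega>] e by auto
      then show ?thesis using sum_nonneg[of "{..<n}" "\<lambda>i. overshoot n i \<omega>"] by (simp add: overshoot_nonneg)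
    qed
    then show "\<exists>no. \<forall>n\<ge>no. norm ((\<Sum>i<n. overshoot n i \<omega>) - 0) < e" by blast
  qed
qed

text \<open>
  The increments of \<open>L\<close> have the same conditional means as the squared increments of \<open>N\<close>.
\<close>

lemma L_submartingale:
  assumes s: "r \<le> s" "s \<le> u" and C: "C \<in> sets (F (ennreal s))"
  shows "expectation (\<lambda>\<omega>. indicator C \<omega> * L s \<omega>) \<le> expectation (\<lambda>\<omega>. indicator C \<omega> * L u \<omega>)"
proof -
  have CM[measurable]: "C \<in> sets M" by (rule sets_F_M[OF C])
  have i: "integrable M (\<lambda>\<omega>. indicator C \<omega> * L s \<omega>)" "integrable M (\<lambda>\<omega>. indicator C \<omega> * L u \<omega>)"
    using s r_less_u by (auto intro!: integrable_bounded_mult[where b=1] L_integrable simp: indicator_def)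
  have "0 \<le> expectation (\<lambda>\<omega>. indicator C \<omega> * (N u \<omega> - N s \<omega>)\<^sup>2)" by (intro Bochner_Integration.integral_nonneg) auto
  also have "\<dots> = expectation (\<lambda>\<omega>. indicator C \<omega> * (L u \<omega> - L s \<omega>))"
    using s C by (intro N_bracket[where b=1]) (auto simp: indicator_def)
  also have "\<dots> = expectation (\<lambda>\<omega>. indicator C \<omega> * L u \<omega>) - expectation (\<lambda>\<omega>. indicator C \<omega> * L s \<omega>)"
    using i by (simp add: right_diff_distrib)
  finally show ?thesis by simp
qed

text \<open>
  The overshoot tends to \<open>0\<close> on each path since \<open>L\<close> is continuous, but \<open>L\<close> at the first grid
  point after \<open>T\<close> has no obvious integrable bound. The part where the overshoot is at most \<open>1\<close> is
  handled by bounded convergence. Where it exceeds \<open>1\<close>, an event known at that grid point, the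
  submartingale property replaces the value of \<open>L\<close> there by its value at time \<open>u\<close>, and the value
  at the preceding grid point, which lies before \<open>T\<close>, differs from \<open>L r\<close> by at most \<open>q (u - r)\<close>.
  This gives the fixed integrable bound \<open>Q\<close>, restricted to an event that eventually fails on
  almost every path.
\<close>

lemma overshoot_tendsto: "(\<lambda>n. expectation (\<lambda>\<omega>. \<Sum>i<n. overshoot n i \<omega>)) \<longlonglongrightarrow> 0"
proof -
  define Z where "Z n \<omega> = (\<Sum>i<n. overshoot n i \<omega>)" for n \<omega>
  define Q where "Q \<omega> = \<bar>L u \<omega>\<bar> + \<bar>L r \<omega>\<bar> + q * (u - r)" for \<omega>
  define C where "C n i = {\<omega> \<in> active n i. \<not> ennreal (grid n (Suc i)) < T \<omega>
      \<and> 1 < L (grid n (Suc i)) \<omega> - L (grid n i) \<omega>}" for n i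
  let ?W = "\<lambda>n i \<omega>. indicator (C n i) \<omega> * (L (grid n (Suc i)) \<omega> - L (grid n i) \<omega>)"
  have Z_int: "integrable M (Z n)" for n
    unfolding Z_def by (intro Bochner_Integration.integrable_sum overshoot_measurable(2)) auto
  note [measurable] = borel_measurable_integrable[OF Z_int]
  have Z0: "0 \<le> Z n \<omega>" for n \<omega> unfolding Z_def by (intro sum_nonneg overshoot_nonneg)
  have Q_int: "integrable M Q"
    unfolding Q_def using r_less_u by (intro Bochner_Integration.integrable_add integrable_abs L_integrable) auto
  note [measurable] = borel_measurable_integrable[OF Q_int]
  have Q0: "0 \<le> Q \<omega>" for \<omega> unfolding Q_def using q_pos r_less_u by simp
  have lim: "AE \<omega> in M. (\<lambda>n. Z n \<omega>) \<longlonglongrightarrow> 0" using overshoot_path_tendsto by (simp add: Z_def)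
  have C_sets: "C n i \<in> sets (F (ennreal (grid n (Suc i))))" if i: "i < n" for n i
  proof -
    let ?G = "F (ennreal (grid n (Suc i)))"
    have le: "ennreal (grid n i) \<le> ennreal (grid n (Suc i))" by (intro ennreal_leI grid_mono) simp
    have [measurable]: "L (grid n (Suc i)) \<in> borel_measurable ?G"
      using i by (intro L_adapted grid_ge grid_le) auto
    have [measurable]: "L (grid n i) \<in> borel_measurable ?G"
      using i by (intro measurable_F_mono[OF le] L_adapted grid_ge grid_le) auto
    have [measurable]: "active n i \<in> sets ?G"
      using active_sets[of i n] sets_F_mono[OF le] i by auto
    have [measurable]: "{\<omega> \<in> space M. ennreal (grid n (Suc i)) < T \<omega>} \<in> sets ?G" by (rule less_T_sets)
    have "C n i = {\<omega> \<in> space ?G. \<omega> \<in> active n i \<and> 1 < L (grid n (Suc i)) \<omega> - L (grid n i) \<omega>}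
        - {\<omega> \<in> space M. ennreal (grid n (Suc i)) < T \<omega>}"
      using \<Gamma>_space by (auto simp: C_def space_F active_def)
    also have "\<dots> \<in> sets ?G" by measurable
    finally show ?thesis .
  qed
  have CM[measurable]: "C n i \<in> sets M" if "i < n" for n i by (rule sets_F_M[OF C_sets[OF that]])
  have Z_le: "Z n \<omega> \<le> min (Z n \<omega>) 1 + (\<Sum>i<n. ?W n i \<omega>)" for n \<omega>
  proof -
    have nn: "0 \<le> ?W n i \<omega>" for i
      by (auto simp: indicator_def C_def)
    show ?thesis
    proof (cases "Z n \<omega> \<le> 1")
      case True
      then show ?thesis using sum_nonneg[of "{..<n}" "\<lambda>i. ?W n i \<omega>"] nn
        by simp
    next
      case False
      then obtain i where i: "i < n" "\<omega> \<in> active n i" "\<not> ennreal (grid n (Suc i)) < T \<omega>" "Z n \<omega> = overshoot n i \<omega>"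
        using overshoot_sum_cases[of n \<omega>] by (auto simp: Z_def)
      then have "Z n \<omega> = ?W n i \<omega>"
        using False by (auto simp: overshoot_def C_def indicator_def max_def split: if_splits)
      also have "\<dots> \<le> (\<Sum>i<n. ?W n i \<omega>)"
        using i(1) nn by (intro member_le_sum) auto
      finally show ?thesis using Z0[of n \<omega>] by simp
    qed
  qed
  have C_le: "(\<Sum>i<n. indicator (C n i) \<omega>) \<le> (if 1 < Z n \<omega> then 1 else (0::real))" for n \<omega>
  proof (cases "\<exists>i<n. \<omega> \<in> C n i")
    case True
    then obtain i where i: "i < n" "\<omega> \<in> C n i" by blast
    have "\<omega> \<notin> C n j" if "j \<noteq> i" for j
      using that i(2) active_D(2)[of \<omega> n j "Suc i"] active_D(2)[of \<omega> n i "Suc j"]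
      by (auto simp: C_def not_less_eq_eq[symmetric] Suc_le_eq neq_iff)
    then have "(\<Sum>i<n. indicator (C n i) \<omega>) = (\<Sum>j\<in>{i}. indicator (C n j) \<omega> :: real)"
      using i(1) by (intro sum.mono_neutral_right) auto
    moreover have "1 < overshoot n i \<omega>" using i(2) by (auto simp: C_def overshoot_def)
    moreover have "overshoot n i \<omega> \<le> Z n \<omega>"
      unfolding Z_def using i(1) by (intro member_le_sum) (auto simp: overshoot_nonneg)
    ultimately show ?thesis using i by simp
  next
    case False
    then have "(\<Sum>i<n. indicator (C n i) \<omega> :: real) = 0" by (intro sum.neutral) auto
    then show ?thesis by simp
  qed
  have step: "expectation (\<lambda>\<omega>. ?W n i \<omega>)
      \<le> expectation (\<lambda>\<omega>. indicator (C n i) \<omega> * Q \<omega>)" if i: "i < n" for n i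
  proof -
    note CM[OF i, measurable]
    have ii: "integrable M (\<lambda>\<omega>. indicator (C n i) \<omega> * L t \<omega>)" if "r \<le> t" "t \<le> u" for t
      using that by (auto intro!: integrable_bounded_mult[where b=1] L_integrable simp: indicator_def)
    have g: "r \<le> grid n i" "grid n i \<le> u" "r \<le> grid n (Suc i)" "grid n (Suc i) \<le> u"
      using i by (auto intro!: grid_ge grid_le)
    have ru: "r \<le> u" using r_less_u by simp
    have "expectation (\<lambda>\<omega>. ?W n i \<omega>)
      = expectation (\<lambda>\<omega>. indicator (C n i) \<omega> * L (grid n (Suc i)) \<omega>) - expectation (\<lambda>\<omega>. indicator (C n i) \<omega> * L (grid n i) \<omega>)"
      using ii g by (simp add: right_diff_distrib)
    also have "\<dots> \<le> expectation (\<lambda>\<omega>. indicator (C n i) \<omega> * L u \<omega>) - expectation (\<lambda>\<omega>. indicator (C n i) \<omega> * L (grid n i) \<omega>)"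
      using L_submartingale[OF g(3,4) C_sets[OF i]] by simp
    also have "\<dots> = expectation (\<lambda>\<omega>. indicator (C n i) \<omega> * L u \<omega> - indicator (C n i) \<omega> * L (grid n i) \<omega>)"
      using ii g ru by simp
    also have "\<dots> \<le> expectation (\<lambda>\<omega>. indicator (C n i) \<omega> * Q \<omega>)"
    proof (rule integral_mono_AE)
      show "integrable M (\<lambda>\<omega>. indicator (C n i) \<omega> * Q \<omega>)"
        by (intro integrable_bounded_mult[where b=1] Q_int) (auto simp: indicator_def)
      show "AE \<omega> in M. indicator (C n i) \<omega> * L u \<omega> - indicator (C n i) \<omega> * L (grid n i) \<omega> \<le> indicator (C n i) \<omega> * Q \<omega>"
        using L_growth
      proof eventually_elim
        case (elim \<omega>)
        show ?case
        proof (cases "\<omega> \<in> C n i")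
          case True
          then have a: "\<omega> \<in> active n i" by (simp add: C_def)
          have "\<bar>L (grid n i) \<omega> - L r \<omega>\<bar> \<le> q * (grid n i - r)"
            using elim active_D(1,2)[OF a order_refl] g by blast
          also have "\<dots> \<le> q * (u - r)" using q_pos g by (intro mult_left_mono) auto
          finally show ?thesis using True by (simp add: Q_def)
        qed simp
      qed
    qed (use ii g ru in auto)
    finally show ?thesis .
  qed
  have bound: "expectation (Z n) \<le> expectation (\<lambda>\<omega>. min (Z n \<omega>) 1) + expectation (\<lambda>\<omega>. (if 1 < Z n \<omega> then 1 else 0) * Q \<omega>)" for n
  proof -
    have i1: "integrable M (\<lambda>\<omega>. min (Z n \<omega>) 1)" using Z_int by (intro integrable_min) auto
    have i2: "integrable M (\<lambda>\<omega>. ?W n i \<omega>)" if i: "i < n" for i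
    proof -
      note CM[OF i, measurable]
      show ?thesis using i
        by (auto intro!: integrable_bounded_mult[where b=1] Bochner_Integration.integrable_diff L_integrable grid_ge grid_le simp: indicator_def)
    qed
    have i3: "integrable M (\<lambda>\<omega>. indicator (C n i) \<omega> * Q \<omega>)" if i: "i < n" for i
    proof -
      note CM[OF i, measurable]
      show ?thesis by (auto intro!: integrable_bounded_mult[where b=1] Q_int simp: indicator_def)
    qed
    have i4: "integrable M (\<lambda>\<omega>. (if 1 < Z n \<omega> then 1 else 0) * Q \<omega>)"
      by (intro integrable_bounded_mult[where b=1] Q_int) auto
    have "expectation (Z n) \<le> expectation (\<lambda>\<omega>. min (Z n \<omega>) 1 + (\<Sum>i<n. ?W n i \<omega>))"
      using Z_int i1 i2 Z_le by (intro integral_mono Bochner_Integration.integrable_add Bochner_Integration.integrable_sum) auto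
    also have "\<dots> = expectation (\<lambda>\<omega>. min (Z n \<omega>) 1) + (\<Sum>i<n. expectation (\<lambda>\<omega>. ?W n i \<omega>))"
    proof -
      have "integrable M (\<lambda>\<omega>. \<Sum>i<n. ?W n i \<omega>)"
        by (rule Bochner_Integration.integrable_sum) (rule i2, simp)
      moreover have "expectation (\<lambda>\<omega>. \<Sum>i<n. ?W n i \<omega>)
        = (\<Sum>i<n. expectation (\<lambda>\<omega>. ?W n i \<omega>))"
        by (rule Bochner_Integration.integral_sum) (rule i2, simp)
      ultimately show ?thesis using Bochner_Integration.integral_add[OF i1] by simp
    qed
    also have "\<dots> \<le> expectation (\<lambda>\<omega>. min (Z n \<omega>) 1) + (\<Sum>i<n. expectation (\<lambda>\<omega>. indicator (C n i) \<omega> * Q \<omega>))"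
      by (intro add_left_mono sum_mono step) auto
    also have "(\<Sum>i<n. expectation (\<lambda>\<omega>. indicator (C n i) \<omega> * Q \<omega>)) = expectation (\<lambda>\<omega>. (\<Sum>i<n. indicator (C n i) \<omega>) * Q \<omega>)"
      unfolding sum_distrib_right by (rule Bochner_Integration.integral_sum[symmetric]) (rule i3, simp)
    also have "\<dots> \<le> expectation (\<lambda>\<omega>. (if 1 < Z n \<omega> then 1 else 0) * Q \<omega>)"
    proof (intro integral_mono mult_right_mono C_le Q0 i4)
      show "integrable M (\<lambda>\<omega>. (\<Sum>i<n. indicator (C n i) \<omega>) * Q \<omega>)"
        unfolding sum_distrib_right by (rule Bochner_Integration.integrable_sum) (rule i3, simp)
    qed
    finally show ?thesis by simp
  qed
  have l1: "(\<lambda>n. expectation (\<lambda>\<omega>. min (Z n \<omega>) 1)) \<longlonglongrightarrow> expectation (\<lambda>_. 0)"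
  proof (rule integral_dominated_convergence[where w = "\<lambda>_. 1"])
    show "AE \<omega> in M. (\<lambda>n. min (Z n \<omega>) 1) \<longlonglongrightarrow> 0"
      using lim by eventually_elim (rule tendsto_eq_intros | simp)+
    show "AE \<omega> in M. norm (min (Z n \<omega>) 1) \<le> 1" for n using Z0[of n] by auto
  qed auto
  have l2: "(\<lambda>n. expectation (\<lambda>\<omega>. (if 1 < Z n \<omega> then 1 else 0) * Q \<omega>)) \<longlonglongrightarrow> expectation (\<lambda>_. 0)"
  proof (rule integral_dominated_convergence[where w = Q])
    show "AE \<omega> in M. (\<lambda>n. (if 1 < Z n \<omega> then 1 else 0) * Q \<omega>) \<longlonglongrightarrow> 0"
      using lim
    proof eventually_elim
      case (elim \<omega>)
      have "eventually (\<lambda>n. Z n \<omega> < 1) sequentially" using order_tendstoD(2)[OF elim] by simp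
      then have "eventually (\<lambda>n. (if 1 < Z n \<omega> then 1 else 0) * Q \<omega> = 0) sequentially"
        by eventually_elim simp
      then show ?case by (rule tendsto_eventually)
    qed
    show "AE \<omega> in M. norm ((if 1 < Z n \<omega> then 1 else 0) * Q \<omega>) \<le> Q \<omega>" for n using Q0 by auto
  qed (use Q_int in auto)
  have "(\<lambda>n. expectation (Z n)) \<longlonglongrightarrow> 0"
  proof (rule tendsto_sandwich[OF _ _ tendsto_const])
    show "eventually (\<lambda>n. 0 \<le> expectation (Z n)) sequentially" using Z0 by (simp add: Bochner_Integration.integral_nonneg)
    show "eventually (\<lambda>n. expectation (Z n) \<le> expectation (\<lambda>\<omega>. min (Z n \<omega>) 1) + expectation (\<lambda>\<omega>. (if 1 < Z n \<omega> then 1 else 0) * Q \<omega>)) sequentially"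
      using bound by simp
    show "(\<lambda>n. expectation (\<lambda>\<omega>. min (Z n \<omega>) 1) + expectation (\<lambda>\<omega>. (if 1 < Z n \<omega> then 1 else 0) * Q \<omega>)) \<longlonglongrightarrow> 0"
      using tendsto_add[OF l1 l2] by simp
  qed
  then show ?thesis by (simp add: Z_def[abs_def])
qed

end

section \<open>The origin is not reached\<close>

context critical_drift_process
begin

definition absorbed_below :: "real \<Rightarrow> 'a \<Rightarrow> bool" where
  "absorbed_below K \<omega> \<longleftrightarrow> \<omega> \<in> \<Gamma> \<and> (\<exists>t. r < t \<and> t \<le> u \<and> ennreal t \<le> T \<omega> \<and>
     ((\<lambda>s. X s \<omega>) \<longlongrightarrow> 0) (at_left t) \<and> (\<forall>v\<in>{r..<t}. X v \<omega> < K))"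

end

context barrier_strip
begin

text \<open>
  On a fine grid some point falls into the interval before the absorption time on which \<open>X < \<delta>\<close>;
  the first grid point with a value at or below \<open>\<delta>\<close> is the exit from the strip.
\<close>

lemma absorbed_imp_hit:
  assumes "absorbed_below K \<omega>" "\<delta> < X r \<omega>"
  shows "eventually (\<lambda>n. \<omega> \<in> hit n n) sequentially"
proof -
  from assms(1) obtain t where \<omega>: "\<omega> \<in> \<Gamma>" and t: "r < t" "t \<le> u" "ennreal t \<le> T \<omega>"
    "((\<lambda>s. X s \<omega>) \<longlongrightarrow> 0) (at_left t)" and XK: "\<And>v. r \<le> v \<Longrightarrow> v < t \<Longrightarrow> X v \<omega> < K"
    by (auto simp: absorbed_below_def)
  have "eventually (\<lambda>s. X s \<omega> < \<delta>) (at_left t)" using order_tendstoD(2)[OF t(4) \<delta>] .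
  then obtain s0 where s0: "s0 < t" "\<And>s. s0 < s \<Longrightarrow> s < t \<Longrightarrow> X s \<omega> < \<delta>"
    by (auto simp: eventually_at_left_field)
  define s1 where "s1 = max r s0"
  have s1: "r \<le> s1" "s1 < t" "\<And>s. s1 < s \<Longrightarrow> s < t \<Longrightarrow> X s \<omega> < \<delta>"
    using s0 t by (auto simp: s1_def)
  have "eventually (\<lambda>n. mesh n < t - s1) sequentially" using s1 by (intro eventually_mesh_less) simp
  then show ?thesis using eventually_gt_at_top[of 0]
  proof eventually_elim
    case (elim n)
    define h where "h = mesh n"
    have h: "0 < h" "h < t - s1" using mesh_pos[OF elim(2)] elim(1) by (auto simp: h_def)
    \<comment> \<open>the first grid point beyond \<open>s1\<close>\<close>
    define i where "i = Suc (nat \<lfloor>(s1 - r) / h\<rfloor>)"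
    have "0 \<le> (s1 - r) / h" using s1 h by simp
    then have "real i = of_int \<lfloor>(s1 - r) / h\<rfloor> + 1" by (simp add: i_def)
    then have "(s1 - r) / h < real i" "real i \<le> (s1 - r) / h + 1" by linarith+
    then have "s1 - r < real i * h" "real i * h \<le> s1 - r + h" using h by (simp_all add: field_simps)
    then have gi: "s1 < grid n i" "grid n i < t" using h by (auto simp: grid_def h_def)
    define P where "P k \<longleftrightarrow> grid n k < t \<and> X (grid n k) \<omega> \<le> \<delta>" for k
    have "P i" using gi s1(3) by (auto simp: P_def intro: less_imp_le)
    define m where "m = (LEAST k. P k)"
    have Pm: "P m" unfolding m_def using \<open>P i\<close> by (rule LeastI)
    have not_P: "\<not> P k" if "k < m" for k using that not_less_Least unfolding m_def by blast
    have "m \<noteq> 0" using Pm assms(2) by (auto simp: P_def intro: ccontr)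
    then obtain k where k: "m = Suc k" by (cases m) auto
    have gm: "grid n m < t" using Pm by (simp add: P_def)
    have gj: "grid n j < t" if "j \<le> m" for j using grid_mono[OF that, of n] gm by simp
    have Tj: "ennreal (grid n j) < T \<omega>" if "j \<le> m" for j
      using gj[OF that] grid_ge[of n j] r_nonneg t(3) by (intro less_le_trans[OF ennreal_lessI t(3)]) auto
    have "\<omega> \<in> active n k"
      unfolding active_def using \<omega> Tj gj XK grid_ge not_P k by (auto simp: P_def not_le)
    moreover have "k < n"
    proof (rule ccontr)
      assume "\<not> k < n"
      then have "grid n n \<le> grid n m" using k by (intro grid_mono) simp
      then show False using gm t(2) n_mesh[OF elim(2)] by (simp add: grid_def)
    qed
    ultimately show "\<omega> \<in> hit n n" using Tj[of m] Pm k by (auto simp: hit_def P_def)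
  qed
qed

text \<open>
  The set of all paths that are absorbed need not be measurable, so it is enclosed in the event
  that the strip is left through \<open>\<delta>\<close> on all sufficiently fine grids.
\<close>

lemma eventually_hit_prob:
  assumes \<epsilon>: "\<delta> < \<epsilon>" "\<epsilon> \<le> K" "\<And>\<omega>. \<omega> \<in> \<Gamma> \<Longrightarrow> \<epsilon> \<le> X r \<omega>"
  shows "\<exists>H\<in>sets M. prob H \<le> (ln (2 * K) - ln \<epsilon>) / (ln (2 * K) - ln \<delta>) \<and> {\<omega>. absorbed_below K \<omega>} \<subseteq> H"
proof -
  define b where "b = (ln (2 * K) - ln \<epsilon>) / (ln (2 * K) - ln \<delta>)"
  define B where "B n = (ln (2 * K) - ln \<epsilon>
    + 2 / \<delta> * expectation (\<lambda>\<omega>. \<Sum>i<n. deficit n i \<omega>)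
    + 1 / (2 * \<delta>\<^sup>2) * expectation (\<lambda>\<omega>. \<Sum>i<n. overshoot n i \<omega>) + real n * remainder (mesh n))
    / (ln (2 * K) - ln \<delta>)" for n
  have pos: "0 < ln (2 * K) - ln \<delta>" using \<delta> \<delta>K by simp
  have "B \<longlonglongrightarrow> (ln (2 * K) - ln \<epsilon> + 2 / \<delta> * 0 + 1 / (2 * \<delta>\<^sup>2) * 0 + 0) / (ln (2 * K) - ln \<delta>)"
    unfolding B_def using pos
    by (intro tendsto_intros deficit_tendsto overshoot_tendsto remainder_tendsto) auto
  then have B: "B \<longlonglongrightarrow> b" by (simp add: b_def)
  have hit_le: "prob (hit n n) \<le> B n" if "0 < n" for n
    using prob_hit_le[OF that \<epsilon>] pos unfolding B_def by (simp add: field_simps)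
  have hs [measurable]: "hit n n \<in> sets M" for n by (rule hit_sets) simp
  define H where "H m = (\<Inter>n\<in>{Suc m..}. hit n n)" for m
  have Hs: "H m \<in> sets M" for m unfolding H_def by (rule sets.countable_INT) auto
  have "prob (H m) \<le> b" for m
  proof (rule LIMSEQ_le_const[OF B], intro exI[of _ "Suc m"] allI impI)
    fix n assume n: "Suc m \<le> n"
    have "prob (H m) \<le> prob (hit n n)" using n by (intro finite_measure_mono) (auto simp: H_def)
    also have "\<dots> \<le> B n" using n by (intro hit_le) simp
    finally show "prob (H m) \<le> B n" .
  qed
  moreover have "(\<lambda>m. prob (H m)) \<longlonglongrightarrow> prob (\<Union>m. H m)"
    using Hs by (intro finite_Lim_measure_incseq) (auto simp: incseq_def H_def)
  ultimately have "prob (\<Union>m. H m) \<le> b" by (intro LIMSEQ_le_const2) auto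
  moreover have "{\<omega>. absorbed_below K \<omega>} \<subseteq> (\<Union>m. H m)"
  proof clarify
    fix \<omega> assume a: "absorbed_below K \<omega>"
    then have "\<delta> < X r \<omega>" using \<epsilon> by (force simp: absorbed_below_def)
    then obtain m where "\<And>n. m \<le> n \<Longrightarrow> \<omega> \<in> hit n n"
      using absorbed_imp_hit[OF a] by (auto simp: eventually_sequentially)
    then show "\<omega> \<in> (\<Union>m. H m)" by (auto simp: H_def intro!: exI[of _ m])
  qed
  ultimately show ?thesis using Hs unfolding b_def by blast
qed

end

context critical_drift_process
begin

text \<open>
  The enclosing events have a probability of order \<open>1 / ln (1 / \<delta>)\<close>; let \<open>\<delta>\<close> run through a
  sequence that tends to \<open>0\<close>.
\<close>

lemma not_absorbed_below:
  assumes \<epsilon>: "0 < \<epsilon>" "\<epsilon> \<le> K" "\<And>\<omega>. \<omega> \<in> \<Gamma> \<Longrightarrow> \<epsilon> \<le> X r \<omega>"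
  shows "AE \<omega> in M. \<not> absorbed_below K \<omega>"
proof -
  \<comment> \<open>the exponent is \<open>Suc k\<close> because the levels have to lie strictly below \<open>\<epsilon>\<close>\<close>
  define lev where "lev k = \<epsilon> * exp (- real (Suc k))" for k
  have lev: "0 < lev k" "lev k < \<epsilon>" "ln (lev k) = ln \<epsilon> - real (Suc k)" for k
    using \<epsilon>(1) by (auto simp: lev_def ln_mult simp flip: exp_minus)
  have "\<exists>H\<in>sets M. prob H \<le> (ln (2 * K) - ln \<epsilon>) / (ln (2 * K) - ln (lev k)) \<and> {\<omega>. absorbed_below K \<omega>} \<subseteq> H" for k
  proof -
    interpret barrier_strip M F T \<Gamma> X N L q c r u "lev k" K
      by unfold_locales (use lev[of k] \<epsilon> in auto)
    show ?thesis by (rule eventually_hit_prob[OF lev(2) \<epsilon>(2,3)])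
  qed
  then obtain H where H: "\<And>k. H k \<in> sets M" "\<And>k. prob (H k) \<le> (ln (2 * K) - ln \<epsilon>) / (ln (2 * K) - ln (lev k))"
    "\<And>k. {\<omega>. absorbed_below K \<omega>} \<subseteq> H k" by metis
  have I: "(\<Inter>k. H k) \<in> sets M" using H(1) by auto
  have lim: "(\<lambda>k. (ln (2 * K) - ln \<epsilon>) / (ln (2 * K) - ln (lev k))) \<longlonglongrightarrow> 0"
  proof -
    have "filterlim (\<lambda>k. (ln (2 * K) - ln \<epsilon>) + real (Suc k)) at_top sequentially"
      by (intro filterlim_tendsto_add_at_top[OF tendsto_const] filterlim_compose[OF filterlim_real_sequentially filterlim_Suc])
    then have "(\<lambda>k. (ln (2 * K) - ln \<epsilon>) / ((ln (2 * K) - ln \<epsilon>) + real (Suc k))) \<longlonglongrightarrow> 0"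
      by (rule real_tendsto_divide_at_top[OF tendsto_const])
    then show ?thesis unfolding lev(3) by (simp add: algebra_simps)
  qed
  have "prob (\<Inter>k. H k) \<le> (ln (2 * K) - ln \<epsilon>) / (ln (2 * K) - ln (lev k))" for k
    using H(1)[of k] I by (intro order_trans[OF finite_measure_mono H(2)]) auto
  then have "prob (\<Inter>k. H k) \<le> 0" by (intro LIMSEQ_le_const[OF lim]) auto
  then have "prob (\<Inter>k. H k) = 0" using measure_nonneg[of M "\<Inter>k. H k"] by linarith
  then have "(\<Inter>k. H k) \<in> null_sets M" using I by (simp add: emeasure_eq_measure null_setsI)
  then show ?thesis by (rule AE_I') (use H(3) in blast)
qed

text \<open>
  A path with left limit \<open>0\<close> is bounded up to that time, hence absorbed below one of countably many
  levels.
\<close>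

lemma left_limit_nonzero:
  assumes \<epsilon>: "0 < \<epsilon>" "\<And>\<omega>. \<omega> \<in> \<Gamma> \<Longrightarrow> \<epsilon> \<le> X r \<omega>"
  shows "AE \<omega> in M. \<omega> \<in> \<Gamma> \<longrightarrow> (\<forall>t. r < t \<longrightarrow> t \<le> u \<longrightarrow> ennreal t \<le> T \<omega> \<longrightarrow>
     has_nonzero_left_limit (\<lambda>s. X s \<omega>) t)"
proof -
  have "AE \<omega> in M. \<forall>k. \<not> absorbed_below (\<epsilon> + real k) \<omega>"
    unfolding AE_all_countable using \<epsilon> by (intro allI not_absorbed_below[of \<epsilon>]) auto
  then show ?thesis using X_left_limit X_continuous
  proof eventually_elim
    case (elim \<omega>)
    show ?case
    proof (intro impI allI)
      fix t assume \<omega>: "\<omega> \<in> \<Gamma>" and t: "r < t" "t \<le> u" "ennreal t \<le> T \<omega>"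
      have "\<not> ((\<lambda>s. X s \<omega>) \<longlongrightarrow> 0) (at_left t)"
      proof
        assume lim: "((\<lambda>s. X s \<omega>) \<longlongrightarrow> 0) (at_left t)"
        have "{r..<t} \<subseteq> {t \<in> {r..u}. ennreal t < T \<omega>}"
          using t r_nonneg by (auto intro!: less_le_trans[OF ennreal_lessI t(3)])
        then have "continuous_on {r..<t} (\<lambda>s. X s \<omega>)"
          using elim(3) \<omega> continuous_on_subset by blast
        then have "uniformly_continuous_on {r..<t} (\<lambda>s. X s \<omega>)"
          by (rule uniformly_continuous_on_left_limit[OF t(1) _ lim])
        then have "bounded ((\<lambda>s. X s \<omega>) ` {r..<t})"
          by (rule bounded_uniformly_continuous_image) simp
        then obtain b where b: "\<forall>s\<in>{r..<t}. \<bar>X s \<omega>\<bar> \<le> b" by (auto simp: bounded_iff)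
        obtain k where "b < real k" using reals_Archimedean2 by blast
        then have "\<forall>v\<in>{r..<t}. X v \<omega> < \<epsilon> + real k" using b \<epsilon>(1) by fastforce
        then have "absorbed_below (\<epsilon> + real k) \<omega>"
          using \<omega> t lim by (auto simp: absorbed_below_def)
        then show False using elim(1) by blast
      qed
      then show "has_nonzero_left_limit (\<lambda>s. X s \<omega>) t"
        using elim(2) \<omega> t by metis
    qed
  qed
qed

end

section \<open>Increments of correlated Brownian motions\<close>

context filtered_prob_space
begin

lemma brownian_adapted:
  "brownian_motion M F W \<Longrightarrow> 0 \<le> t \<Longrightarrow> W t \<in> borel_measurable (F (ennreal t))"
  by (simp add: brownian_motion_def)

text \<open>
  Independence of an increment from the past, stated for set systems in the definition, passes to
  the generated \<open>\<sigma>\<close>-algebras since both systems are stable under intersections.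
\<close>

lemma brownian_increment_indep:
  assumes W: "brownian_motion M F W" and st: "0 \<le> s" "s < t"
    and Y: "Y \<in> borel_measurable (F (ennreal s))"
  shows "indep_var borel Y borel (\<lambda>\<omega>. W t \<omega> - W s \<omega>)"
proof -
  let ?D = "\<lambda>\<omega>. W t \<omega> - W s \<omega>"
  let ?E = "{?D -` A \<inter> space M | A. A \<in> sets borel}"
  have [measurable]: "W t \<in> borel_measurable M" "W s \<in> borel_measurable M" "Y \<in> borel_measurable M"
    using W st Y by (auto intro!: measurable_F_M brownian_adapted)
  have I: "indep_set (sets (F (ennreal s))) ?E"
    using W st by (simp add: brownian_motion_def)
  have "Int_stable (sets (F (ennreal s)))" by (rule sets.Int_stable)
  moreover have "Int_stable ?E"
  proof (rule Int_stableI)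
    fix a b assume "a \<in> ?E" "b \<in> ?E"
    then obtain A B where "A \<in> sets borel" "B \<in> sets borel" "a = ?D -` A \<inter> space M" "b = ?D -` B \<inter> space M"
      by blast
    then have "a \<inter> b = ?D -` (A \<inter> B) \<inter> space M" "A \<inter> B \<in> sets borel" by auto
    then show "a \<inter> b \<in> ?E" by blast
  qed
  ultimately have I2: "indep_set (sigma_sets (space M) (sets (F (ennreal s)))) (sigma_sets (space M) ?E)"
    using indep_set_sigma_sets[OF I] by blast
  have "sigma_sets (space M) {Y -` A \<inter> space M | A. A \<in> sets borel} \<subseteq> sigma_sets (space M) (sets (F (ennreal s)))"
    by (rule sigma_sets_mono') (use measurable_sets[OF Y] in \<open>auto simp: space_F\<close>)
  then have "indep_set (sigma_sets (space M) {Y -` A \<inter> space M | A. A \<in> sets borel}) (sigma_sets (space M) ?E)"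
    using I2 unfolding indep_set_def
    by (elim indep_sets_mono_sets) (auto split: bool.split)
  then show ?thesis unfolding indep_var_eq by simp
qed

lemma brownian_increment_moments:
  assumes W: "brownian_motion M F W" and st: "0 \<le> s" "s \<le> t"
  shows "integrable M (\<lambda>\<omega>. (W t \<omega> - W s \<omega>) ^ k)"
    and "expectation (\<lambda>\<omega>. W t \<omega> - W s \<omega>) = 0"
    and "expectation (\<lambda>\<omega>. (W t \<omega> - W s \<omega>)\<^sup>2) = t - s"
    and "expectation (\<lambda>\<omega>. (W t \<omega> - W s \<omega>) ^ 4) = 3 * (t - s)\<^sup>2"
proof -
  have *: "integrable M (\<lambda>\<omega>. (W t \<omega> - W s \<omega>) ^ k) \<and> expectation (\<lambda>\<omega>. W t \<omega> - W s \<omega>) = 0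
    \<and> expectation (\<lambda>\<omega>. (W t \<omega> - W s \<omega>)\<^sup>2) = t - s \<and> expectation (\<lambda>\<omega>. (W t \<omega> - W s \<omega>) ^ 4) = 3 * (t - s)\<^sup>2"
  proof (cases "s = t")
    case True
    then show ?thesis by (auto simp: power_0_left)
  next
    case False
    define \<sigma> where "\<sigma> = sqrt (t - s)"
    have \<sigma>: "0 < \<sigma>" "\<sigma>\<^sup>2 = t - s" using st False by (auto simp: \<sigma>_def)
    have D: "distributed M lborel (\<lambda>\<omega>. W t \<omega> - W s \<omega>) (normal_density 0 \<sigma>)"
      using W st False by (simp add: brownian_motion_def \<sigma>_def)
    have i: "integrable M (\<lambda>\<omega>. (W t \<omega> - W s \<omega>) ^ k)"
      using distributed_integrable[OF D, of "\<lambda>x. x ^ k"] integrable_normal_moment[OF \<sigma>(1), of 0 k] by simp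
    have e1: "expectation (\<lambda>\<omega>. W t \<omega> - W s \<omega>) = 0"
      by (rule normal_distributed_expectation[OF \<sigma>(1) D])
    have e2: "expectation (\<lambda>\<omega>. (W t \<omega> - W s \<omega>)\<^sup>2) = t - s"
      using normal_distributed_variance[OF \<sigma>(1) D] \<sigma>(2) e1 by simp
    have "expectation (\<lambda>\<omega>. (W t \<omega> - W s \<omega>) ^ 4) = (\<integral>x. normal_density 0 \<sigma> x * x ^ 4 \<partial>lborel)"
      using distributed_integral[OF D, of "\<lambda>x. x ^ 4"] by simp
    also have "\<dots> = fact 4 / ((2 / \<sigma>\<^sup>2)\<^sup>2 * fact 2)"
      using integral_normal_moment_even[OF \<sigma>(1), of 0 2] by simp
    also have "\<dots> = 3 * (t - s)\<^sup>2"
      unfolding \<sigma>(2)[symmetric] using \<sigma>(1) by (simp add: fact_numeral field_simps)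
    finally show ?thesis using i e1 e2 by simp
  qed
  then show "integrable M (\<lambda>\<omega>. (W t \<omega> - W s \<omega>) ^ k)" "expectation (\<lambda>\<omega>. W t \<omega> - W s \<omega>) = 0"
    "expectation (\<lambda>\<omega>. (W t \<omega> - W s \<omega>)\<^sup>2) = t - s" "expectation (\<lambda>\<omega>. (W t \<omega> - W s \<omega>) ^ 4) = 3 * (t - s)\<^sup>2"
    by auto
qed

lemma brownian_increment_mult:
  assumes W: "brownian_motion M F W" and st: "0 \<le> s" "s \<le> t"
    and Y: "Y \<in> borel_measurable (F (ennreal s))" "integrable M Y"
  shows "integrable M (\<lambda>\<omega>. Y \<omega> * (W t \<omega> - W s \<omega>))"
    and "expectation (\<lambda>\<omega>. Y \<omega> * (W t \<omega> - W s \<omega>)) = 0"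
    and "integrable M (\<lambda>\<omega>. Y \<omega> * (W t \<omega> - W s \<omega>)\<^sup>2)"
    and "expectation (\<lambda>\<omega>. Y \<omega> * (W t \<omega> - W s \<omega>)\<^sup>2) = (t - s) * expectation Y"
proof -
  note mom = brownian_increment_moments[OF W st]
  have *: "integrable M (\<lambda>\<omega>. Y \<omega> * (W t \<omega> - W s \<omega>)) \<and> expectation (\<lambda>\<omega>. Y \<omega> * (W t \<omega> - W s \<omega>)) = 0
    \<and> integrable M (\<lambda>\<omega>. Y \<omega> * (W t \<omega> - W s \<omega>)\<^sup>2)
    \<and> expectation (\<lambda>\<omega>. Y \<omega> * (W t \<omega> - W s \<omega>)\<^sup>2) = (t - s) * expectation Y"
  proof (cases "s = t")
    case False
    then have I: "indep_var borel Y borel (\<lambda>\<omega>. W t \<omega> - W s \<omega>)"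
      using st by (intro brownian_increment_indep[OF W _ _ Y(1)]) auto
    have I2: "indep_var borel Y borel (\<lambda>\<omega>. (W t \<omega> - W s \<omega>)\<^sup>2)"
      using indep_var_compose[OF I, of "\<lambda>x. x" borel "\<lambda>x. x\<^sup>2" borel] by (simp add: comp_def)
    show ?thesis
      using indep_var_lebesgue_integral[OF I Y(2)] indep_var_integrable[OF I Y(2)] mom(1)[of 1] mom(2)
        indep_var_lebesgue_integral[OF I2 Y(2) mom(1)] indep_var_integrable[OF I2 Y(2) mom(1)] mom(3)
      by simp
  qed simp
  then show "integrable M (\<lambda>\<omega>. Y \<omega> * (W t \<omega> - W s \<omega>))"
    "expectation (\<lambda>\<omega>. Y \<omega> * (W t \<omega> - W s \<omega>)) = 0"
    "integrable M (\<lambda>\<omega>. Y \<omega> * (W t \<omega> - W s \<omega>)\<^sup>2)"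
    "expectation (\<lambda>\<omega>. Y \<omega> * (W t \<omega> - W s \<omega>)\<^sup>2) = (t - s) * expectation Y"
    by auto
qed

lemma integrable_mult_squares:
  fixes f g :: "'a \<Rightarrow> real"
  assumes [measurable]: "f \<in> borel_measurable M" "g \<in> borel_measurable M"
    and i: "integrable M (\<lambda>\<omega>. (f \<omega>)\<^sup>2)" "integrable M (\<lambda>\<omega>. (g \<omega>)\<^sup>2)"
  shows "integrable M (\<lambda>\<omega>. f \<omega> * g \<omega>)"
proof (rule Bochner_Integration.integrable_bound[where f = "\<lambda>\<omega>. (f \<omega>)\<^sup>2 + (g \<omega>)\<^sup>2"])
  have "\<bar>x * y\<bar> \<le> x\<^sup>2 + y\<^sup>2" for x y :: real
  proof -
    have "2 * \<bar>x * y\<bar> \<le> x\<^sup>2 + y\<^sup>2" using sum_squares_bound[of "\<bar>x\<bar>" "\<bar>y\<bar>"] by (simp add: abs_mult mult.assoc)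
    then show ?thesis using abs_ge_zero[of "x * y"] by linarith
  qed
  then show "AE \<omega> in M. norm (f \<omega> * g \<omega>) \<le> norm ((f \<omega>)\<^sup>2 + (g \<omega>)\<^sup>2)" by simp
qed (use i in auto)

lemma brownian_square_integrable:
  assumes W: "brownian_motion M F W" and t: "0 \<le> t"
  shows "integrable M (\<lambda>\<omega>. (W t \<omega>)\<^sup>2)" "integrable M (W t)"
proof -
  have W0: "AE \<omega> in M. W 0 \<omega> = 0" using W by (simp add: brownian_motion_def)
  have m[measurable]: "W t \<in> borel_measurable M" "W 0 \<in> borel_measurable M"
    using W t by (auto intro!: measurable_F_M brownian_adapted)
  have "integrable M (\<lambda>\<omega>. (W t \<omega> - W 0 \<omega>) ^ k)" for k
    using brownian_increment_moments(1)[OF W _ t] by simp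
  moreover have "AE \<omega> in M. (W t \<omega> - W 0 \<omega>) ^ k = W t \<omega> ^ k" for k
    using W0 by eventually_elim simp
  ultimately have *: "integrable M (\<lambda>\<omega>. W t \<omega> ^ k)" for k
    using integrable_cong_AE[of "\<lambda>\<omega>. (W t \<omega> - W 0 \<omega>) ^ k" M "\<lambda>\<omega>. W t \<omega> ^ k"] by simp
  show "integrable M (\<lambda>\<omega>. (W t \<omega>)\<^sup>2)" by (rule *)
  show "integrable M (W t)" using *[of 1] by simp
qed

lemma martingale_increment:
  assumes V: "martingale M F V" and st: "0 \<le> s" "s \<le> t"
    and Y: "Y \<in> borel_measurable (F (ennreal s))" "\<And>\<omega>. \<bar>Y \<omega>\<bar> \<le> b"
  shows "expectation (\<lambda>\<omega>. Y \<omega> * V t \<omega>) = expectation (\<lambda>\<omega>. Y \<omega> * V s \<omega>)"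
proof -
  have iV: "integrable M (V t)" "integrable M (V s)" using V st by (auto simp: martingale_def)
  note [measurable] = borel_measurable_integrable[OF iV(1)] borel_measurable_integrable[OF iV(2)] measurable_F_M[OF Y(1)]
  have AEq: "AE \<omega> in M. real_cond_exp M (F (ennreal s)) (V t) \<omega> = V s \<omega>"
    using V st by (auto simp: martingale_def)
  interpret sigma_finite_subalgebra M "F (ennreal s)"
    by (rule finite_measure_subalgebra_is_sigma_finite) (unfold_locales, rule subalgebra_F)
  have iY: "integrable M (\<lambda>\<omega>. Y \<omega> * V t \<omega>)"
    using Y(2) iV(1) by (intro integrable_bounded_mult) simp_all
  have "expectation (\<lambda>\<omega>. Y \<omega> * V t \<omega>) = expectation (\<lambda>\<omega>. Y \<omega> * real_cond_exp M (F (ennreal s)) (V t) \<omega>)"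
    by (rule real_cond_exp_intg(2)[OF iY Y(1), symmetric]) simp
  also have "\<dots> = expectation (\<lambda>\<omega>. Y \<omega> * V s \<omega>)"
    by (rule integral_cong_AE) (use AEq in auto)
  finally show ?thesis .
qed

lemma covariation_integrable:
  assumes W: "brownian_motion M F W" "brownian_motion M F W'" and A: "covariation M F W W' A" and t: "0 \<le> t"
  shows "integrable M (A t)"
proof -
  have "integrable M (\<lambda>\<omega>. W t \<omega> * W' t \<omega>)"
    using W t by (intro integrable_mult_squares brownian_square_integrable measurable_F_M[OF brownian_adapted])
  moreover have "integrable M (\<lambda>\<omega>. W t \<omega> * W' t \<omega> - A t \<omega>)"
    using A t by (simp add: covariation_def martingale_def)
  ultimately have "integrable M (\<lambda>\<omega>. W t \<omega> * W' t \<omega> - (W t \<omega> * W' t \<omega> - A t \<omega>))"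
    by (rule Bochner_Integration.integrable_diff)
  then show ?thesis by simp
qed

text \<open>
  The product of the increments differs from the increment of the product by terms that are an
  increment times a factor known at time \<open>s\<close>, and these have mean zero.
\<close>

lemma covariation_increment:
  assumes W: "brownian_motion M F W" "brownian_motion M F W'" and A: "covariation M F W W' A"
    and st: "0 \<le> s" "s \<le> t" and Y: "Y \<in> borel_measurable (F (ennreal s))" "\<And>\<omega>. \<bar>Y \<omega>\<bar> \<le> b"
  shows "integrable M (\<lambda>\<omega>. Y \<omega> * ((W t \<omega> - W s \<omega>) * (W' t \<omega> - W' s \<omega>)))"
    and "expectation (\<lambda>\<omega>. Y \<omega> * ((W t \<omega> - W s \<omega>) * (W' t \<omega> - W' s \<omega>)))
      = expectation (\<lambda>\<omega>. Y \<omega> * (A t \<omega> - A s \<omega>))"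
proof -
  have t: "0 \<le> t" using st by simp
  define V where "V = (\<lambda>t \<omega>. W t \<omega> * W' t \<omega> - A t \<omega>)"
  have V: "martingale M F V" using A by (simp add: covariation_def V_def)
  note YM[measurable] = measurable_F_M[OF Y(1)]
  have [measurable]: "W s \<in> borel_measurable (F (ennreal s))" "W' s \<in> borel_measurable (F (ennreal s))"
    using W st by (auto intro: brownian_adapted)
  note Y(1)[measurable]
  note bdd = integrable_bounded_mult[OF YM Y(2)]
  have iV: "integrable M (\<lambda>\<omega>. Y \<omega> * V t \<omega>)" "integrable M (\<lambda>\<omega>. Y \<omega> * V s \<omega>)"
    using V st t by (auto simp: martingale_def intro!: bdd)
  have iA: "integrable M (\<lambda>\<omega>. Y \<omega> * A t \<omega>)" "integrable M (\<lambda>\<omega>. Y \<omega> * A s \<omega>)"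
    using covariation_integrable[OF W A] st t by (auto intro!: bdd)
  have iY: "integrable M (\<lambda>\<omega>. Y \<omega> * W s \<omega>)" "integrable M (\<lambda>\<omega>. Y \<omega> * W' s \<omega>)"
    using W st by (auto intro!: bdd brownian_square_integrable)
  have mY: "(\<lambda>\<omega>. Y \<omega> * W s \<omega>) \<in> borel_measurable (F (ennreal s))" "(\<lambda>\<omega>. Y \<omega> * W' s \<omega>) \<in> borel_measurable (F (ennreal s))"
    by measurable
  note c1 = brownian_increment_mult[OF W(2) st mY(1) iY(1)]
  note c2 = brownian_increment_mult[OF W(1) st mY(2) iY(2)]
  have eq: "Y \<omega> * ((W t \<omega> - W s \<omega>) * (W' t \<omega> - W' s \<omega>)) =
     (Y \<omega> * V t \<omega> - Y \<omega> * V s \<omega>) + (Y \<omega> * A t \<omega> - Y \<omega> * A s \<omega>)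
     - (Y \<omega> * W s \<omega>) * (W' t \<omega> - W' s \<omega>) - (Y \<omega> * W' s \<omega>) * (W t \<omega> - W s \<omega>)" for \<omega>
    by (simp add: V_def algebra_simps)
  show "integrable M (\<lambda>\<omega>. Y \<omega> * ((W t \<omega> - W s \<omega>) * (W' t \<omega> - W' s \<omega>)))"
    unfolding eq by (intro Bochner_Integration.integrable_add Bochner_Integration.integrable_diff iV iA c1(1) c2(1))
  have "expectation (\<lambda>\<omega>. Y \<omega> * ((W t \<omega> - W s \<omega>) * (W' t \<omega> - W' s \<omega>)))
    = (expectation (\<lambda>\<omega>. Y \<omega> * V t \<omega>) - expectation (\<lambda>\<omega>. Y \<omega> * V s \<omega>))
     + (expectation (\<lambda>\<omega>. Y \<omega> * A t \<omega>) - expectation (\<lambda>\<omega>. Y \<omega> * A s \<omega>))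
     - expectation (\<lambda>\<omega>. (Y \<omega> * W s \<omega>) * (W' t \<omega> - W' s \<omega>)) - expectation (\<lambda>\<omega>. (Y \<omega> * W' s \<omega>) * (W t \<omega> - W s \<omega>))"
    unfolding eq
    by (simp only: Bochner_Integration.integral_add Bochner_Integration.integral_diff
        Bochner_Integration.integrable_add Bochner_Integration.integrable_diff iV iA c1(1) c2(1))
  also have "\<dots> = expectation (\<lambda>\<omega>. Y \<omega> * (A t \<omega> - A s \<omega>))"
    using martingale_increment[OF V st Y] iA unfolding c1(2) c2(2) by (simp add: right_diff_distrib)
  finally show "expectation (\<lambda>\<omega>. Y \<omega> * ((W t \<omega> - W s \<omega>) * (W' t \<omega> - W' s \<omega>)))
      = expectation (\<lambda>\<omega>. Y \<omega> * (A t \<omega> - A s \<omega>))" .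
qed

lemma brownian_sum_fourth_moment:
  assumes bm: "\<And>j. j \<in> J \<Longrightarrow> brownian_motion M F (B j)" and st: "0 \<le> s" "s \<le> t"
  shows "integrable M (\<lambda>\<omega>. ((\<Sum>j\<in>J. B j t \<omega>) - (\<Sum>j\<in>J. B j s \<omega>)) ^ 4)"
    and "expectation (\<lambda>\<omega>. ((\<Sum>j\<in>J. B j t \<omega>) - (\<Sum>j\<in>J. B j s \<omega>)) ^ 4) \<le> 3 * real (card J) ^ 4 * (t - s)\<^sup>2"
proof -
  let ?S = "\<lambda>\<omega>. (\<Sum>j\<in>J. B j t \<omega> - B j s \<omega>)"
  let ?Q = "\<lambda>\<omega>. real (card J) ^ 3 * (\<Sum>j\<in>J. (B j t \<omega> - B j s \<omega>) ^ 4)"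
  have [measurable]: "B j t \<in> borel_measurable M" "B j s \<in> borel_measurable M" if "j \<in> J" for j
    using bm[OF that] st by (auto intro!: measurable_F_M[OF brownian_adapted])
  have iQ: "integrable M ?Q"
    using bm st by (intro integrable_mult_right Bochner_Integration.integrable_sum brownian_increment_moments(1))
  have le: "?S \<omega> ^ 4 \<le> ?Q \<omega>" for \<omega> by (rule sum_power4_le)
  have iS: "integrable M (\<lambda>\<omega>. ?S \<omega> ^ 4)"
  proof (rule Bochner_Integration.integrable_bound[OF iQ])
    have "norm (?S \<omega> ^ 4) \<le> norm (?Q \<omega>)" for \<omega>
    proof -
      have "\<bar>?S \<omega> ^ 4\<bar> = ?S \<omega> ^ 4" by (rule abs_of_nonneg) simp
      then show ?thesis using le[of \<omega>] abs_ge_self[of "?Q \<omega>"] unfolding real_norm_def by linarith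
    qed
    then show "AE \<omega> in M. norm (?S \<omega> ^ 4) \<le> norm (?Q \<omega>)" by simp
  qed measurable
  have "expectation (\<lambda>\<omega>. ?S \<omega> ^ 4) \<le> expectation ?Q"
    by (rule integral_mono[OF iS iQ le])
  also have "\<dots> = real (card J) ^ 3 * (\<Sum>j\<in>J. 3 * (t - s)\<^sup>2)"
    using bm st brownian_increment_moments(1)[OF bm st] brownian_increment_moments(4)[OF bm st]
    by (simp add: Bochner_Integration.integral_sum)
  also have "\<dots> = 3 * real (card J) ^ 4 * (t - s)\<^sup>2" by (simp add: eval_nat_numeral)
  finally show "expectation (\<lambda>\<omega>. ((\<Sum>j\<in>J. B j t \<omega>) - (\<Sum>j\<in>J. B j s \<omega>)) ^ 4) \<le> 3 * real (card J) ^ 4 * (t - s)\<^sup>2"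
    by (simp add: sum_subtractf)
  show "integrable M (\<lambda>\<omega>. ((\<Sum>j\<in>J. B j t \<omega>) - (\<Sum>j\<in>J. B j s \<omega>)) ^ 4)"
    using iS by (simp add: sum_subtractf)
qed

lemma integrable_of_bounded:
  fixes Y :: "'a \<Rightarrow> real"
  assumes "Y \<in> borel_measurable (F s)" "\<And>\<omega>. \<bar>Y \<omega>\<bar> \<le> b" shows "integrable M Y"
  by (rule integrable_const_bound[where B=b]) (use assms measurable_F_M[OF assms(1)] in auto)

lemma brownian_sum_martingale:
  assumes bm: "\<And>j. j \<in> J \<Longrightarrow> brownian_motion M F (B j)" and st: "0 \<le> s" "s \<le> t"
    and Y: "Y \<in> borel_measurable (F (ennreal s))" "\<And>\<omega>. \<bar>Y \<omega>\<bar> \<le> b"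
  shows "expectation (\<lambda>\<omega>. Y \<omega> * ((\<Sum>j\<in>J. B j t \<omega>) - (\<Sum>j\<in>J. B j s \<omega>))) = 0"
proof -
  note iY = integrable_of_bounded[OF Y]
  have "expectation (\<lambda>\<omega>. Y \<omega> * ((\<Sum>j\<in>J. B j t \<omega>) - (\<Sum>j\<in>J. B j s \<omega>)))
    = expectation (\<lambda>\<omega>. \<Sum>j\<in>J. Y \<omega> * (B j t \<omega> - B j s \<omega>))"
    by (simp add: sum_subtractf[symmetric] sum_distrib_left)
  also have "\<dots> = (\<Sum>j\<in>J. expectation (\<lambda>\<omega>. Y \<omega> * (B j t \<omega> - B j s \<omega>)))"
    using brownian_increment_mult(1)[OF bm st Y(1) iY] by (intro Bochner_Integration.integral_sum)
  also have "\<dots> = 0"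
    using brownian_increment_mult(2)[OF bm st Y(1) iY] by (intro sum.neutral) auto
  finally show ?thesis .
qed

text \<open>
  This identifies the bracket of \<open>\<Sum> B j\<close>: the squares contribute \<open>t\<close> each, and the mixed
  products their covariations.
\<close>

lemma brownian_sum_bracket:
  assumes J: "finite J" and bm: "\<And>j. j \<in> J \<Longrightarrow> brownian_motion M F (B j)"
    and cov: "\<And>j k. j \<in> J \<Longrightarrow> k \<in> J \<Longrightarrow> j \<noteq> k \<Longrightarrow> covariation M F (B j) (B k) (A j k)"
    and st: "0 \<le> s" "s \<le> t"
    and Y: "Y \<in> borel_measurable (F (ennreal s))" "\<And>\<omega>. \<bar>Y \<omega>\<bar> \<le> b"
  shows "expectation (\<lambda>\<omega>. Y \<omega> * ((\<Sum>j\<in>J. B j t \<omega>) - (\<Sum>j\<in>J. B j s \<omega>))\<^sup>2)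
    = expectation (\<lambda>\<omega>. Y \<omega> * ((real (card J) * t + (\<Sum>j\<in>J. \<Sum>k\<in>J - {j}. A j k t \<omega>))
        - (real (card J) * s + (\<Sum>j\<in>J. \<Sum>k\<in>J - {j}. A j k s \<omega>))))"
proof -
  note iY = integrable_of_bounded[OF Y]
  note YM = measurable_F_M[OF Y(1)]
  define D where "D j \<omega> = B j t \<omega> - B j s \<omega>" for j \<omega>
  define E where "E j k \<omega> = A j k t \<omega> - A j k s \<omega>" for j k \<omega>
  have t: "0 \<le> t" using st by simp
  have sq: "(\<Sum>j\<in>J. D j \<omega>)\<^sup>2 = (\<Sum>j\<in>J. (D j \<omega>)\<^sup>2 + (\<Sum>k\<in>J - {j}. D j \<omega> * D k \<omega>))" for \<omega>
    unfolding power2_eq_square sum_product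
    by (intro sum.cong refl) (simp add: sum.remove[OF J])
  have iD: "integrable M (\<lambda>\<omega>. Y \<omega> * (D j \<omega>)\<^sup>2)" "expectation (\<lambda>\<omega>. Y \<omega> * (D j \<omega>)\<^sup>2) = (t - s) * expectation Y" if "j \<in> J" for j
    unfolding D_def using brownian_increment_mult(3,4)[OF bm[OF that] st Y(1) iY] by auto
  have iDD: "integrable M (\<lambda>\<omega>. Y \<omega> * (D j \<omega> * D k \<omega>))"
    "expectation (\<lambda>\<omega>. Y \<omega> * (D j \<omega> * D k \<omega>)) = expectation (\<lambda>\<omega>. Y \<omega> * E j k \<omega>)"
    if "j \<in> J" "k \<in> J - {j}" for j k
    unfolding D_def E_def using covariation_increment[OF bm bm cov st Y, of j k] that by auto
  have iE: "integrable M (\<lambda>\<omega>. Y \<omega> * E j k \<omega>)" if "j \<in> J" "k \<in> J - {j}" for j k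
    unfolding E_def using that st t
    by (intro integrable_bounded_mult[OF YM Y(2)] Bochner_Integration.integrable_diff covariation_integrable[OF bm bm cov]) auto
  have "expectation (\<lambda>\<omega>. Y \<omega> * ((\<Sum>j\<in>J. B j t \<omega>) - (\<Sum>j\<in>J. B j s \<omega>))\<^sup>2)
    = expectation (\<lambda>\<omega>. \<Sum>j\<in>J. Y \<omega> * (D j \<omega>)\<^sup>2 + (\<Sum>k\<in>J - {j}. Y \<omega> * (D j \<omega> * D k \<omega>)))"
    by (simp add: sum_subtractf[symmetric] D_def[symmetric] sq sum_distrib_left distrib_left)
  also have "\<dots> = (\<Sum>j\<in>J. expectation (\<lambda>\<omega>. Y \<omega> * (D j \<omega>)\<^sup>2 + (\<Sum>k\<in>J - {j}. Y \<omega> * (D j \<omega> * D k \<omega>))))"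
    by (intro Bochner_Integration.integral_sum Bochner_Integration.integrable_add Bochner_Integration.integrable_sum iD iDD)
  also have "\<dots> = (\<Sum>j\<in>J. expectation (\<lambda>\<omega>. (t - s) * Y \<omega> + (\<Sum>k\<in>J - {j}. Y \<omega> * E j k \<omega>)))"
  proof (intro sum.cong refl)
    fix j assume j: "j \<in> J"
    have "expectation (\<lambda>\<omega>. Y \<omega> * (D j \<omega>)\<^sup>2 + (\<Sum>k\<in>J - {j}. Y \<omega> * (D j \<omega> * D k \<omega>)))
      = expectation (\<lambda>\<omega>. Y \<omega> * (D j \<omega>)\<^sup>2) + (\<Sum>k\<in>J - {j}. expectation (\<lambda>\<omega>. Y \<omega> * (D j \<omega> * D k \<omega>)))"
      using iD(1)[OF j] iDD(1)[OF j]
      by (subst Bochner_Integration.integral_add) (auto intro!: Bochner_Integration.integrable_sum Bochner_Integration.integral_sum)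
    also have "\<dots> = (t - s) * expectation Y + (\<Sum>k\<in>J - {j}. expectation (\<lambda>\<omega>. Y \<omega> * E j k \<omega>))"
      using iD(2)[OF j] iDD(2)[OF j] by simp
    also have "\<dots> = expectation (\<lambda>\<omega>. (t - s) * Y \<omega> + (\<Sum>k\<in>J - {j}. Y \<omega> * E j k \<omega>))"
      using iY iE[OF j]
      by (subst Bochner_Integration.integral_add) (auto intro!: Bochner_Integration.integrable_sum Bochner_Integration.integral_sum[symmetric])
    finally show "expectation (\<lambda>\<omega>. Y \<omega> * (D j \<omega>)\<^sup>2 + (\<Sum>k\<in>J - {j}. Y \<omega> * (D j \<omega> * D k \<omega>)))
      = expectation (\<lambda>\<omega>. (t - s) * Y \<omega> + (\<Sum>k\<in>J - {j}. Y \<omega> * E j k \<omega>))" .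
  qed
  also have "\<dots> = expectation (\<lambda>\<omega>. \<Sum>j\<in>J. (t - s) * Y \<omega> + (\<Sum>k\<in>J - {j}. Y \<omega> * E j k \<omega>))"
    by (intro Bochner_Integration.integral_sum[symmetric] Bochner_Integration.integrable_add Bochner_Integration.integrable_sum
        integrable_mult_right iY iE)
  also have "(\<lambda>\<omega>. \<Sum>j\<in>J. (t - s) * Y \<omega> + (\<Sum>k\<in>J - {j}. Y \<omega> * E j k \<omega>)) =
    (\<lambda>\<omega>. Y \<omega> * ((real (card J) * t + (\<Sum>j\<in>J. \<Sum>k\<in>J - {j}. A j k t \<omega>))
        - (real (card J) * s + (\<Sum>j\<in>J. \<Sum>k\<in>J - {j}. A j k s \<omega>))))"
    by (simp add: E_def sum.distrib sum_subtractf sum_distrib_left[symmetric] algebra_simps)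
  finally show ?thesis .
qed

end

section \<open>Paths between the two stopping times\<close>

lemma LBINT_increment:
  fixes g :: "real \<Rightarrow> real"
  assumes g: "set_integrable lborel {a..t} g" and st: "a \<le> s" "s \<le> t"
  shows "(LBINT x:{a..t}. g x) - (LBINT x:{a..s}. g x) = (LBINT x:{s..t}. g x)"
proof -
  have i: "set_integrable lborel {a..s} g" "set_integrable lborel {s..t} g"
    using g st by (auto intro: set_integrable_subset)
  have "integral {a..s} g + integral {s..t} g = integral {a..t} g"
    using st set_borel_integral_eq_integral(1)[OF g] by (intro Henstock_Kurzweil_Integration.integral_combine) auto
  then show ?thesis using set_borel_integral_eq_integral(2)[OF g] set_borel_integral_eq_integral(2)[OF i(1)]
    set_borel_integral_eq_integral(2)[OF i(2)] by simp
qed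

text \<open>
  Each point of \<open>I\<close> either has a larger one in \<open>I\<close> or is the maximum of \<open>I\<close>; this treats
  half-open and closed intervals alike.
\<close>

lemma continuous_on_initial_segments:
  fixes f :: "real \<Rightarrow> real"
  assumes f: "\<And>t. t \<in> I \<Longrightarrow> continuous_on {a..t} f" and a: "\<And>t. t \<in> I \<Longrightarrow> a \<le> t"
  shows "continuous_on I f"
  unfolding continuous_on_eq_continuous_within
proof
  fix x assume x: "x \<in> I"
  show "continuous (at x within I) f"
  proof (cases "\<exists>t\<in>I. x < t")
    case True
    then obtain t where t: "t \<in> I" "x < t" by blast
    have "continuous (at x within {a..t}) f"
      using f[OF t(1)] a[OF x] t(2) by (auto simp: continuous_on_eq_continuous_within)
    then have "continuous (at x within I \<inter> {..<t}) f"
      by (rule continuous_within_subset) (use a in auto)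
    moreover have "at x within I = at x within I \<inter> {..<t}"
      by (rule at_within_nhd[where S="{..<t}"]) (use t in auto)
    ultimately show ?thesis by simp
  next
    case False
    then have "I \<subseteq> {a..x}" using a by (auto simp: not_less)
    moreover have "continuous (at x within {a..x}) f"
      using f[OF x] a[OF x] by (auto simp: continuous_on_eq_continuous_within)
    ultimately show ?thesis by (blast intro: continuous_within_subset)
  qed
qed

lemma LBINT_abs_le_length:
  fixes g :: "real \<Rightarrow> real"
  assumes m: "set_borel_measurable lborel {s..t} g" and st: "s \<le> t"
    and b: "AE x in lborel. x \<in> {s..t} \<longrightarrow> \<bar>g x\<bar> \<le> b"
  shows "set_integrable lborel {s..t} g" "\<bar>LBINT x:{s..t}. g x\<bar> \<le> b * (t - s)"
proof -
  have ib: "set_integrable lborel {s..t} (\<lambda>x. b)"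
    by (rule borel_integrable_atLeastAtMost') simp
  have "AE x in lborel. x \<in> {s..t} \<longrightarrow> norm (g x) \<le> norm b" using b by eventually_elim auto
  from set_integrable_bound[OF ib m this] show ig: "set_integrable lborel {s..t} g" .
  have c: "(LBINT x:{s..t}. b) = b * (t - s)" "(LBINT x:{s..t}. - b) = - b * (t - s)"
    using st by (subst set_integral_const; simp)+
  have "(LBINT x:{s..t}. g x) \<le> (LBINT x:{s..t}. b)"
    by (rule set_integral_mono_AE[OF ig ib]) (use b in \<open>eventually_elim, auto\<close>)
  moreover have "(LBINT x:{s..t}. - b) \<le> (LBINT x:{s..t}. g x)"
    by (rule set_integral_mono_AE[OF borel_integrable_atLeastAtMost' ig])
      (use b in \<open>auto elim!: eventually_mono\<close>)
  ultimately show "\<bar>LBINT x:{s..t}. g x\<bar> \<le> b * (t - s)" unfolding c by linarith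
qed

text \<open>
  Finiteness of \<open>\<integral> \<Sum> 1 / x j\<close> with \<open>1 / 0 = \<infinity>\<close> has two effects: the \<open>x j\<close> are positive almost
  everywhere, and the real-valued integrand, where \<open>1 / 0 = 0\<close>, is integrable. The lower bound
  is the inequality between arithmetic and harmonic mean under the integral.
\<close>

lemma reciprocal_drift:
  fixes x m :: "'j \<Rightarrow> real \<Rightarrow> real"
  assumes J: "finite J" "J \<noteq> {}"
    and meas: "\<And>j. j \<in> J \<Longrightarrow> set_borel_measurable lborel {s..t} (x j)"
      "\<And>j. j \<in> J \<Longrightarrow> set_borel_measurable lborel {s..t} (m j)"
    and x0: "\<And>j r. j \<in> J \<Longrightarrow> r \<in> {s..t} \<Longrightarrow> 0 \<le> x j r"
    and mC: "\<And>j r. j \<in> J \<Longrightarrow> r \<in> {s..t} \<Longrightarrow> \<bar>m j r\<bar> \<le> C"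
    and fin: "(\<integral>\<^sup>+ r \<in> {s..t}. (\<Sum>j\<in>J. 1 / ennreal (x j r)) \<partial>lborel) < \<infinity>"
  shows "AE r in lborel. r \<in> {s..t} \<longrightarrow> (\<forall>j\<in>J. 0 < x j r)"
    and "set_integrable lborel {s..t} (\<lambda>r. \<Sum>j\<in>J. m j r / x j r)"
    and "\<And>b \<kappa>. s \<le> t \<Longrightarrow> 0 < b \<Longrightarrow> 0 \<le> \<kappa> \<Longrightarrow> (\<And>r. r \<in> {s..t} \<Longrightarrow> (\<Sum>j\<in>J. x j r) \<le> b) \<Longrightarrow>
      (AE r in lborel. r \<in> {s..t} \<longrightarrow> (\<forall>j\<in>J. \<kappa> \<le> m j r)) \<Longrightarrow>
      \<kappa> * (real (card J))\<^sup>2 / b * (t - s) \<le> (LBINT r:{s..t}. \<Sum>j\<in>J. m j r / x j r)"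
proof -
  let ?I = "\<lambda>r. indicator {s..t} r :: real"
  have [measurable]: "(\<lambda>r. ?I r * x j r) \<in> borel_measurable borel" "(\<lambda>r. ?I r * m j r) \<in> borel_measurable borel" if "j \<in> J" for j
    using meas[OF that] by (auto simp: set_borel_measurable_def)
  define h where "h = (\<lambda>r. (\<Sum>j\<in>J. 1 / ennreal (?I r * x j r)) * indicator {s..t} r)"
  have h_eq: "h = (\<lambda>r. (\<Sum>j\<in>J. 1 / ennreal (x j r)) * indicator {s..t} r)"
    by (auto simp: h_def indicator_def fun_eq_iff)
  have h_meas[measurable]: "h \<in> borel_measurable borel" unfolding h_def by measurable
  have h_fin: "(\<integral>\<^sup>+ r. h r \<partial>lborel) < \<infinity>" using fin by (simp add: h_eq)
  show pos: "AE r in lborel. r \<in> {s..t} \<longrightarrow> (\<forall>j\<in>J. 0 < x j r)"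
  proof -
    have "AE r in lborel. h r \<noteq> \<infinity>" using h_fin by (intro nn_integral_PInf_AE) auto
    then show ?thesis
    proof eventually_elim
      case (elim r)
      show ?case
      proof (intro impI ballI)
        fix j assume r: "r \<in> {s..t}" and j: "j \<in> J"
        have "1 / ennreal (x j r) \<le> (\<Sum>j\<in>J. 1 / ennreal (x j r))" using J j by (intro member_le_sum) auto
        also have "\<dots> = h r" using r by (simp add: h_eq)
        finally have "1 / ennreal (x j r) \<noteq> \<infinity>" using elim by (auto simp: top_unique)
        then have "x j r \<noteq> 0" by (auto simp: divide_ennreal_def)
        then show "0 < x j r" using x0[OF j r] by simp
      qed
    qed
  qed
  let ?D = "\<lambda>r. \<Sum>j\<in>J. m j r / x j r"
  show D: "set_integrable lborel {s..t} ?D"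
    unfolding set_integrable_def
  proof (rule integrableI_bounded)
    have "(\<lambda>r. \<Sum>j\<in>J. (?I r * m j r) / (?I r * x j r)) \<in> borel_measurable borel" by measurable
    also have "(\<lambda>r. \<Sum>j\<in>J. (?I r * m j r) / (?I r * x j r)) = (\<lambda>r. ?I r *\<^sub>R ?D r)"
      by (auto simp: indicator_def fun_eq_iff)
    finally show "(\<lambda>r. ?I r *\<^sub>R ?D r) \<in> borel_measurable lborel" by simp
    have le: "ennreal (norm (?I r *\<^sub>R ?D r)) \<le> ennreal (max C 0) * h r" for r
    proof (cases "r \<in> {s..t}")
      case True
      have "norm (?D r) \<le> (\<Sum>j\<in>J. \<bar>m j r / x j r\<bar>)" unfolding real_norm_def by (rule sum_abs)
      also have "\<dots> \<le> (\<Sum>j\<in>J. max C 0 * (1 / x j r))"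
      proof (rule sum_mono)
        fix j assume j: "j \<in> J"
        have "\<bar>m j r / x j r\<bar> = \<bar>m j r\<bar> * (1 / x j r)" using x0[OF j True] by (simp add: abs_divide)
        also have "\<dots> \<le> max C 0 * (1 / x j r)" using x0[OF j True] mC[OF j True] by (intro mult_right_mono) auto
        finally show "\<bar>m j r / x j r\<bar> \<le> max C 0 * (1 / x j r)" .
      qed
      finally have "ennreal (norm (?D r)) \<le> ennreal (\<Sum>j\<in>J. max C 0 * (1 / x j r))" by (rule ennreal_leI)
      also have "\<dots> = (\<Sum>j\<in>J. ennreal (max C 0) * ennreal (1 / x j r))"
      proof -
        have "ennreal (\<Sum>j\<in>J. max C 0 * (1 / x j r)) = (\<Sum>j\<in>J. ennreal (max C 0 * (1 / x j r)))"
          using x0[OF _ True] by (intro sum_ennreal[symmetric]) auto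
        also have "\<dots> = (\<Sum>j\<in>J. ennreal (max C 0) * ennreal (1 / x j r))"
          using x0[OF _ True] by (intro sum.cong refl ennreal_mult) auto
        finally show ?thesis .
      qed
      also have "\<dots> \<le> (\<Sum>j\<in>J. ennreal (max C 0) * (1 / ennreal (x j r)))"
      proof (intro sum_mono mult_left_mono)
        fix j assume j: "j \<in> J"
        show "ennreal (1 / x j r) \<le> 1 / ennreal (x j r)"
          using x0[OF j True] divide_ennreal[of 1 "x j r"] by (cases "x j r = 0") auto
      qed auto
      finally show ?thesis using True by (simp add: h_eq sum_distrib_left)
    qed simp
    have "(\<integral>\<^sup>+ r. ennreal (norm (?I r *\<^sub>R ?D r)) \<partial>lborel) \<le> (\<integral>\<^sup>+ r. ennreal (max C 0) * h r \<partial>lborel)"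
      by (intro nn_integral_mono le)
    also have "\<dots> = ennreal (max C 0) * (\<integral>\<^sup>+ r. h r \<partial>lborel)" by (rule nn_integral_cmult) simp
    also have "\<dots> < \<infinity>" using h_fin by (simp add: ennreal_mult_less_top)
    finally show "(\<integral>\<^sup>+ r. ennreal (norm (?I r *\<^sub>R ?D r)) \<partial>lborel) < \<infinity>" .
  qed
  fix b \<kappa> :: real
  assume st: "s \<le> t" and b: "0 < b" and \<kappa>: "0 \<le> \<kappa>" and Xb: "\<And>r. r \<in> {s..t} \<Longrightarrow> (\<Sum>j\<in>J. x j r) \<le> b"
    and lower: "AE r in lborel. r \<in> {s..t} \<longrightarrow> (\<forall>j\<in>J. \<kappa> \<le> m j r)"
  let ?c = "\<kappa> * (real (card J))\<^sup>2 / b"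
  have "?c * (t - s) = (LBINT r:{s..t}. ?c)" using st by (subst set_integral_const) auto
  also have "\<dots> \<le> (LBINT r:{s..t}. ?D r)"
  proof (rule set_integral_mono_AE[OF _ D])
    show "set_integrable lborel {s..t} (\<lambda>r. ?c)" by (rule borel_integrable_atLeastAtMost') simp
    show "AE r\<in>{s..t} in lborel. ?c \<le> ?D r"
      using pos lower
    proof eventually_elim
      case (elim r)
      show ?case
      proof
        assume r: "r \<in> {s..t}"
        then have xp: "0 < x j r" and ml: "\<kappa> \<le> m j r" if "j \<in> J" for j using elim that by auto
        have Xp: "0 < (\<Sum>j\<in>J. x j r)" using J xp by (intro sum_pos) auto
        have "?c = \<kappa> * ((real (card J))\<^sup>2 / b)" by simp
        also have "\<dots> \<le> \<kappa> * ((real (card J))\<^sup>2 / (\<Sum>j\<in>J. x j r))"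
          using \<kappa> Xp Xb[OF r] b by (intro mult_left_mono divide_left_mono) auto
        also have "\<dots> \<le> \<kappa> * (\<Sum>j\<in>J. 1 / x j r)"
          using \<kappa> by (intro mult_left_mono sum_inverse_ge J xp)
        also have "\<dots> = (\<Sum>j\<in>J. \<kappa> / x j r)" by (simp add: sum_distrib_left)
        also have "\<dots> \<le> ?D r" using xp ml by (intro sum_mono divide_right_mono) (auto intro: less_imp_le)
        finally show "?c \<le> ?D r" .
      qed
    qed
  qed
  finally show "?c * (t - s) \<le> (LBINT r:{s..t}. ?D r)" .
qed

lemma active_times_segment:
  assumes "t \<in> active_times S T \<omega>"
  shows "{enn2real (S \<omega>)..t} \<subseteq> active_times S T \<omega>" "enn2real (S \<omega>) \<le> t" "S \<omega> = ennreal (enn2real (S \<omega>))"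
    "S \<omega> < T \<omega>"
proof -
  have t: "0 \<le> t" "S \<omega> \<le> ennreal t" "ennreal t < T \<omega>" using assms by (auto simp: active_times_def)
  then have "S \<omega> < top" by (auto simp: less_top[symmetric] top_unique)
  then show S: "S \<omega> = ennreal (enn2real (S \<omega>))" by simp
  show "enn2real (S \<omega>) \<le> t" using t by (metis enn2real_mono enn2real_ennreal ennreal_less_top)
  show "S \<omega> < T \<omega>" using t by simp
  show "{enn2real (S \<omega>)..t} \<subseteq> active_times S T \<omega>"
  proof
    fix v assume v: "v \<in> {enn2real (S \<omega>)..t}"
    then have "0 \<le> v" using order_trans[OF enn2real_nonneg[of "S \<omega>"]] by auto
    moreover have "S \<omega> \<le> ennreal v" using v by (subst S) (auto intro: ennreal_leI)
    moreover have "ennreal v \<le> ennreal t" using v by (auto intro: ennreal_leI)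
    ultimately show "v \<in> active_times S T \<omega>" using t(3) by (auto simp: active_times_def)
  qed
qed

lemma active_times_start:
  assumes "S \<omega> < T \<omega>" shows "enn2real (S \<omega>) \<in> active_times S T \<omega>"
proof -
  have "S \<omega> < top" using assms by (auto simp: less_top[symmetric])
  then show ?thesis using assms by (simp add: active_times_def)
qed

lemma active_times_borel: "active_times S T \<omega> \<in> sets borel"
  unfolding active_times_def by measurable

lemma esssup_active_times:
  assumes "esssup (restrict_space lborel (active_times S T \<omega>)) (\<lambda>s. ereal \<bar>g s\<bar>) \<le> 1"
  shows "AE s in lborel. s \<in> active_times S T \<omega> \<longrightarrow> \<bar>g s\<bar> \<le> 1"
proof -
  have "AE s in restrict_space lborel (active_times S T \<omega>). \<bar>g s\<bar> \<le> 1"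
    using esssup_AE[of "\<lambda>s. ereal \<bar>g s\<bar>" "restrict_space lborel (active_times S T \<omega>)"]
  proof eventually_elim
    case (elim s)
    then have "ereal \<bar>g s\<bar> \<le> 1" using assms by (rule order_trans)
    then show ?case by simp
  qed
  then show ?thesis using active_times_borel[of S T \<omega>] by (simp add: AE_restrict_space_iff)
qed

context filtered_prob_space
begin

lemma progressive_at:
  assumes X: "progressive_on F S T X" and t: "0 \<le> t"
  shows "(\<lambda>\<omega>. if t \<in> active_times S T \<omega> then X t \<omega> else 0) \<in> borel_measurable (F (ennreal t))"
proof -
  have m: "(\<lambda>(t, \<omega>). if t \<in> active_times S T \<omega> then X t \<omega> else 0)
        \<in> borel_measurable (restrict_space borel {0..t} \<Otimes>\<^sub>M F (ennreal t))"
    using X t by (auto simp: progressive_on_def)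
  have "(\<lambda>\<omega>. (t, \<omega>)) \<in> measurable (F (ennreal t)) (restrict_space borel {0..t} \<Otimes>\<^sub>M F (ennreal t))"
    by (rule measurable_Pair1') (use t in \<open>simp add: space_restrict_space\<close>)
  from measurable_compose[OF this m] show ?thesis by simp
qed

lemma progressive_path:
  assumes X: "progressive_on F S T X" and \<omega>: "\<omega> \<in> space M"
    and ab: "{a..b} \<subseteq> active_times S T \<omega>"
  shows "set_borel_measurable lborel {a..b} (\<lambda>t. X t \<omega>)"
proof (cases "a \<le> b")
  case True
  then have a: "0 \<le> a" "0 \<le> b" using ab by (auto simp: active_times_def)
  have m: "(\<lambda>(t, \<omega>). if t \<in> active_times S T \<omega> then X t \<omega> else 0)
        \<in> borel_measurable (restrict_space borel {0..b} \<Otimes>\<^sub>M F (ennreal b))"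
    using X a by (auto simp: progressive_on_def)
  have "(\<lambda>t. (t, \<omega>)) \<in> measurable (restrict_space borel {0..b}) (restrict_space borel {0..b} \<Otimes>\<^sub>M F (ennreal b))"
    by (rule measurable_Pair2') (use \<omega> in \<open>simp add: space_F\<close>)
  from measurable_compose[OF this m]
  have "(\<lambda>t. if t \<in> active_times S T \<omega> then X t \<omega> else 0) \<in> borel_measurable (restrict_space borel {0..b})" by simp
  then have "(\<lambda>t. if t \<in> active_times S T \<omega> then X t \<omega> else 0) \<in> borel_measurable (restrict_space borel {a..b})"
    by (rule measurable_restrict_mono) (use a in auto)
  then have "(\<lambda>t. X t \<omega>) \<in> borel_measurable (restrict_space borel {a..b})"
    by (subst measurable_cong[symmetric, where g="\<lambda>t. X t \<omega>"]) (use ab in \<open>auto simp: space_restrict_space\<close>)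
  then show ?thesis
    by (simp add: set_borel_measurable_def borel_measurable_restrict_space_iff)
qed (simp add: set_borel_measurable_def)

end

text \<open>
  Before \<open>T\<close> the left limit is the value by continuity; at \<open>T\<close> it is the value by definition, with
  \<open>\<infinity>\<close> as a possible limit.
\<close>

lemma left_limit_imp_total_process_pos:
  fixes J :: "'j set" and \<rho> :: "'j \<Rightarrow> real \<Rightarrow> 'a \<Rightarrow> real"
  defines "X \<equiv> \<lambda>t \<omega>. \<Sum>j\<in>J. \<rho> j t \<omega>"
  assumes t: "S \<omega> < ennreal t" "0 \<le> t" "ennreal t \<le> T \<omega>"
    and cont: "continuous_on (active_times S T \<omega>) (\<lambda>t. X t \<omega>)"
    and nonneg: "\<And>s. s \<in> active_times S T \<omega> \<Longrightarrow> 0 \<le> X s \<omega>"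
    and lim: "has_nonzero_left_limit (\<lambda>s. X s \<omega>) t"
  shows "0 < total_process J T \<rho> t \<omega>"
proof -
  define a where "a = enn2real (S \<omega>)"
  have "S \<omega> < top" using t(1) by (auto intro: less_trans)
  then have S: "S \<omega> = ennreal a" by (simp add: a_def)
  have a: "0 \<le> a" "a < t" using t(1) unfolding S by (auto simp: a_def ennreal_less_iff)
  have act: "s \<in> active_times S T \<omega>" if "a \<le> s" "s < t" for s
    using that a(1) t(3) less_le_trans[OF ennreal_lessI t(3), of s] unfolding active_times_def S
    by (auto intro: ennreal_leI)
  have ev: "eventually (\<lambda>s. a \<le> s \<and> s < t) (at_left t)"
    using a by (auto simp: eventually_at_left_field intro!: exI[of _ a])
  then have ev0: "eventually (\<lambda>s. 0 \<le> X s \<omega>) (at_left t)"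
    by eventually_elim (use nonneg act in blast)
  show ?thesis
  proof (cases "ennreal t < T \<omega>")
    case True
    have ta: "t \<in> active_times S T \<omega>" using True t by (auto simp: active_times_def)
    have "continuous_on {a..t} (\<lambda>t. X t \<omega>)"
      using active_times_segment(1)[OF ta] unfolding a_def by (rule continuous_on_subset[OF cont])
    then have "continuous (at t within {a..t}) (\<lambda>t. X t \<omega>)"
      using a by (auto simp: continuous_on_eq_continuous_within)
    then have c: "((\<lambda>s. X s \<omega>) \<longlongrightarrow> X t \<omega>) (at_left t)"
      using a by (simp add: continuous_within at_within_Icc_at_left)
    have "X t \<omega> \<noteq> 0"
    proof -
      have "\<not> filterlim (\<lambda>s. X s \<omega>) at_top (at_left t)"
        using c not_tendsto_and_filterlim_at_infinity[OF _ c] filterlim_at_top_imp_at_infinity by auto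
      then obtain l where l: "l \<noteq> 0" "((\<lambda>s. X s \<omega>) \<longlongrightarrow> l) (at_left t)" using lim by blast
      have "X t \<omega> = l" by (rule tendsto_unique[OF _ c l(2)]) simp
      then show ?thesis using l by simp
    qed
    then have "0 < X t \<omega>" using nonneg[OF ta] by simp
    then show ?thesis using True by (simp add: total_process_def X_def)
  next
    case False
    have "\<exists>m. 0 < m \<and> ((\<lambda>s. ennreal (X s \<omega>)) \<longlongrightarrow> m) (at_left t)"
      using lim
    proof
      assume "\<exists>l. l \<noteq> 0 \<and> ((\<lambda>s. X s \<omega>) \<longlongrightarrow> l) (at_left t)"
      then obtain l where l: "l \<noteq> 0" "((\<lambda>s. X s \<omega>) \<longlongrightarrow> l) (at_left t)" by blast
      have "0 \<le> l" using ev0 by (intro tendsto_lowerbound[OF l(2)]) auto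
      then show ?thesis using l by (intro exI[of _ "ennreal l"]) (auto intro: tendsto_ennrealI)
    next
      assume "filterlim (\<lambda>s. X s \<omega>) at_top (at_left t)"
      then have "((\<lambda>s. ennreal (X s \<omega>)) \<longlongrightarrow> top) (at_left t)"
        by (simp add: ennreal_tendsto_top_eq_at_top)
      then show ?thesis by (intro exI[of _ top]) auto
    qed
    then obtain m where m: "0 < m" "((\<lambda>s. ennreal (X s \<omega>)) \<longlongrightarrow> m) (at_left t)" by blast
    have "Lim (at_left t) (\<lambda>s. ennreal (X s \<omega>)) = m" by (rule tendsto_Lim[OF _ m(2)]) simp
    then show ?thesis using False m(1) by (simp add: total_process_def X_def)
  qed
qed

section \<open>The sum does not vanish\<close>

theorem theorem3p4:
  fixes M :: "'a measure" and F :: "ennreal \<Rightarrow> 'a measure"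
    and S T :: "'a \<Rightarrow> ennreal"
    and J :: "'j set" and \<alpha> :: real
    and \<rho> \<mu> B :: "'j \<Rightarrow> real \<Rightarrow> 'a \<Rightarrow> real"
    and \<sigma> A :: "'j \<Rightarrow> 'j \<Rightarrow> real \<Rightarrow> 'a \<Rightarrow> real"
  assumes fps: "filtered_prob_space M F"
    and S: "stopping_time F S" and T: "stopping_time F T"
    and J: "finite J" "card J \<ge> 2"
    and rho_prog: "\<And>j. j \<in> J \<Longrightarrow> progressive_on F S T (\<rho> j)"
    and rho_nonneg: "\<And>j. j \<in> J \<Longrightarrow> AE \<omega> in M. \<forall>t\<in>active_times S T \<omega>. 0 \<le> \<rho> j t \<omega>"
    and sde: "AE \<omega> in M. S \<omega> < T \<omega> \<longrightarrow> (\<forall>t\<in>active_times S T \<omega>.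
        (\<Sum>j\<in>J. \<rho> j t \<omega>) =
          (\<Sum>j\<in>J. \<rho> j (enn2real (S \<omega>)) \<omega>)
          + (LBINT r:{enn2real (S \<omega>)..t}. (\<Sum>j\<in>J. \<mu> j r \<omega> / \<rho> j r \<omega>))
          + (\<Sum>j\<in>J. B j t \<omega> - B j (enn2real (S \<omega>)) \<omega>))"
    and inv_integrable: "AE \<omega> in M. S \<omega> < T \<omega> \<longrightarrow> (\<forall>t\<in>active_times S T \<omega>.
        (\<integral>\<^sup>+ r \<in> {enn2real (S \<omega>)..t}. (\<Sum>j\<in>J. 1 / ennreal (\<rho> j r \<omega>)) \<partial>lborel) < \<infinity>)"
    and mu_prog: "\<And>j. j \<in> J \<Longrightarrow> progressive_on F S T (\<mu> j)"
    and mu_bounded: "\<exists>C. \<forall>j\<in>J. AE \<omega> in M. \<forall>s\<in>active_times S T \<omega>. \<bar>\<mu> j s \<omega>\<bar> \<le> C"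
    and alpha_nonneg: "\<alpha> \<ge> 0"
    and alpha: "(real (card J))\<^sup>2 * (1 - 2 * \<alpha>)
          / (real (card J) + real (card J) * (real (card J) - 1) / 2) \<ge> 1"
    and alpha_pos: "(1 - 2 * \<alpha>) / 2 > 0"
    and mu_lower: "AE \<omega> in M. S \<omega> < T \<omega> \<longrightarrow> (\<forall>j\<in>J. AE s in lborel.
          s \<in> active_times S T \<omega> \<longrightarrow> \<mu> j s \<omega> \<ge> (1 - 2 * \<alpha>) / 2)"
    and bm: "\<And>j. j \<in> J \<Longrightarrow> brownian_motion M F (B j)"
    and sigma_prog: "\<And>j k. j \<in> J \<Longrightarrow> k \<in> J \<Longrightarrow> j \<noteq> k \<Longrightarrow> progressive_on F S T (\<sigma> j k)"
    and sigma_bound: "\<And>j k. j \<in> J \<Longrightarrow> k \<in> J \<Longrightarrow> j \<noteq> k \<Longrightarrow> AE \<omega> in M. S \<omega> < T \<omega> \<longrightarrow>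
          esssup (restrict_space lborel (active_times S T \<omega>)) (\<lambda>s. ereal \<bar>\<sigma> j k s \<omega>\<bar>) \<le> 1"
    and cov: "\<And>j k. j \<in> J \<Longrightarrow> k \<in> J \<Longrightarrow> j \<noteq> k \<Longrightarrow> covariation M F (B j) (B k) (A j k)"
    and cov_sigma: "\<And>j k. j \<in> J \<Longrightarrow> k \<in> J \<Longrightarrow> j \<noteq> k \<Longrightarrow> AE \<omega> in M. S \<omega> < T \<omega> \<longrightarrow>
          (\<forall>t\<in>active_times S T \<omega>. A j k t \<omega> - A j k (enn2real (S \<omega>)) \<omega>
             = 1 / 2 * (LBINT s:{enn2real (S \<omega>)..t}. \<sigma> j k s \<omega>))"
  shows "measure (completion M) {\<omega> \<in> space M.
           (\<forall>t\<ge>0. S \<omega> < ennreal t \<and> ennreal t \<le> T \<omega> \<longrightarrow> total_process J T \<rho> t \<omega> > 0) \<and> S \<omega> < T \<omega>}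
         = measure (completion M) {\<omega> \<in> space M. S \<omega> < T \<omega>}"
proof -
  interpret filtered_prob_space M F by (rule fps)
  define n where "n = real (card J)"
  \<comment> \<open>the maximal growth rate of the bracket of \<open>N\<close>\<close>
  define q where "q = n + n * (n - 1) / 2"
  define \<kappa> where "\<kappa> = (1 - 2 * \<alpha>) / 2"
  define X where "X = (\<lambda>t \<omega>. \<Sum>j\<in>J. \<rho> j t \<omega>)"
  define N where "N = (\<lambda>t \<omega>. \<Sum>j\<in>J. B j t \<omega>)"
  define L where "L = (\<lambda>t \<omega>. n * t + (\<Sum>j\<in>J. \<Sum>k\<in>J - {j}. A j k t \<omega>))"
  define I where "I = active_times S T"
  \<comment> \<open>\<open>I\<close> is the set of finite times in \<open>[S,T)\<close>, and \<open>a\<close> is its minimum whenever \<open>S < T\<close>\<close>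
  define a where "a = (\<lambda>\<omega>. enn2real (S \<omega>))"
  have n: "2 \<le> n" using J by (simp add: n_def)
  have J0: "J \<noteq> {}" using J by auto
  have q: "0 < q" using n by (simp add: q_def add_pos_nonneg)
  \<comment> \<open>the condition on \<open>\<alpha>\<close>: it makes the lower bound \<open>\<kappa> n\<^sup>2 / X\<close> of the drift at least \<open>q / (2 X)\<close>\<close>
  have \<kappa>: "0 < \<kappa>" "q \<le> 2 * \<kappa> * n\<^sup>2"
    using alpha_pos alpha q unfolding \<kappa>_def n_def[symmetric] q_def[symmetric]
    by (auto simp: field_simps)
  obtain C where C: "\<And>j. j \<in> J \<Longrightarrow> AE \<omega> in M. \<forall>s\<in>I \<omega>. \<bar>\<mu> j s \<omega>\<bar> \<le> C"
    using mu_bounded by (auto simp: I_def)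

  have N_cont: "AE \<omega> in M. continuous_on {0..} (\<lambda>t. N t \<omega>)"
  proof -
    have "AE \<omega> in M. \<forall>j\<in>J. continuous_on {0..} (\<lambda>t. B j t \<omega>)"
      using bm J(1) by (intro AE_finite_allI) (auto simp: brownian_motion_def)
    then show ?thesis unfolding N_def by eventually_elim (auto intro: continuous_on_sum)
  qed
  have L_cont: "AE \<omega> in M. continuous_on {0..} (\<lambda>t. L t \<omega>)"
  proof -
    have "AE \<omega> in M. \<forall>j\<in>J. \<forall>k\<in>J - {j}. continuous_on {0..} (\<lambda>t. A j k t \<omega>)"
      using cov J(1) by (intro AE_finite_allI) (auto simp: covariation_def)
    then show ?thesis unfolding L_def by eventually_elim (auto intro!: continuous_intros)
  qed

  have seg: "{s..t} \<subseteq> I \<omega>" "a \<omega> \<le> s" "S \<omega> < T \<omega>" "a \<omega> \<le> t" if "s \<in> I \<omega>" "t \<in> I \<omega>" for s t \<omega>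
    using active_times_segment[of s S T \<omega>] active_times_segment[of t S T \<omega>] that
    by (auto simp: I_def a_def)

  \<comment> \<open>the bracket grows at most at rate \<open>q\<close> before \<open>T\<close>: here the bound on the \<open>\<sigma> j k\<close> enters\<close>
  have L_grow: "AE \<omega> in M. \<forall>s\<in>I \<omega>. \<forall>t\<in>I \<omega>. s \<le> t \<longrightarrow> \<bar>L t \<omega> - L s \<omega>\<bar> \<le> q * (t - s)"
  proof -
    have "AE \<omega> in M. \<forall>j\<in>J. \<forall>k\<in>J - {j}. S \<omega> < T \<omega> \<longrightarrow>
        esssup (restrict_space lborel (active_times S T \<omega>)) (\<lambda>s. ereal \<bar>\<sigma> j k s \<omega>\<bar>) \<le> 1"
      using sigma_bound J(1) by (intro AE_finite_allI) auto
    moreover have "AE \<omega> in M. \<forall>j\<in>J. \<forall>k\<in>J - {j}. S \<omega> < T \<omega> \<longrightarrow>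
          (\<forall>t\<in>active_times S T \<omega>. A j k t \<omega> - A j k (enn2real (S \<omega>)) \<omega>
             = 1 / 2 * (LBINT s:{enn2real (S \<omega>)..t}. \<sigma> j k s \<omega>))"
      using cov_sigma J(1) by (intro AE_finite_allI) auto
    ultimately show ?thesis using AE_space
    proof eventually_elim
      case (elim \<omega>)
      show ?case
      proof (intro ballI impI)
        fix s t assume s: "s \<in> I \<omega>" and t: "t \<in> I \<omega>" and st: "s \<le> t"
        note sg = seg[OF s t]
        have start: "a \<omega> \<in> I \<omega>" using active_times_start[where S=S and T=T, OF sg(3)] by (simp add: a_def I_def)
        have A: "\<bar>A j k t \<omega> - A j k s \<omega>\<bar> \<le> 1 / 2 * (t - s)" if jk: "j \<in> J" "k \<in> J - {j}" for j k
        proof -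
          have m: "set_borel_measurable lborel {v..w} (\<lambda>s. \<sigma> j k s \<omega>)" if "v \<in> I \<omega>" "w \<in> I \<omega>" for v w
            using sigma_prog[of j k] jk elim(3) seg(1)[OF that] by (intro progressive_path) (auto simp: I_def)
          have b: "AE s in lborel. s \<in> I \<omega> \<longrightarrow> \<bar>\<sigma> j k s \<omega>\<bar> \<le> 1"
            using elim(1) jk sg(3) unfolding I_def by (intro esssup_active_times) auto
          have b': "AE r in lborel. r \<in> {v..w} \<longrightarrow> \<bar>\<sigma> j k r \<omega>\<bar> \<le> 1" if "v \<in> I \<omega>" "w \<in> I \<omega>" for v w
            using b by eventually_elim (use seg(1)[OF that] in blast)
          have int: "set_integrable lborel {a \<omega>..t} (\<lambda>s. \<sigma> j k s \<omega>)"
            by (rule LBINT_abs_le_length(1)[OF m[OF start t] sg(4) b'[OF start t]])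
          have A_eq: "A j k v \<omega> - A j k (a \<omega>) \<omega> = 1 / 2 * (LBINT s:{a \<omega>..v}. \<sigma> j k s \<omega>)" if "v \<in> I \<omega>" for v
            using elim(2) jk sg(3) that unfolding I_def a_def by blast
          have "A j k t \<omega> - A j k s \<omega> = 1 / 2 * (LBINT r:{s..t}. \<sigma> j k r \<omega>)"
            using A_eq[OF s] A_eq[OF t] LBINT_increment[OF int sg(2) st] by (simp add: field_simps)
          then show ?thesis
            using LBINT_abs_le_length(2)[OF m[OF s t] st b'[OF s t]] by (simp only: abs_le_iff) linarith
        qed
        have "L t \<omega> - L s \<omega> = n * (t - s) + (\<Sum>j\<in>J. \<Sum>k\<in>J - {j}. A j k t \<omega> - A j k s \<omega>)"
          by (simp add: L_def sum_subtractf algebra_simps)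
        also have "\<bar>\<dots>\<bar> \<le> n * (t - s) + (\<Sum>j\<in>J. \<Sum>k\<in>J - {j}. 1 / 2 * (t - s))"
        proof -
          have "\<bar>\<Sum>j\<in>J. \<Sum>k\<in>J - {j}. A j k t \<omega> - A j k s \<omega>\<bar> \<le> (\<Sum>j\<in>J. \<Sum>k\<in>J - {j}. 1 / 2 * (t - s))"
            by (intro order_trans[OF sum_abs] sum_mono A)
          moreover have "\<bar>n * (t - s)\<bar> = n * (t - s)" using n st by simp
          ultimately show ?thesis by linarith
        qed
        also have "(\<Sum>j\<in>J. \<Sum>k\<in>J - {j}. 1 / 2 * (t - s)) = (\<Sum>j\<in>J. (n - 1) * (1 / 2 * (t - s)))"
          using J by (intro sum.cong refl) (simp add: n_def of_nat_diff)
        also have "n * (t - s) + \<dots> = q * (t - s)"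
          by (simp add: n_def[symmetric] q_def algebra_simps)
        finally show "\<bar>L t \<omega> - L s \<omega>\<bar> \<le> q * (t - s)" .
      qed
    qed
  qed

  \<comment> \<open>what the equation implies on a single path: continuity, positive values arbitrarily close to \<open>S\<close>, and the critical drift\<close>
  have X_path: "AE \<omega> in M. continuous_on (I \<omega>) (\<lambda>t. X t \<omega>) \<and> (\<forall>t\<in>I \<omega>. 0 \<le> X t \<omega>) \<and>
    (\<forall>t\<in>I \<omega>. a \<omega> < t \<longrightarrow> (\<exists>x. a \<omega> < x \<and> x < t \<and> 0 < X x \<omega>)) \<and>
    (\<forall>s\<in>I \<omega>. \<forall>t\<in>I \<omega>. \<forall>b>0. s \<le> t \<longrightarrow> (\<forall>v\<in>{s..t}. X v \<omega> \<le> b) \<longrightarrow>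
      N t \<omega> - N s \<omega> + q / (2 * b) * (t - s) \<le> X t \<omega> - X s \<omega>)"
  proof -
    have "AE \<omega> in M. \<forall>j\<in>J. \<forall>s\<in>I \<omega>. 0 \<le> \<rho> j s \<omega>"
      using rho_nonneg J(1) by (intro AE_finite_allI) (auto simp: I_def)
    moreover have "AE \<omega> in M. \<forall>j\<in>J. \<forall>s\<in>I \<omega>. \<bar>\<mu> j s \<omega>\<bar> \<le> C"
      using C J(1) by (intro AE_finite_allI)
    ultimately show ?thesis using AE_space sde inv_integrable mu_lower N_cont
    proof eventually_elim
      case (elim \<omega>)
      let ?D = "\<lambda>r. \<Sum>j\<in>J. \<mu> j r \<omega> / \<rho> j r \<omega>"
      have X0: "0 \<le> X t \<omega>" if "t \<in> I \<omega>" for t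
        unfolding X_def using elim(1) that by (intro sum_nonneg) auto
      have start: "a \<omega> \<in> I \<omega>" if "t \<in> I \<omega>" for t
        using active_times_start[where S=S and T=T, OF seg(3)[OF that that]] by (simp add: a_def I_def)
      have X_eq: "X t \<omega> = X (a \<omega>) \<omega> + (LBINT r:{a \<omega>..t}. ?D r) + (N t \<omega> - N (a \<omega>) \<omega>)" if "t \<in> I \<omega>" for t
        using elim(4) seg(3)[OF that that] that unfolding I_def a_def X_def N_def sum_subtractf by blast
      have meas: "set_borel_measurable lborel {s..t} (\<lambda>r. \<rho> j r \<omega>)" "set_borel_measurable lborel {s..t} (\<lambda>r. \<mu> j r \<omega>)"
        if "s \<in> I \<omega>" "t \<in> I \<omega>" "j \<in> J" for s t j
        using that rho_prog mu_prog elim(3) seg(1)[OF that(1,2)] by (auto intro!: progressive_path simp: I_def)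
      have fin: "(\<integral>\<^sup>+ r \<in> {s..t}. (\<Sum>j\<in>J. 1 / ennreal (\<rho> j r \<omega>)) \<partial>lborel) < \<infinity>" if st: "s \<in> I \<omega>" "t \<in> I \<omega>" for s t
      proof -
        have "(\<integral>\<^sup>+ r \<in> {s..t}. (\<Sum>j\<in>J. 1 / ennreal (\<rho> j r \<omega>)) \<partial>lborel) \<le> (\<integral>\<^sup>+ r \<in> {a \<omega>..t}. (\<Sum>j\<in>J. 1 / ennreal (\<rho> j r \<omega>)) \<partial>lborel)"
          using seg(2)[OF st] by (intro nn_integral_mono) (auto simp: indicator_def)
        also have "\<dots> < \<infinity>" using elim(5) seg(3)[OF st] st(2) unfolding I_def a_def by blast
        finally show ?thesis .
      qed
      have dr: "AE r in lborel. r \<in> {s..t} \<longrightarrow> (\<forall>j\<in>J. 0 < \<rho> j r \<omega>)"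
        "set_integrable lborel {s..t} ?D"
        "\<And>b. s \<le> t \<Longrightarrow> 0 < b \<Longrightarrow> (\<And>r. r \<in> {s..t} \<Longrightarrow> (\<Sum>j\<in>J. \<rho> j r \<omega>) \<le> b) \<Longrightarrow> \<kappa> * n\<^sup>2 / b * (t - s) \<le> (LBINT r:{s..t}. ?D r)"
        if st: "s \<in> I \<omega>" "t \<in> I \<omega>" for s t
      proof -
        have x0: "0 \<le> \<rho> j r \<omega>" "\<bar>\<mu> j r \<omega>\<bar> \<le> C" if "j \<in> J" "r \<in> {s..t}" for j r
          using elim(1,2) seg(1)[OF st] that by auto
        note R = reciprocal_drift[of J s t "\<lambda>j r. \<rho> j r \<omega>" "\<lambda>j r. \<mu> j r \<omega>", OF J(1) J0 meas[OF st] x0 fin[OF st]]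
        show "AE r in lborel. r \<in> {s..t} \<longrightarrow> (\<forall>j\<in>J. 0 < \<rho> j r \<omega>)" by (rule R(1))
        show "set_integrable lborel {s..t} ?D" by (rule R(2))
        have low: "AE r in lborel. r \<in> {s..t} \<longrightarrow> (\<forall>j\<in>J. \<kappa> \<le> \<mu> j r \<omega>)"
        proof -
          have "AE r in lborel. \<forall>j\<in>J. r \<in> I \<omega> \<longrightarrow> \<kappa> \<le> \<mu> j r \<omega>"
            using elim(6) seg(3)[OF st] J(1) by (intro AE_finite_allI) (auto simp: I_def \<kappa>_def)
          then show ?thesis by eventually_elim (use seg(1)[OF st] in blast)
        qed
        show "\<kappa> * n\<^sup>2 / b * (t - s) \<le> (LBINT r:{s..t}. ?D r)"
          if "s \<le> t" "0 < b" "\<And>r. r \<in> {s..t} \<Longrightarrow> (\<Sum>j\<in>J. \<rho> j r \<omega>) \<le> b" for b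
          unfolding n_def using that \<kappa>(1) low by (intro R(3)) auto
      qed
      have cont: "continuous_on (I \<omega>) (\<lambda>t. X t \<omega>)"
      proof (rule continuous_on_initial_segments[where a="a \<omega>"])
        fix t assume t: "t \<in> I \<omega>"
        have a0: "0 \<le> a \<omega>" by (simp add: a_def)
        have "continuous_on {a \<omega>..t} (\<lambda>s. integral {a \<omega>..s} ?D)"
          by (intro indefinite_integral_continuous_1 set_borel_integral_eq_integral(1) dr(2)[OF start[OF t] t])
        moreover have "integral {a \<omega>..s} ?D = (LBINT r:{a \<omega>..s}. ?D r)" if "s \<in> {a \<omega>..t}" for s
          using that seg(1)[OF start[OF t] t] by (intro set_borel_integral_eq_integral(2)[symmetric] dr(2) start[OF t]) auto
        ultimately have "continuous_on {a \<omega>..t} (\<lambda>s. LBINT r:{a \<omega>..s}. ?D r)"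
          by (rule continuous_on_eq)
        moreover have "continuous_on {a \<omega>..t} (\<lambda>s. N s \<omega>)"
          by (rule continuous_on_subset[OF elim(7)]) (use a0 in auto)
        ultimately have "continuous_on {a \<omega>..t} (\<lambda>s. X (a \<omega>) \<omega> + (LBINT r:{a \<omega>..s}. ?D r) + (N s \<omega> - N (a \<omega>) \<omega>))"
          by (intro continuous_intros)
        then show "continuous_on {a \<omega>..t} (\<lambda>t. X t \<omega>)"
          by (rule continuous_on_eq) (use seg(1)[OF start[OF t] t] X_eq in auto)
      qed (use seg(2) in blast)
      \<comment> \<open>almost every time is a time at which all \<open>\<rho> j\<close> are positive\<close>
      have pos: "\<exists>x. a \<omega> < x \<and> x < t \<and> 0 < X x \<omega>" if t: "t \<in> I \<omega>" "a \<omega> < t" for t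
      proof (rule ccontr)
        assume no: "\<not> ?thesis"
        have "AE r in lborel. r \<notin> {a \<omega><..<t}"
          using dr(1)[OF start[OF t(1)] t(1)]
        proof eventually_elim
          case (elim r)
          show ?case
          proof
            assume r: "r \<in> {a \<omega><..<t}"
            then have "0 < X r \<omega>" unfolding X_def using elim J(1) J0 by (intro sum_pos) auto
            then show False using no r by auto
          qed
        qed
        then have "emeasure lborel {a \<omega><..<t} = 0"
          by (subst (asm) AE_iff_measurable[where N="{a \<omega><..<t}"]) auto
        then show False using t(2) by simp
      qed
      have drift: "N t \<omega> - N s \<omega> + q / (2 * b) * (t - s) \<le> X t \<omega> - X s \<omega>"
        if st: "s \<in> I \<omega>" "t \<in> I \<omega>" "0 < b" "s \<le> t" "\<And>v. v \<in> {s..t} \<Longrightarrow> X v \<omega> \<le> b" for s t b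
      proof -
        have "q / (2 * b) * (t - s) \<le> \<kappa> * n\<^sup>2 / b * (t - s)"
          using \<kappa>(2) st by (intro mult_right_mono) (auto simp: field_simps)
        also have "\<dots> \<le> (LBINT r:{s..t}. ?D r)"
          using st(5) by (intro dr(3)[OF st(1,2,4,3)]) (auto simp: X_def)
        also have "\<dots> = (LBINT r:{a \<omega>..t}. ?D r) - (LBINT r:{a \<omega>..s}. ?D r)"
          by (rule LBINT_increment[symmetric]) (use st seg(2) start dr(2) in auto)
        finally show ?thesis using X_eq[OF st(1)] X_eq[OF st(2)] by linarith
      qed
      show ?case using cont X0 pos drift by blast
    qed
  qed

  \<comment> \<open>the process is restarted at a deterministic time at which it is alive and at least \<open>\<epsilon>\<close>\<close>
  define \<Gamma> where "\<Gamma> = (\<lambda>r \<epsilon>. {\<omega> \<in> space M. r \<in> I \<omega> \<and> \<epsilon> \<le> X r \<omega>})"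
  have X_adapted: "(\<lambda>\<omega>. if t \<in> I \<omega> then X t \<omega> else 0) \<in> borel_measurable (F (ennreal t))" if "0 \<le> t" for t
  proof -
    have "(\<lambda>\<omega>. \<Sum>j\<in>J. if t \<in> active_times S T \<omega> then \<rho> j t \<omega> else 0) \<in> borel_measurable (F (ennreal t))"
      using rho_prog that by (intro borel_measurable_sum progressive_at)
    also have "(\<lambda>\<omega>. \<Sum>j\<in>J. if t \<in> active_times S T \<omega> then \<rho> j t \<omega> else 0) = (\<lambda>\<omega>. if t \<in> I \<omega> then X t \<omega> else 0)"
      by (auto simp: X_def I_def)
    finally show ?thesis .
  qed
  have I_sets: "{\<omega> \<in> space M. t \<in> I \<omega>} \<in> sets (F (ennreal t))" if "0 \<le> t" for t
  proof -
    have [measurable]: "Measurable.pred (F (ennreal t)) (\<lambda>\<omega>. S \<omega> \<le> ennreal t)"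
      "Measurable.pred (F (ennreal t)) (\<lambda>\<omega>. ennreal t < T \<omega>)"
      using stopping_timeD[OF S] stopping_timeD2[OF T] by auto
    have "{\<omega> \<in> space (F (ennreal t)). S \<omega> \<le> ennreal t \<and> ennreal t < T \<omega>} \<in> sets (F (ennreal t))"
      by measurable
    then show ?thesis using that by (simp add: I_def active_times_def space_F)
  qed
  have \<Gamma>_sets: "\<Gamma> r \<epsilon> \<in> sets (F (ennreal r))" if r: "0 \<le> r" for r \<epsilon>
  proof -
    note [measurable] = X_adapted[OF r] I_sets[OF r]
    have "{\<omega> \<in> space M. r \<in> I \<omega>} \<inter> {\<omega> \<in> space (F (ennreal r)). \<epsilon> \<le> (if r \<in> I \<omega> then X r \<omega> else 0)} \<in> sets (F (ennreal r))"
      by measurable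
    moreover have "{\<omega> \<in> space M. r \<in> I \<omega>} \<inter> {\<omega> \<in> space (F (ennreal r)). \<epsilon> \<le> (if r \<in> I \<omega> then X r \<omega> else 0)} = \<Gamma> r \<epsilon>"
      by (auto simp: \<Gamma>_def space_F)
    ultimately show ?thesis by simp
  qed

  have core: "AE \<omega> in M. \<omega> \<in> \<Gamma> r \<epsilon> \<longrightarrow> (\<forall>t. r < t \<longrightarrow> t \<le> u \<longrightarrow> ennreal t \<le> T \<omega> \<longrightarrow>
     has_nonzero_left_limit (\<lambda>s. X s \<omega>) t)"
    if r: "0 \<le> r" "r < u" and \<epsilon>: "0 < \<epsilon>" for r u \<epsilon>
  proof -
    have \<Gamma>_I: "t \<in> I \<omega>" if "\<omega> \<in> \<Gamma> r \<epsilon>" "r \<le> t" "ennreal t < T \<omega>" for \<omega> t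
      using that r(1) by (auto simp: \<Gamma>_def I_def active_times_def intro: order_trans[OF _ ennreal_leI])
    have crit: "critical_drift_process M F T (\<Gamma> r \<epsilon>) X N L q (3 * n ^ 4) r u"
    proof (intro critical_drift_process.intro[OF fps] critical_drift_process_axioms.intro)
      show "ennreal r < T \<omega>" if "\<omega> \<in> \<Gamma> r \<epsilon>" for \<omega> using that by (auto simp: \<Gamma>_def I_def active_times_def)
      show "(\<lambda>\<omega>. if \<omega> \<in> \<Gamma> r \<epsilon> \<and> ennreal t < T \<omega> then X t \<omega> else 0) \<in> borel_measurable (F (ennreal t))"
        if t: "r \<le> t" "t \<le> u" for t
      proof -
        have t0: "0 \<le> t" using r t by simp
        have [measurable]: "\<Gamma> r \<epsilon> \<in> sets (F (ennreal t))"
          using \<Gamma>_sets[OF r(1)] sets_F_mono[of "ennreal r" "ennreal t"] t by (auto intro: ennreal_leI)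
        note [measurable] = X_adapted[OF t0] I_sets[OF t0]
        have "(\<lambda>\<omega>. if \<omega> \<in> \<Gamma> r \<epsilon> then (if t \<in> I \<omega> then X t \<omega> else 0) else 0) \<in> borel_measurable (F (ennreal t))"
          by measurable
        also have "(\<lambda>\<omega>. if \<omega> \<in> \<Gamma> r \<epsilon> then (if t \<in> I \<omega> then X t \<omega> else 0) else 0) =
          (\<lambda>\<omega>. if \<omega> \<in> \<Gamma> r \<epsilon> \<and> ennreal t < T \<omega> then X t \<omega> else 0)"
          using \<Gamma>_I[OF _ t(1)] by (auto simp: fun_eq_iff) (auto simp: I_def active_times_def)
        finally show ?thesis .
      qed
      show "N t \<in> borel_measurable (F (ennreal t))" if "r \<le> t" "t \<le> u" for t
        unfolding N_def using r that bm by (intro borel_measurable_sum brownian_adapted) auto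
      show "L t \<in> borel_measurable (F (ennreal t))" if "r \<le> t" "t \<le> u" for t
        unfolding L_def using r that cov by (intro borel_measurable_add borel_measurable_sum) (auto simp: covariation_def)
      show "integrable M (L t)" if "r \<le> t" "t \<le> u" for t
      proof -
        have "integrable M (A j k t)" if "j \<in> J" "k \<in> J - {j}" for j k
          using that r \<open>r \<le> t\<close> by (intro covariation_integrable[OF bm bm cov, of j k]) auto
        then show ?thesis
          unfolding L_def by (intro Bochner_Integration.integrable_add Bochner_Integration.integrable_sum) auto
      qed
      show "integrable M (\<lambda>\<omega>. (N t \<omega> - N s \<omega>) ^ 4)" "expectation (\<lambda>\<omega>. (N t \<omega> - N s \<omega>) ^ 4) \<le> 3 * n ^ 4 * (t - s)\<^sup>2"
        if "r \<le> s" "s \<le> t" "t \<le> u" for s t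
        unfolding N_def n_def using brownian_sum_fourth_moment[of J B s t] bm r that by auto
      show "expectation (\<lambda>\<omega>. Y \<omega> * (N t \<omega> - N s \<omega>)) = 0"
        if "r \<le> s" "s \<le> t" "t \<le> u" "Y \<in> borel_measurable (F (ennreal s))" "\<And>\<omega>. \<bar>Y \<omega>\<bar> \<le> b" for s t Y b
        unfolding N_def by (rule brownian_sum_martingale[OF bm]) (use that r in auto)
      show "expectation (\<lambda>\<omega>. Y \<omega> * (N t \<omega> - N s \<omega>)\<^sup>2) = expectation (\<lambda>\<omega>. Y \<omega> * (L t \<omega> - L s \<omega>))"
        if "r \<le> s" "s \<le> t" "t \<le> u" "Y \<in> borel_measurable (F (ennreal s))" "\<And>\<omega>. \<bar>Y \<omega>\<bar> \<le> b" for s t Y b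
        unfolding N_def L_def n_def by (rule brownian_sum_bracket[OF J(1) bm cov]) (use that r in auto)
      show "AE \<omega> in M. continuous_on {r..u} (\<lambda>t. N t \<omega>)"
        using N_cont by eventually_elim (erule continuous_on_subset, use r in auto)
      show "AE \<omega> in M. continuous_on {r..u} (\<lambda>t. L t \<omega>)"
        using L_cont by eventually_elim (erule continuous_on_subset, use r in auto)
      show "AE \<omega> in M. \<omega> \<in> \<Gamma> r \<epsilon> \<longrightarrow> continuous_on {t \<in> {r..u}. ennreal t < T \<omega>} (\<lambda>t. X t \<omega>)"
        using X_path by eventually_elim (auto elim!: continuous_on_subset dest: \<Gamma>_I)
      show "AE \<omega> in M. \<omega> \<in> \<Gamma> r \<epsilon> \<longrightarrow> (\<forall>s t. r \<le> s \<longrightarrow> s \<le> t \<longrightarrow> t \<le> u \<longrightarrow> ennreal t < T \<omega> \<longrightarrow>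
        \<bar>L t \<omega> - L s \<omega>\<bar> \<le> q * (t - s))"
        using L_grow
      proof eventually_elim
        case (elim \<omega>)
        show ?case
        proof (intro impI allI)
          fix s t assume a: "\<omega> \<in> \<Gamma> r \<epsilon>" "r \<le> s" "s \<le> t" "t \<le> u" "ennreal t < T \<omega>"
          have "s \<in> I \<omega>" "t \<in> I \<omega>" using a by (auto intro!: \<Gamma>_I le_less_trans[OF ennreal_leI a(5)])
          then show "\<bar>L t \<omega> - L s \<omega>\<bar> \<le> q * (t - s)" using elim a(3) by blast
        qed
      qed
      show "AE \<omega> in M. \<omega> \<in> \<Gamma> r \<epsilon> \<longrightarrow> (\<forall>s t b. r \<le> s \<longrightarrow> s \<le> t \<longrightarrow> t \<le> u \<longrightarrow> ennreal t < T \<omega> \<longrightarrow>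
        0 < b \<longrightarrow> (\<forall>v\<in>{s..t}. X v \<omega> \<le> b) \<longrightarrow>
        N t \<omega> - N s \<omega> + q / (2 * b) * (t - s) \<le> X t \<omega> - X s \<omega>)"
        using X_path
      proof eventually_elim
        case (elim \<omega>)
        show ?case
        proof (intro impI allI)
          fix s t b assume a: "\<omega> \<in> \<Gamma> r \<epsilon>" "r \<le> s" "s \<le> t" "t \<le> u" "ennreal t < T \<omega>"
            and b: "0 < b" "\<forall>v\<in>{s..t}. X v \<omega> \<le> b"
          have "s \<in> I \<omega>" "t \<in> I \<omega>" using a by (auto intro!: \<Gamma>_I le_less_trans[OF ennreal_leI a(5)])
          then show "N t \<omega> - N s \<omega> + q / (2 * b) * (t - s) \<le> X t \<omega> - X s \<omega>" using elim a(3) b by blast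
        qed
      qed
    qed (use r q T \<Gamma>_sets in auto)
    show ?thesis
      by (rule critical_drift_process.left_limit_nonzero[OF crit \<epsilon>]) (simp add: \<Gamma>_def)
  qed

  have good: "AE \<omega> in M. S \<omega> < T \<omega> \<longrightarrow>
    (\<forall>t\<ge>0. S \<omega> < ennreal t \<and> ennreal t \<le> T \<omega> \<longrightarrow> total_process J T \<rho> t \<omega> > 0)"
  proof -
    \<comment> \<open>starting times, levels and horizons from countable sets, so that one null set suffices\<close>
    have "AE \<omega> in M. \<forall>p::rat. \<forall>k m::nat. 0 \<le> real_of_rat p \<longrightarrow> \<omega> \<in> \<Gamma> (real_of_rat p) (inverse (real (Suc k))) \<longrightarrow>
      (\<forall>t. real_of_rat p < t \<longrightarrow> t \<le> real_of_rat p + real (Suc m) \<longrightarrow> ennreal t \<le> T \<omega> \<longrightarrow>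
      has_nonzero_left_limit (\<lambda>s. X s \<omega>) t)"
      (is "AE \<omega> in M. \<forall>p k m. ?Q \<omega> p k m")
    proof (unfold AE_all_countable, intro allI)
      fix p :: rat and k m :: nat
      show "AE \<omega> in M. ?Q \<omega> p k m"
        using core[of "real_of_rat p" "real_of_rat p + real (Suc m)" "inverse (real (Suc k))"]
        by (cases "0 \<le> real_of_rat p") auto
    qed
    then show ?thesis using X_path AE_space
    proof eventually_elim
      case (elim \<omega>)
      show ?case
      proof (intro impI allI, elim conjE)
        fix t assume ST: "S \<omega> < T \<omega>" and t: "0 \<le> t" "S \<omega> < ennreal t" "ennreal t \<le> T \<omega>"
        have start: "a \<omega> \<in> I \<omega>" using active_times_start[where S=S and T=T, OF ST] by (simp add: a_def I_def)
        have a0: "0 \<le> a \<omega>" by (simp add: a_def)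
        have Sa: "S \<omega> = ennreal (a \<omega>)" using active_times_segment(3) start by (auto simp: I_def a_def)
        have at: "a \<omega> < t" using t(2) a0 unfolding Sa by (simp add: ennreal_less_iff)
        have inI: "v \<in> I \<omega>" if "a \<omega> \<le> v" "v < t" for v
          using that a0 t(3) less_le_trans[OF ennreal_lessI t(3), of v]
          unfolding I_def active_times_def Sa by (auto intro: ennreal_leI)
        \<comment> \<open>a rational time \<open>p\<close> with \<open>X p > 0\<close> between the starting time and \<open>t\<close>\<close>
        define t1 where "t1 = (a \<omega> + t) / 2"
        have t1: "a \<omega> < t1" "t1 < t" using at by (auto simp: t1_def)
        then obtain x where x: "a \<omega> < x" "x < t1" "0 < X x \<omega>"
          using elim(2) inI[of t1] by auto
        have "continuous_on {a \<omega>..x} (\<lambda>t. X t \<omega>)"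
          by (rule continuous_on_subset[OF conjunct1[OF elim(2)]]) (use x t1 in \<open>auto intro: inI\<close>)
        then have "((\<lambda>s. X s \<omega>) \<longlongrightarrow> X x \<omega>) (at_left x)"
          using x by (auto simp: continuous_on_eq_continuous_within continuous_within at_within_Icc_at_left dest!: bspec[of _ _ x])
        from order_tendstoD(1)[OF this x(3)] obtain d where d: "d < x" "\<And>y. d < y \<Longrightarrow> y < x \<Longrightarrow> 0 < X y \<omega>"
          by (auto simp: eventually_at_left_field)
        have "max d (a \<omega>) < x" using d x by simp
        then obtain p where p: "max d (a \<omega>) < real_of_rat p" "real_of_rat p < x" using of_rat_dense by blast
        have Xp: "0 < X (real_of_rat p) \<omega>" using d p by auto
        obtain k where k: "inverse (real (Suc k)) < X (real_of_rat p) \<omega>" using reals_Archimedean[OF Xp] by blast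
        have pI: "real_of_rat p \<in> I \<omega>" using p x t1 by (intro inI) auto
        have "\<omega> \<in> \<Gamma> (real_of_rat p) (inverse (real (Suc k)))"
          using pI k elim(3) by (simp add: \<Gamma>_def)
        moreover obtain m where "t - real_of_rat p < real m" using reals_Archimedean2 by blast
        then have "t \<le> real_of_rat p + real (Suc m)" by simp
        moreover have "0 \<le> real_of_rat p" "real_of_rat p < t" using p a0 x t1 by linarith+
        ultimately have lim: "has_nonzero_left_limit (\<lambda>s. X s \<omega>) t"
          using elim(1) t(3) by blast
        show "0 < total_process J T \<rho> t \<omega>"
          by (rule left_limit_imp_total_process_pos[where S = S and T = T, OF t(2,1,3)])
            (use elim(2) lim in \<open>auto simp: X_def I_def\<close>)
      qed
    qed
  qed

  let ?E = "{\<omega> \<in> space M. S \<omega> < T \<omega>}"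
  let ?G = "{\<omega> \<in> space M. (\<forall>t\<ge>0. S \<omega> < ennreal t \<and> ennreal t \<le> T \<omega> \<longrightarrow> total_process J T \<rho> t \<omega> > 0) \<and> S \<omega> < T \<omega>}"
  have [measurable]: "S \<in> borel_measurable M" "T \<in> borel_measurable M"
    using S T sets_F_M by (auto intro!: measurable_stopping_time simp: space_F)
  have E: "?E \<in> sets M" by measurable
  obtain Z where Z: "Z \<in> null_sets M" "{\<omega> \<in> space M. \<not> (S \<omega> < T \<omega> \<longrightarrow>
    (\<forall>t\<ge>0. S \<omega> < ennreal t \<and> ennreal t \<le> T \<omega> \<longrightarrow> total_process J T \<rho> t \<omega> > 0))} \<subseteq> Z"
    using good by (auto simp: eventually_ae_filter)
  have G_eq: "?G = (?E - Z) \<union> (?G \<inter> Z)" using Z(2) by blast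
  \<comment> \<open>the event on the left involves uncountably many times; it differs from a measurable set by part of a null set\<close>
  have "?G \<in> sets (completion M)"
    by (rule sets_completionI[OF G_eq]) (use Z E in auto)
  moreover have "AE \<omega> in completion M. \<omega> \<in> ?G \<longleftrightarrow> \<omega> \<in> ?E"
    by (rule AE_completion) (use good in \<open>eventually_elim, auto\<close>)
  ultimately show ?thesis
    using E by (intro measure_eq_AE) auto
qed

end
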